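(* Let $G$ be a linear algebraic group over $\mathbb{R}$ with $G(\mathbb{R})$ compact, let $V$ be an affine $G$-variety over $\mathbb{R}$, let $\pi\colon V\to W=V/\!/G$ be the quotient morphism and $\rho\colon\mathbb{R}[V]\to\mathbb{R}[W]=\mathbb{R}[V]^G$ the Reynolds operator. Let $K\subset V(\mathbb{R})$ be basic closed and $G$-invariant, and let $M$ be a quadratic module in $\mathbb{R}[V]$. The following are equivalent: (i) $M$ solves the averaged $K$-moment problem; (ii) $\overline{\rho(M)}=\mathscr P_W(\pi K)$; (iii) $\rho(M)$ solves the (usual) $\pi(K)$-moment problem in $W$.
   Context: An affine $\mathbb{R}$-variety is a reduced affine scheme of finite type over $\mathbb{R}$. Standing assumption: $G(\mathbb{R})$ is Zariski dense in $G$; $G$ is reductive since $G(\mathbb{R})$ is compact. An affine $G$-variety is an affine $\mathbb{R}$-variety $V$ with an action $G\times V\to V$ by a morphism; $G(\mathbb{R})$ acts on $\mathbb{R}[V]$ by $f^g(x)=f(gx)$; $V/\!/G$ is the affine variety with coordinate ring $\mathbb{R}[V]^G$ and $\pi$ is induced by $\mathbb{R}[V]^G\subset\mathbb{R}[V]$. The Reynolds operator $\rho$ is the projection $\mathbb{R}[V]\to\mathbb{R}[V]^G$ along the unique $G$-stable complement of $\mathbb{R}[V]^G$. $G$-invariant subsets are those stable under $G(\mathbb{R})$. A linear functional $L\colon\mathbb{R}[V]\to\mathbb{R}$ is $G$-invariant if $L(f^g)=L(f)$ for all $f\in\mathbb{R}[V]$, $g\in G(\mathbb{R})$. A set in $V(\mathbb{R})$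 is basic closed if it is of the form $\{f_1\ge0,\dots,f_r\ge0\}$ with $f_i\in\mathbb{R}[V]$. A quadratic module in a ring $A$ is a subset $M$ with $1\in M$, $M+M\subset M$, $a^2M\subset M$ for all $a\in A$. $\mathscr P_W(\pi K)=\{f\in\mathbb{R}[W]\colon f\ge0\text{ on }\pi(K)\}$. The bar denotes closure in $\mathbb{R}[W]$ with respect to the finest locally convex vector space topology. "Measure" means (positive) Borel measure for which all functions in the relevant coordinate ring are integrable. $M$ solves the averaged $K$-moment problem if for every $G$-invariant linear functional $L\colon\mathbb{R}[V]\to\mathbb{R}$: there exists a $G$-invariant measure $\mu$ on $K$ with $L(f)=\int_Kf\,d\mu$ for all $f\in\mathbb{R}[V]$ if and only if $L(f)\ge0$ for every $f\in M$. (For $G$-invariant $L$, the existence of such a $G$-invariant $\mu$ is equivalent to each of: there is a measure $\mu$ on $K$ with $L(f)=\int_K f\,d\mu$ for all $f\in\mathbb{R}[V]^G$; there is a measure $\nu$ on $\pi(K)$ with $L(f)=\int_{\pi(K)}f\,d\nu$ for all $f\in\mathbb{R}[W]$; $L(f)\ge0$ for all $f\in\mathscr P_W(\pi K)$.) A quadratic module $N$ in $\mathbb{R}[W]$ solves the (usual) $\pi(K)$-moment problem in $W$ if the linear functionals $F\colon\mathbb{R}[W]\to\mathbb{R}$ with $F|_N\ge0$ are precisely those of the form $F(f)=\int_{\pi(K)}f\,d\nu$ with $\nu$ a Borel measure on $\pi(K)$. (The set $\rho(M)$ is a quadratic module in $\mathbb{R}[W]$.) *)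

theory Defs
  imports "HOL-Analysis.Analysis"
begin

section \<open>Commutative real algebras\<close>

text \<open>
  Affine real schemes are represented by their coordinate rings. The class asks for a unit but,
  unlike \<^class>\<open>comm_ring_1\<close>, not for \<open>0 \<noteq> 1\<close>, so that the empty variety (the zero ring) is
  not excluded.
\<close>

class real_comm_algebra = real_algebra + comm_ring + comm_monoid_mult

instance real :: real_comm_algebra ..

definition alg_hom :: "('a::real_comm_algebra \<Rightarrow> 'b::real_comm_algebra) \<Rightarrow> bool" where
  "alg_hom f \<longleftrightarrow> linear f \<and> f 1 = 1 \<and> (\<forall>x y. f (x * y) = f x * f y)"

definition subalgebra :: "'a::real_comm_algebra set \<Rightarrow> bool" where
  "subalgebra B \<longleftrightarrow> subspace B \<and> 1 \<in> B \<and> (\<forall>x\<in>B. \<forall>y\<in>B. x * y \<in> B)"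

section \<open>The tensor product over the reals\<close>

text \<open>
  A list \<open>[(a\<^sub>1, b\<^sub>1), \<dots>]\<close> stands for \<open>a\<^sub>1 \<otimes> b\<^sub>1 + \<dots>\<close>. By the universal property, and since linear
  functionals separate the points of a real vector space, two such sums agree in the tensor
  product iff every bilinear form takes the same value on both.
\<close>

definition tsum :: "('a \<Rightarrow> 'b \<Rightarrow> 'c::comm_monoid_add) \<Rightarrow> ('a \<times> 'b) list \<Rightarrow> 'c" where
  "tsum \<beta> xs = (\<Sum>(a, b)\<leftarrow>xs. \<beta> a b)"

lemma tsum_simps [simp]:
  "tsum \<beta> [] = 0" "tsum \<beta> ((a, b) # xs) = \<beta> a b + tsum \<beta> xs"
  "tsum \<beta> (xs @ ys) = tsum \<beta> xs + tsum \<beta> ys"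
  by (simp_all add: tsum_def)

definition tensor_rel ::
  "('a::real_vector \<times> 'b::real_vector) list \<Rightarrow> ('a \<times> 'b) list \<Rightarrow> bool" where
  "tensor_rel xs ys \<longleftrightarrow> (\<forall>\<beta> :: 'a \<Rightarrow> 'b \<Rightarrow> real. bilinear \<beta> \<longrightarrow> tsum \<beta> xs = tsum \<beta> ys)"

quotient_type (overloaded) ('a, 'b) tensor =
  "('a::real_vector \<times> 'b::real_vector) list" / tensor_rel
  by (auto intro!: equivpI reflpI sympI transpI simp: tensor_rel_def)

lift_definition tensor_pure ::
  "'a::real_vector \<Rightarrow> 'b::real_vector \<Rightarrow> ('a, 'b) tensor"  (infixr \<open>\<otimes>\<^sub>R\<close> 75)
  is "\<lambda>a b. [(a, b)]" .

lemma tsum_map_scale: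
  assumes "bilinear \<beta>"
  shows "tsum \<beta> (map (\<lambda>(a, b). (r *\<^sub>R a, b)) xs) = r *\<^sub>R tsum \<beta> xs"
  by (induction xs) (auto simp: bilinear_lmul[OF assms] scaleR_add_right)

lemma tsum_map_neg:
  assumes "bilinear \<beta>"
  shows "tsum \<beta> (map (\<lambda>(a, b). (- a, b)) xs) = - tsum \<beta> xs"
  by (induction xs) (auto simp: bilinear_lneg[OF assms])

instantiation tensor :: (real_vector, real_vector) real_vector
begin

lift_definition zero_tensor :: "('a, 'b) tensor" is "[]" .

lift_definition plus_tensor :: "('a, 'b) tensor \<Rightarrow> ('a, 'b) tensor \<Rightarrow> ('a, 'b) tensor"
  is "(@)" by (simp add: tensor_rel_def)

lift_definition uminus_tensor :: "('a, 'b) tensor \<Rightarrow> ('a, 'b) tensor"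
  is "map (\<lambda>(a, b). (- a, b))" by (simp add: tensor_rel_def tsum_map_neg)

lift_definition scaleR_tensor :: "real \<Rightarrow> ('a, 'b) tensor \<Rightarrow> ('a, 'b) tensor"
  is "\<lambda>r. map (\<lambda>(a, b). (r *\<^sub>R a, b))" by (simp add: tensor_rel_def tsum_map_scale)

definition minus_tensor :: "('a, 'b) tensor \<Rightarrow> ('a, 'b) tensor \<Rightarrow> ('a, 'b) tensor" where
  "minus_tensor s t = s + - t"

instance
proof
  fix x y z :: "('a, 'b) tensor" and r s :: real
  show "x + y + z = x + (y + z)" by transfer (simp add: tensor_rel_def)
  show "x + y = y + x" by transfer (simp add: tensor_rel_def)
  show "0 + x = x" by transfer (simp add: tensor_rel_def)
  show "- x + x = 0" by transfer (simp add: tensor_rel_def tsum_map_neg)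
  show "x - y = x + - y" by (simp add: minus_tensor_def)
  show "r *\<^sub>R (x + y) = r *\<^sub>R x + r *\<^sub>R y" by transfer (simp add: tensor_rel_def)
  show "(r + s) *\<^sub>R x = r *\<^sub>R x + s *\<^sub>R x"
    by transfer (simp add: tensor_rel_def tsum_map_scale distrib_right)
  show "r *\<^sub>R s *\<^sub>R x = (r * s) *\<^sub>R x"
    by transfer (simp add: tensor_rel_def tsum_map_scale del: map_map)
  show "1 *\<^sub>R x = x" by transfer (simp add: tensor_rel_def tsum_map_scale)
qed

end

definition tmul ::
  "('a::times \<times> 'b::times) list \<Rightarrow> ('a \<times> 'b) list \<Rightarrow> ('a \<times> 'b) list" where
  "tmul xs ys = concat (map (\<lambda>(a, b). map (\<lambda>(a', b'). (a * a', b * b')) ys) xs)"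

lemma tsum_tmul:
  "tsum \<beta> (tmul xs ys) = tsum (\<lambda>a b. tsum (\<lambda>a' b'. \<beta> (a * a') (b * b')) ys) xs"
proof (induction xs)
  case (Cons p xs)
  obtain a b where p: "p = (a, b)" by (cases p)
  have "tsum \<beta> (map (\<lambda>(a', b'). (a * a', b * b')) ys) = tsum (\<lambda>a' b'. \<beta> (a * a') (b * b')) ys"
    by (induction ys) auto
  with Cons show ?case by (simp add: p tmul_def)
qed (simp add: tmul_def)

lemma tsum_add: "tsum (\<lambda>a b. f a b + g a b) xs = tsum f xs + tsum g xs"
  by (induction xs) (auto simp: algebra_simps)

lemma tsum_scale: "tsum (\<lambda>a b. r *\<^sub>R (f a b :: 'c::real_vector)) xs = r *\<^sub>R tsum f xs"
  by (induction xs) (auto simp: scaleR_add_right)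

lemma tsum_0: "tsum (\<lambda>a b. 0) xs = 0"
  by (induction xs) auto

lemma tsum_swap:
  "tsum (\<lambda>a b. tsum (\<lambda>a' b'. f a b a' b') ys) xs = tsum (\<lambda>a' b'. tsum (\<lambda>a b. f a b a' b') xs) ys"
  by (induction xs) (auto simp: tsum_add tsum_0)

lemma bilinear_mult_arg:
  fixes \<beta> :: "'a::real_comm_algebra \<Rightarrow> 'b::real_comm_algebra \<Rightarrow> 'c::real_vector"
  assumes "bilinear \<beta>"
  shows "bilinear (\<lambda>a' b'. \<beta> (a * a') (b * b'))"
  by (auto simp: bilinear_def linear_iff distrib_left bilinear_ladd[OF assms]
      bilinear_radd[OF assms] bilinear_lmul[OF assms] bilinear_rmul[OF assms])

lemma bilinear_tsum_mult:
  fixes \<beta> :: "'a::real_comm_algebra \<Rightarrow> 'b::real_comm_algebra \<Rightarrow> 'c::real_vector"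
  assumes "bilinear \<beta>"
  shows "bilinear (\<lambda>a b. tsum (\<lambda>a' b'. \<beta> (a * a') (b * b')) ys)"
  by (auto simp: bilinear_def linear_iff distrib_right bilinear_ladd[OF assms]
      bilinear_radd[OF assms] bilinear_lmul[OF assms] bilinear_rmul[OF assms] tsum_add tsum_scale)

instantiation tensor :: (real_comm_algebra, real_comm_algebra) real_comm_algebra
begin

lift_definition one_tensor :: "('a, 'b) tensor" is "[(1, 1)]" .

lift_definition times_tensor :: "('a, 'b) tensor \<Rightarrow> ('a, 'b) tensor \<Rightarrow> ('a, 'b) tensor"
  is tmul
  unfolding tensor_rel_def tsum_tmul
proof (intro allI impI)
  fix xs xs' ys ys' :: "('a \<times> 'b) list" and \<beta> :: "'a \<Rightarrow> 'b \<Rightarrow> real"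
  assume xs: "\<forall>\<beta> :: 'a \<Rightarrow> 'b \<Rightarrow> real. bilinear \<beta> \<longrightarrow> tsum \<beta> xs = tsum \<beta> xs'"
    and ys: "\<forall>\<beta> :: 'a \<Rightarrow> 'b \<Rightarrow> real. bilinear \<beta> \<longrightarrow> tsum \<beta> ys = tsum \<beta> ys'"
    and \<beta>: "bilinear \<beta>"
  have "tsum (\<lambda>a' b'. \<beta> (a * a') (b * b')) ys = tsum (\<lambda>a' b'. \<beta> (a * a') (b * b')) ys'" for a b
    using ys bilinear_mult_arg[OF \<beta>] by blast
  then show "tsum (\<lambda>a b. tsum (\<lambda>a' b'. \<beta> (a * a') (b * b')) ys) xs =
      tsum (\<lambda>a b. tsum (\<lambda>a' b'. \<beta> (a * a') (b * b')) ys') xs'"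
    using xs bilinear_tsum_mult[OF \<beta>] by simp
qed

instance
proof
  fix x y z :: "('a, 'b) tensor" and r :: real
  show "x * y = y * x"
    by transfer (unfold tensor_rel_def tsum_tmul, subst tsum_swap, simp only: mult.commute, blast)
  show "x * y * z = x * (y * z)"
    by transfer (simp only: tensor_rel_def tsum_tmul mult.assoc, blast)
  show "1 * x = x"
    by transfer (simp add: tensor_rel_def tsum_tmul)
  show "(x + y) * z = x * z + y * z"
    by transfer (simp add: tensor_rel_def tsum_tmul)
  show "x * (y + z) = x * y + x * z"
    by transfer (simp add: tensor_rel_def tsum_tmul tsum_add)
  show "r *\<^sub>R x * y = r *\<^sub>R (x * y)"
    by transfer
      (simp add: tensor_rel_def tsum_tmul tsum_map_scale tsum_map_scale[OF bilinear_tsum_mult])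
  show "x * r *\<^sub>R y = r *\<^sub>R (x * y)"
    by transfer (simp add: tensor_rel_def tsum_tmul tsum_map_scale
        tsum_map_scale[OF bilinear_mult_arg] tsum_scale[where 'c = real, simplified])
qed

end

text \<open>The linear map on the tensor product induced by a bilinear map \<open>\<beta>\<close>.\<close>

definition tensor_lift ::
  "('a::real_vector \<Rightarrow> 'b::real_vector \<Rightarrow> 'c::real_vector) \<Rightarrow> ('a, 'b) tensor \<Rightarrow> 'c" where
  "tensor_lift \<beta> t = tsum \<beta> (rep_tensor t)"

lemma tensor_rel_tsum:
  fixes \<beta> :: "'a::real_vector \<Rightarrow> 'b::real_vector \<Rightarrow> 'c::real_vector"
  assumes "tensor_rel xs ys" "bilinear \<beta>"
  shows "tsum \<beta> xs = tsum \<beta> ys"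
proof (rule ccontr)
  assume neq: "tsum \<beta> xs \<noteq> tsum \<beta> ys"
  define v where "v = tsum \<beta> xs - tsum \<beta> ys"
  have "independent {v}" using neq by (simp add: v_def)
  then obtain \<phi> :: "'c \<Rightarrow> real" where \<phi>: "linear \<phi>" "\<phi> v = 1"
    using linear_independent_extend[of "{v}" "\<lambda>_. 1::real"] by auto
  have bil: "bilinear (\<lambda>a b. \<phi> (\<beta> a b))"
    using assms(2) \<phi>(1) by (auto simp: bilinear_def intro: linear_compose[unfolded o_def])
  have eq: "tsum (\<lambda>a b. \<phi> (\<beta> a b)) zs = \<phi> (tsum \<beta> zs)" for zs
    by (induction zs) (auto simp: linear_0[OF \<phi>(1)] linear_add[OF \<phi>(1)])
  have "\<phi> v = 0"
    using assms(1) bil by (simp add: v_def linear_diff[OF \<phi>(1)] flip: eq) (simp add: tensor_rel_def)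
  with \<phi>(2) show False by simp
qed

lemma tensor_lift_pure:
  assumes "bilinear \<beta>"
  shows "tensor_lift \<beta> (a \<otimes>\<^sub>R b) = \<beta> a b"
proof -
  have "tensor_rel (rep_tensor (a \<otimes>\<^sub>R b)) [(a, b)]"
    unfolding tensor_pure.abs_eq
    by (rule Quotient3_rep_abs[OF Quotient3_tensor]) (simp add: tensor_rel_def)
  from tensor_rel_tsum[OF this assms] show ?thesis by (simp add: tensor_lift_def)
qed

lemma linear_tensor_lift:
  assumes "bilinear \<beta>"
  shows "linear (tensor_lift \<beta>)"
proof (rule linearI)
  fix s t :: "('a, 'b) tensor" and r :: real
  have rep: "tensor_rel (rep_tensor (abs_tensor xs)) xs" for xs :: "('a \<times> 'b) list"
    by (rule Quotient3_rep_abs[OF Quotient3_tensor]) (simp add: tensor_rel_def)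
  have lift_abs: "tensor_lift \<beta> (abs_tensor xs) = tsum \<beta> xs" for xs
    unfolding tensor_lift_def by (rule tensor_rel_tsum[OF rep assms])
  show "tensor_lift \<beta> (s + t) = tensor_lift \<beta> s + tensor_lift \<beta> t"
    by (induction s, induction t) (simp add: plus_tensor.abs_eq lift_abs)
  show "tensor_lift \<beta> (r *\<^sub>R s) = r *\<^sub>R tensor_lift \<beta> s"
    by (induction s) (simp add: scaleR_tensor.abs_eq lift_abs tsum_map_scale[OF assms])
qed

section \<open>Affine varieties, algebraic groups and actions\<close>

definition affine_variety :: "'a::real_comm_algebra itself \<Rightarrow> bool" where
  "affine_variety _ \<longleftrightarrow>
     (\<exists>S :: 'a set. finite S \<and> subalgebra hull S = UNIV) \<and>
     (\<forall>(f :: 'a) n. f ^ n = 0 \<longrightarrow> f = 0)"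

text \<open>
  A real point \<open>x\<close> is the homomorphism \<open>f \<mapsto> f(x)\<close>. As a set of functions, \<open>V(\<real>)\<close> carries the
  topology of pointwise convergence. This is its Euclidean topology: for generators
  \<open>f\<^sub>1, \<dots>, f\<^sub>n\<close> of the coordinate ring it is induced by \<open>x \<mapsto> (x f\<^sub>1, \<dots>, x f\<^sub>n)\<close>.
\<close>

definition real_points :: "('a::real_comm_algebra \<Rightarrow> real) set" where
  "real_points = {x. alg_hom x}"

text \<open>
  Zariski density in the spectrum of a reduced ring: the maximal ideals of the real points
  intersect in the nilradical, which is zero.
\<close>

definition real_points_dense :: "'a::real_comm_algebra itself \<Rightarrow> bool" where
  "real_points_dense _ \<longleftrightarrow> (\<forall>f :: 'a. (\<forall>x\<in>real_points. x f = 0) \<longrightarrow> f = 0)"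

text \<open>
  A linear algebraic group is given by the Hopf algebra structure on its coordinate ring; the
  arguments are comultiplication, counit and antipode, that is, the comorphisms of the
  multiplication, the unit and the inversion.
\<close>

definition linear_algebraic_group ::
  "('h::real_comm_algebra \<Rightarrow> ('h, 'h) tensor) \<Rightarrow> ('h \<Rightarrow> real) \<Rightarrow> ('h \<Rightarrow> 'h) \<Rightarrow> bool" where
  "linear_algebraic_group \<Delta> \<epsilon> S \<longleftrightarrow>
     affine_variety TYPE('h) \<and> alg_hom \<Delta> \<and> alg_hom \<epsilon> \<and> alg_hom S \<and>
     (\<forall>h. tensor_lift (\<lambda>a b. tensor_lift (\<lambda>c d. c \<otimes>\<^sub>R (d \<otimes>\<^sub>R b)) (\<Delta> a)) (\<Delta> h)
        = tensor_lift (\<lambda>a b. a \<otimes>\<^sub>R \<Delta> b) (\<Delta> h)) \<and>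
     (\<forall>h. tensor_lift (\<lambda>a b. \<epsilon> a *\<^sub>R b) (\<Delta> h) = h) \<and>
     (\<forall>h. tensor_lift (\<lambda>a b. \<epsilon> b *\<^sub>R a) (\<Delta> h) = h) \<and>
     (\<forall>h. tensor_lift (\<lambda>a b. S a * b) (\<Delta> h) = \<epsilon> h *\<^sub>R 1) \<and>
     (\<forall>h. tensor_lift (\<lambda>a b. a * S b) (\<Delta> h) = \<epsilon> h *\<^sub>R 1)"

text \<open>
  An action \<open>G \<times> V \<rightarrow> V\<close> by a morphism, given by its comorphism
  \<open>\<delta> : \<real>[V] \<rightarrow> \<real>[G] \<otimes> \<real>[V]\<close>. The two identities express \<open>(gh)x = g(hx)\<close> and \<open>1x = x\<close>.
\<close>

definition group_action ::
  "('h::real_comm_algebra \<Rightarrow> ('h, 'h) tensor) \<Rightarrow> ('h \<Rightarrow> real) \<Rightarrow>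
   ('a::real_comm_algebra \<Rightarrow> ('h, 'a) tensor) \<Rightarrow> bool" where
  "group_action \<Delta> \<epsilon> \<delta> \<longleftrightarrow>
     alg_hom \<delta> \<and>
     (\<forall>f. tensor_lift (\<lambda>c p. tensor_lift (\<lambda>a b. a \<otimes>\<^sub>R (b \<otimes>\<^sub>R p)) (\<Delta> c)) (\<delta> f)
        = tensor_lift (\<lambda>c p. c \<otimes>\<^sub>R \<delta> p) (\<delta> f)) \<and>
     (\<forall>f. tensor_lift (\<lambda>c p. \<epsilon> c *\<^sub>R p) (\<delta> f) = f)"

text \<open>\<open>act \<delta> g f\<close> is \<open>f\<^sup>g\<close>, and \<open>move \<delta> g x\<close> is the point \<open>gx\<close>, so that \<open>f\<^sup>g(x) = f(gx)\<close>.\<close>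

definition act ::
  "('a::real_comm_algebra \<Rightarrow> ('h::real_comm_algebra, 'a) tensor) \<Rightarrow> ('h \<Rightarrow> real) \<Rightarrow> 'a \<Rightarrow> 'a" where
  "act \<delta> g f = tensor_lift (\<lambda>c p. g c *\<^sub>R p) (\<delta> f)"

definition move ::
  "('a::real_comm_algebra \<Rightarrow> ('h::real_comm_algebra, 'a) tensor) \<Rightarrow> ('h \<Rightarrow> real) \<Rightarrow>
   ('a \<Rightarrow> real) \<Rightarrow> ('a \<Rightarrow> real)" where
  "move \<delta> g x = (\<lambda>f. x (act \<delta> g f))"

definition invariants ::
  "('a::real_comm_algebra \<Rightarrow> ('h::real_comm_algebra, 'a) tensor) \<Rightarrow> 'a set" where
  "invariants \<delta> = {f. \<forall>g\<in>real_points. act \<delta> g f = f}"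

definition reynolds ::
  "('a::real_comm_algebra \<Rightarrow> ('h::real_comm_algebra, 'a) tensor) \<Rightarrow> ('a \<Rightarrow> 'a) \<Rightarrow> bool" where
  "reynolds \<delta> \<rho> \<longleftrightarrow>
     (\<exists>C. subspace C \<and> (\<forall>g\<in>real_points. act \<delta> g ` C \<subseteq> C) \<and>
          invariants \<delta> \<inter> C = {0} \<and> {f + c | f c. f \<in> invariants \<delta> \<and> c \<in> C} = UNIV \<and>
          linear \<rho> \<and> (\<forall>f\<in>invariants \<delta>. \<rho> f = f) \<and> (\<forall>c\<in>C. \<rho> c = 0))"

text \<open>
  The coordinate ring of \<open>W = V//G\<close> is the subset \<open>invariants \<delta>\<close> of \<open>\<real>[V]\<close>. A point of \<open>W(\<real>)\<close>
  is a homomorphism defined on this subset only (and \<^const>\<open>undefined\<close> outside), and \<open>\<pi>\<close>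
  restricts a point of \<open>V(\<real>)\<close> to the invariants.
\<close>

definition quotient_map_pts ::
  "('a::real_comm_algebra \<Rightarrow> ('h::real_comm_algebra, 'a) tensor) \<Rightarrow> ('a \<Rightarrow> real) \<Rightarrow> ('a \<Rightarrow> real)"
  where "quotient_map_pts \<delta> x = restrict x (invariants \<delta>)"

definition basic_closed :: "('a::real_comm_algebra \<Rightarrow> real) set \<Rightarrow> bool" where
  "basic_closed K \<longleftrightarrow> (\<exists>F. finite F \<and> K = {x \<in> real_points. \<forall>f\<in>F. x f \<ge> 0})"

definition invariant_set ::
  "('a::real_comm_algebra \<Rightarrow> ('h::real_comm_algebra, 'a) tensor) \<Rightarrow> ('a \<Rightarrow> real) set \<Rightarrow> bool" where
  "invariant_set \<delta> K \<longleftrightarrow> (\<forall>g\<in>real_points. move \<delta> g ` K \<subseteq> K)"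

definition quadratic_module :: "'a::real_comm_algebra set \<Rightarrow> bool" where
  "quadratic_module M \<longleftrightarrow>
     1 \<in> M \<and> (\<forall>f\<in>M. \<forall>g\<in>M. f + g \<in> M) \<and> (\<forall>a. \<forall>f\<in>M. a\<^sup>2 * f \<in> M)"

section \<open>Moment problems\<close>

text \<open>
  In the following definitions \<open>B\<close> is a coordinate ring, \<open>S\<close> a set of real points of the variety,
  and \<open>y f\<close> is the value of the function \<open>f\<close> at the point \<open>y\<close>.
\<close>

definition nonneg_on :: "'a set \<Rightarrow> ('a \<Rightarrow> real) set \<Rightarrow> 'a set" where
  "nonneg_on B S = {f \<in> B. \<forall>y\<in>S. y f \<ge> 0}"

definition moment_measure :: "'a set \<Rightarrow> ('a \<Rightarrow> real) set \<Rightarrow> ('a \<Rightarrow> real) measure \<Rightarrow> bool" where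
  "moment_measure B S \<mu> \<longleftrightarrow>
     sets \<mu> = sets (restrict_space borel S) \<and> (\<forall>f\<in>B. integrable \<mu> (\<lambda>y. y f))"

definition linear_functional_on :: "'a::real_vector set \<Rightarrow> ('a \<Rightarrow> real) \<Rightarrow> bool" where
  "linear_functional_on B F \<longleftrightarrow>
     (\<forall>f\<in>B. \<forall>g\<in>B. F (f + g) = F f + F g) \<and> (\<forall>r. \<forall>f\<in>B. F (r *\<^sub>R f) = r * F f)"

definition solves_moment_problem ::
  "'a::real_vector set \<Rightarrow> ('a \<Rightarrow> real) set \<Rightarrow> 'a set \<Rightarrow> bool" where
  "solves_moment_problem B S N \<longleftrightarrow>
     (\<forall>F. linear_functional_on B F \<longrightarrow>
        ((\<forall>f\<in>N. F f \<ge> 0) \<longleftrightarrow>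
         (\<exists>\<nu>. moment_measure B S \<nu> \<and> (\<forall>f\<in>B. F f = (\<integral>y. y f \<partial>\<nu>)))))"

definition invariant_measure ::
  "('a::real_comm_algebra \<Rightarrow> ('h::real_comm_algebra, 'a) tensor) \<Rightarrow> ('a \<Rightarrow> real) measure \<Rightarrow> bool"
  where "invariant_measure \<delta> \<mu> \<longleftrightarrow> (\<forall>g\<in>real_points. distr \<mu> \<mu> (move \<delta> g) = \<mu>)"

definition solves_averaged_moment_problem ::
  "('a::real_comm_algebra \<Rightarrow> ('h::real_comm_algebra, 'a) tensor) \<Rightarrow> ('a \<Rightarrow> real) set \<Rightarrow>
   'a set \<Rightarrow> bool" where
  "solves_averaged_moment_problem \<delta> K M \<longleftrightarrow>
     (\<forall>L. linear L \<and> (\<forall>g\<in>real_points. \<forall>f. L (act \<delta> g f) = L f) \<longrightarrow>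
        ((\<exists>\<mu>. moment_measure UNIV K \<mu> \<and> invariant_measure \<delta> \<mu> \<and>
               (\<forall>f. L f = (\<integral>x. x f \<partial>\<mu>))) \<longleftrightarrow>
         (\<forall>f\<in>M. L f \<ge> 0)))"

section \<open>The finest locally convex topology\<close>

definition locally_convex_topology :: "'a::real_vector set \<Rightarrow> 'a topology \<Rightarrow> bool" where
  "locally_convex_topology E T \<longleftrightarrow>
     topspace T = E \<and>
     continuous_map (prod_topology T T) T (\<lambda>(x, y). x + y) \<and>
     continuous_map (prod_topology euclideanreal T) T (\<lambda>(r, x). r *\<^sub>R x) \<and>
     (\<forall>U. openin T U \<and> 0 \<in> U \<longrightarrow> (\<exists>C. openin T C \<and> 0 \<in> C \<and> convex C \<and> C \<subseteq> U))"

text \<open>The supremum of all locally convex vector space topologies on the vector space \<open>E\<close>.\<close>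

definition finest_locally_convex :: "'a::real_vector set \<Rightarrow> 'a topology" where
  "finest_locally_convex E =
     topology_generated_by {U. \<exists>T. locally_convex_topology E T \<and> openin T U}"

lemma openin_finest_locally_convex:
  "locally_convex_topology E T \<Longrightarrow> openin T U \<Longrightarrow> openin (finest_locally_convex E) U"
  unfolding finest_locally_convex_def by (rule topology_generated_by_Basis) auto

lemma locally_convex_finest_locally_convex:
  assumes E: "subspace E"
  shows "locally_convex_topology E (finest_locally_convex E)"
proof -
  let ?F = "finest_locally_convex E"
  let ?S = "{U. \<exists>T. locally_convex_topology E T \<and> openin T U}"
  define I :: "'a topology" where "I = topology (\<lambda>U. U = {} \<or> U = E)"
  have "istopology (\<lambda>U. U = {} \<or> U = E)"
    unfolding istopology_def by blast
  then have opI: "openin I U \<longleftrightarrow> U = {} \<or> U = E" for U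
    by (simp only: I_def topology_inverse')
  have tsI: "topspace I = E" by (auto simp: topspace_def opI)
  have triv: "continuous_map X I f" if "\<And>x. x \<in> topspace X \<Longrightarrow> f x \<in> E"
    for X :: "'b topology" and f
  proof -
    have "{x \<in> topspace X. f x \<in> E} = topspace X" using that by auto
    then show ?thesis using that by (auto simp: continuous_map_def tsI opI)
  qed
  have lcI: "locally_convex_topology E I"
    unfolding locally_convex_topology_def
  proof (intro conjI allI impI)
    show "topspace I = E" by (fact tsI)
    show "continuous_map (prod_topology I I) I (\<lambda>(x, y). x + y)"
      by (rule triv) (auto simp: tsI subspace_add[OF E])
    show "continuous_map (prod_topology euclideanreal I) I (\<lambda>(r, x). r *\<^sub>R x)"
      by (rule triv) (auto simp: tsI subspace_scale[OF E])
    fix U assume "openin I U \<and> 0 \<in> U"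
    then show "\<exists>C. openin I C \<and> 0 \<in> C \<and> convex C \<and> C \<subseteq> U"
      using subspace_imp_convex[OF E] subspace_0[OF E] by (intro exI[of _ E]) (auto simp: opI)
  qed
  have ts: "topspace ?F = E"
    unfolding finest_locally_convex_def topology_generated_by_topspace
  proof
    show "\<Union>?S \<subseteq> E" using openin_subset unfolding locally_convex_topology_def by blast
    have "E \<in> ?S" using lcI opI by blast
    then show "E \<subseteq> \<Union>?S" by blast
  qed
  have into: "continuous_map X ?F f"
    if "\<And>T. locally_convex_topology E T \<Longrightarrow> continuous_map X T f" for X :: "'b topology" and f
  proof -
    have "f ` topspace X \<subseteq> \<Union>?S"
    proof -
      have "f ` topspace X \<subseteq> E"
        using that[OF lcI] continuous_map_image_subset_topspace tsI by metis
      then show ?thesis using lcI opI by blast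
    qed
    moreover have "openin X (f -` U \<inter> topspace X)" if "U \<in> ?S" for U
    proof -
      from that obtain T where T: "locally_convex_topology E T" "openin T U" by auto
      have "f -` U \<inter> topspace X = {x \<in> topspace X. f x \<in> U}" by auto
      then show ?thesis
        using \<open>\<And>T. locally_convex_topology E T \<Longrightarrow> continuous_map X T f\<close>[OF T(1)] T(2)
        by (simp add: continuous_map_def)
    qed
    ultimately show ?thesis
      unfolding finest_locally_convex_def continuous_on_generated_topo_iff by blast
  qed
  have ident: "continuous_map ?F T (\<lambda>x. x)" if T: "locally_convex_topology E T" for T
  proof -
    have tsT: "topspace T = E" using T by (simp add: locally_convex_topology_def)
    have "{x \<in> E. x \<in> U} = U" if "openin T U" for U
      using openin_subset[OF that] tsT by auto
    then show ?thesis
      using openin_finest_locally_convex[OF T] by (simp add: continuous_map_def ts tsT)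
  qed
  have add: "continuous_map (prod_topology ?F ?F) ?F (\<lambda>(x, y). x + y)"
  proof (rule into)
    fix T assume T: "locally_convex_topology E T"
    have "continuous_map (prod_topology ?F ?F) (prod_topology T T) (\<lambda>p. (fst p, snd p))"
      unfolding continuous_map_pairwise o_def
      using continuous_map_compose[OF continuous_map_fst[of ?F ?F] ident[OF T]]
        continuous_map_compose[OF continuous_map_snd[of ?F ?F] ident[OF T]] by (simp add: o_def)
    from continuous_map_compose[OF this] T
    show "continuous_map (prod_topology ?F ?F) T (\<lambda>(x, y). x + y)"
      by (fastforce simp: locally_convex_topology_def o_def case_prod_beta)
  qed
  have scale: "continuous_map (prod_topology euclideanreal ?F) ?F (\<lambda>(r, x). r *\<^sub>R x)"
  proof (rule into)
    fix T assume T: "locally_convex_topology E T"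
    have "continuous_map (prod_topology euclideanreal ?F) (prod_topology euclideanreal T)
        (\<lambda>p. (fst p, snd p))"
      unfolding continuous_map_pairwise o_def
      using continuous_map_fst[of euclideanreal ?F]
        continuous_map_compose[OF continuous_map_snd[of euclideanreal ?F] ident[OF T]]
      by (simp add: o_def)
    from continuous_map_compose[OF this] T
    show "continuous_map (prod_topology euclideanreal ?F) T (\<lambda>(r, x). r *\<^sub>R x)"
      by (fastforce simp: locally_convex_topology_def o_def case_prod_beta)
  qed
  have base: "\<exists>C. openin ?F C \<and> 0 \<in> C \<and> convex C \<and> C \<subseteq> U"
    if "generate_topology_on ?S U" "0 \<in> U" for U
    using that
  proof (induction rule: generate_topology_on.induct)
    case (Int a b)
    then obtain C D where "openin ?F C" "0 \<in> C" "convex C" "C \<subseteq> a"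
      "openin ?F D" "0 \<in> D" "convex D" "D \<subseteq> b" by auto
    then show ?case by (intro exI[of _ "C \<inter> D"]) (auto intro: convex_Int)
  next
    case (UN K)
    then obtain k where "k \<in> K" "0 \<in> k" by auto
    with UN.IH[of k] show ?case by blast
  next
    case (Basis U)
    then obtain T where T: "locally_convex_topology E T" "openin T U" by auto
    then obtain C where "openin T C" "0 \<in> C" "convex C" "C \<subseteq> U"
      using Basis.prems by (auto simp: locally_convex_topology_def)
    with openin_finest_locally_convex[OF T(1)] show ?case by blast
  qed simp
  show ?thesis
    unfolding locally_convex_topology_def
  proof (intro conjI allI impI)
    fix U assume "openin ?F U \<and> 0 \<in> U"
    then show "\<exists>C. openin ?F C \<and> 0 \<in> C \<and> convex C \<and> C \<subseteq> U"
      by (intro base) (simp_all add: finest_locally_convex_def openin_topology_generated_by_iff)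
  qed (fact ts add scale)+
qed

end

theory Submission
  imports Defs "HOL-Library.Function_Algebras"
begin

text \<open>
  Write \<open>N = \<rho> ` M\<close> and let \<open>P\<close> be the cone of invariants that are nonnegative on \<open>\<pi>(K)\<close>. Each of
  the three conditions says that a linear functional is nonnegative on \<open>N\<close> iff it is nonnegative
  on \<open>P\<close>: for the closure this is the Hahn--Banach theorem, and for the two moment problems it is
  Haviland's theorem, since \<open>F \<mapsto> F \<circ> \<rho>\<close> identifies functionals on the invariants with invariant
  functionals. Only Haviland's theorem on \<open>K\<close> is needed: the measure on \<open>\<pi>(K)\<close> is the image of
  the one on \<open>K\<close>, so finite generation of the invariants plays no role.

  Haviland's theorem is proved by extending the functional to all functions on \<open>K\<close> of polynomial
  growth, which gives a finitely additive measure on all subsets of \<open>K\<close>. Coding the points of \<open>K\<close>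
  by the bits \<open>x(f\<^sub>j) < q\<close> moves it to a Cantor space, where finite additivity on cylinder sets
  already implies countable additivity, and decoding moves it back.

  The Haar functional on \<open>\<real>[G]\<close> is the unique minimizer of a strictly convex energy maximized over
  orbits; Haviland's theorem on \<open>G(\<real>)\<close> turns it into the Haar measure, which is used to average
  both functions (giving the Reynolds operator) and measures.
\<close>

section \<open>The Hahn--Banach theorem\<close>

text \<open>Three obstacles shape the argument. Since \<open>K\<close> need not be compact, a
  positive extension is only finitely additive, and mass could escape to infinity; every truncation
  error is therefore bounded by a multiple of 1 + f^2 with f regular, where the functional is under
  control, and this yields a Chebyshev estimate and an L1 rate. Next, points are functions on a ring
  that is usually uncountable, so Borel sets of the product topology are not accessible through
  evaluations alone; a countable spanning sequence turns a point into a sequence of reals, and a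
  continuous map turns it back. Finally, on a noncompact \<open>K\<close> a measure need not be
  determined by its moments, so a measure representing an invariant functional need not be invariant
  and has to be averaged explicitly. On the compact group moments do determine the measure, which is
  how invariance of the Haar functional becomes invariance of the Haar measure.\<close>

definition sublinear :: "('v::real_vector \<Rightarrow> real) \<Rightarrow> bool" where
  "sublinear p \<longleftrightarrow> (\<forall>x y. p (x + y) \<le> p x + p y) \<and> (\<forall>r\<ge>0. \<forall>x. p (r *\<^sub>R x) = r * p x)"

lemma sublinear_zero:
  assumes "sublinear p"
  shows "p 0 = 0"
proof -
  have "p (0 *\<^sub>R 0) = 0 * p 0" using assms unfolding sublinear_def by blast
  then show ?thesis by simp
qed

lemma sublinear_lower:
  assumes "sublinear p"
  shows "- p (- x) \<le> p x"
proof -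
  have "p (x + - x) \<le> p x + p (- x)" using assms unfolding sublinear_def by blast
  then show ?thesis using sublinear_zero[OF assms] by simp
qed

text \<open>Serves the four sublinear functionals that are built as infima of sets of admissible
  values: a directional modification, the infimum of a chain, the distance to a cone, and an upper
  integral. Equality under scaling comes from the inequality for \<open>r\<close> and for its
  inverse.\<close>

lemma Inf_family_sublinear:
  fixes A :: "'v::real_vector \<Rightarrow> real set"
  assumes E: "subspace E"
    and ne: "\<And>x. x \<in> E \<Longrightarrow> A x \<noteq> {}" and bdd: "\<And>x. x \<in> E \<Longrightarrow> bdd_below (A x)"
    and add: "\<And>x y s t. x \<in> E \<Longrightarrow> y \<in> E \<Longrightarrow> s \<in> A x \<Longrightarrow> t \<in> A y \<Longrightarrow> s + t \<in> A (x + y)"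
    and scale: "\<And>r x s. r > 0 \<Longrightarrow> x \<in> E \<Longrightarrow> s \<in> A x \<Longrightarrow> r * s \<in> A (r *\<^sub>R x)"
    and zero: "Inf (A 0) = 0"
  shows "x \<in> E \<Longrightarrow> y \<in> E \<Longrightarrow> Inf (A (x + y)) \<le> Inf (A x) + Inf (A y)"
    and "r \<ge> 0 \<Longrightarrow> x \<in> E \<Longrightarrow> Inf (A (r *\<^sub>R x)) = r * Inf (A x)"
proof -
  assume xy: "x \<in> E" "y \<in> E"
  have "Inf (A (x + y)) - t \<le> Inf (A x)" if t: "t \<in> A y" for t
  proof (rule cInf_greatest[OF ne[OF xy(1)]])
    fix s assume "s \<in> A x"
    then have "Inf (A (x + y)) \<le> s + t"
      using xy t by (intro cInf_lower bdd subspace_add[OF E] add)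
    then show "Inf (A (x + y)) - t \<le> s" by simp
  qed
  then have "Inf (A (x + y)) - Inf (A x) \<le> Inf (A y)"
    by (intro cInf_greatest[OF ne[OF xy(2)]]) (simp add: algebra_simps)
  then show "Inf (A (x + y)) \<le> Inf (A x) + Inf (A y)" by simp
next
  assume r: "r \<ge> 0" and x: "x \<in> E"
  have le: "Inf (A (r *\<^sub>R x)) \<le> r * Inf (A x)" if r: "r > 0" and x: "x \<in> E" for r x
  proof -
    have "Inf (A (r *\<^sub>R x)) / r \<le> Inf (A x)"
    proof (rule cInf_greatest[OF ne[OF x]])
      fix t assume "t \<in> A x"
      then have "Inf (A (r *\<^sub>R x)) \<le> r * t"
        using r x by (intro cInf_lower bdd subspace_scale[OF E] scale)
      then show "Inf (A (r *\<^sub>R x)) / r \<le> t" using r by (simp add: field_simps)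
    qed
    then show ?thesis using r by (simp add: field_simps)
  qed
  show "Inf (A (r *\<^sub>R x)) = r * Inf (A x)"
  proof (cases "r = 0")
    case True then show ?thesis using zero by simp
  next
    case False
    then have r: "r > 0" using r by simp
    have "Inf (A (inverse r *\<^sub>R (r *\<^sub>R x))) \<le> inverse r * Inf (A (r *\<^sub>R x))"
      using r x by (intro le subspace_scale[OF E]) simp
    then have "r * Inf (A x) \<le> Inf (A (r *\<^sub>R x))" using r by (simp add: field_simps)
    with le[OF r x] show ?thesis by linarith
  qed
qed

lemma Inf_zeroI: "(\<And>s. s \<in> A \<Longrightarrow> 0 \<le> s) \<Longrightarrow> 0 \<in> A \<Longrightarrow> Inf A = (0::real)"
  by (intro antisym cInf_greatest cInf_lower bdd_belowI[of _ 0]) auto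

text \<open>The modification is the infimum over t \<ge> 0 of q(y + t x) - t q(x): t = 0 bounds it
  by \<open>q\<close>, t = 1 gives the value at -x, and subadditivity bounds it below by
  -q(-y).\<close>

lemma sublinear_directional:
  assumes q: "sublinear q"
  obtains r where "sublinear r" "\<And>y. r y \<le> q y" "r (- x) \<le> - q x"
proof -
  define A where "A y = {s. \<exists>t\<ge>0. q (y + t *\<^sub>R x) - t * q x \<le> s}" for y
  have add: "q (a + b) \<le> q a + q b" for a b using q unfolding sublinear_def by blast
  have scale: "q (r *\<^sub>R a) = r * q a" if "r \<ge> 0" for r a using q that unfolding sublinear_def by blast
  have lower: "- q (- y) \<le> s" if s: "s \<in> A y" for s y
  proof -
    obtain t where t: "t \<ge> 0" "q (y + t *\<^sub>R x) - t * q x \<le> s" using s unfolding A_def by blast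
    then show ?thesis using add[of "y + t *\<^sub>R x" "- y"] scale[OF t(1), of x] by simp
  qed
  have mem: "q y \<in> A y" for y unfolding A_def by (intro CollectI exI[of _ 0]) simp
  have bdd: "bdd_below (A y)" for y using lower by (rule bdd_belowI)
  have A_add: "s + t \<in> A (y + z)" if st: "s \<in> A y" "t \<in> A z" for s t y z
  proof -
    obtain i j where ij: "i \<ge> 0" "j \<ge> 0" "q (y + i *\<^sub>R x) - i * q x \<le> s" "q (z + j *\<^sub>R x) - j * q x \<le> t"
      using st unfolding A_def by blast
    then have "q (y + z + (i + j) *\<^sub>R x) - (i + j) * q x \<le> s + t"
      using add[of "y + i *\<^sub>R x" "z + j *\<^sub>R x"] by (simp add: algebra_simps)
    with ij show ?thesis unfolding A_def by (intro CollectI exI[of _ "i + j"]) simp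
  qed
  have A_scale: "r * s \<in> A (r *\<^sub>R y)" if r: "r > 0" and s: "s \<in> A y" for r s y
  proof -
    obtain t where t: "t \<ge> 0" "q (y + t *\<^sub>R x) - t * q x \<le> s" using s unfolding A_def by blast
    then have "r * (q (y + t *\<^sub>R x) - t * q x) \<le> r * s" using r by simp
    then have "q (r *\<^sub>R y + (r * t) *\<^sub>R x) - (r * t) * q x \<le> r * s"
      using scale[of r "y + t *\<^sub>R x"] r by (simp add: algebra_simps)
    with r t show ?thesis unfolding A_def by (intro CollectI exI[of _ "r * t"]) simp
  qed
  have zero: "Inf (A 0) = 0"
    using lower[of _ 0] mem[of 0] sublinear_zero[OF q] by (intro Inf_zeroI) auto
  have ne: "A y \<noteq> {}" for y using mem[of y] by blast
  have "sublinear (\<lambda>y. Inf (A y))"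
    unfolding sublinear_def
    by (intro conjI allI impI UNIV_I
    Inf_family_sublinear[OF subspace_UNIV, where A = A] ne bdd zero A_add A_scale)
  moreover have "Inf (A y) \<le> q y" for y using bdd mem by (rule cInf_lower[rotated])
  moreover have "Inf (A (- x)) \<le> - q x"
  proof (rule cInf_lower[OF _ bdd])
    show "- q x \<in> A (- x)"
      unfolding A_def by (intro CollectI exI[of _ 1]) (simp add: sublinear_zero[OF q])
  qed
  ultimately show ?thesis using that by blast
qed

text \<open>Zorn's lemma; the infimum of a chain stays finite because every sublinear function below
  \<open>p\<close> is at least - p (- x) at \<open>x\<close>.\<close>

lemma exists_minimal_sublinear:
  assumes p: "sublinear p"
  obtains q where "sublinear q" "q \<le> p" "\<And>r. sublinear r \<Longrightarrow> r \<le> q \<Longrightarrow> r = q"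
proof -
  let ?A = "{q. sublinear q \<and> q \<le> p}"
  let ?R = "relation_of (\<lambda>q r. r \<le> q) ?A"
  have "\<exists>m\<in>?A. \<forall>a\<in>?A. a \<le> m \<longrightarrow> a = m"
  proof (rule predicate_Zorn)
    show "partial_order_on ?A ?R" by (rule partial_order_on_relation_ofI) auto
    fix C assume C: "C \<in> Chains ?R"
    have CA: "sublinear q" "q \<le> p" if "q \<in> C" for q
      using C that by (auto simp: Chains_def relation_of_def)
    have tot: "a \<le> b \<or> b \<le> a" if "a \<in> C" "b \<in> C" for a b
      using C that by (auto simp: Chains_def relation_of_def)
    show "\<exists>u\<in>?A. \<forall>a\<in>C. u \<le> a"
    proof (cases "C = {}")
      case True then show ?thesis using p by auto
    next
      case False
      then obtain q0 where q0: "q0 \<in> C" by blast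
      define B where "B x = {s. \<exists>q\<in>C. q x \<le> s}" for x
      have mem: "q x \<in> B x" if "q \<in> C" for q x using that unfolding B_def by blast
      have lower: "- p (- x) \<le> s" if s: "s \<in> B x" for s x
      proof -
        obtain q where q: "q \<in> C" "q x \<le> s" using s unfolding B_def by blast
        then show ?thesis
          using sublinear_lower[OF CA(1)[OF q(1)], of x] le_funD[OF CA(2)[OF q(1)], of "- x"] by linarith
      qed
      have bdd: "bdd_below (B x)" for x using lower by (rule bdd_belowI)
      have B_add: "s + t \<in> B (x + y)" if st: "s \<in> B x" "t \<in> B y" for s t x y
      proof -
        obtain i j where ij: "i \<in> C" "j \<in> C" "i x \<le> s" "j y \<le> t" using st unfolding B_def by blast
        \<comment> \<open>Totality of the chain makes the infimum subadditive: the smaller of two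
          members serves both summands.\<close>
        obtain k where k: "k \<in> C" "k \<le> i" "k \<le> j" using tot[OF ij(1,2)] ij(1,2) by blast
        have "k (x + y) \<le> k x + k y" using CA(1)[OF k(1)] unfolding sublinear_def by blast
        then have "k (x + y) \<le> s + t" using le_funD[OF k(2), of x] le_funD[OF k(3), of y] ij by linarith
        with k(1) show ?thesis unfolding B_def by blast
      qed
      have B_scale: "r * s \<in> B (r *\<^sub>R x)" if r: "r > 0" and s: "s \<in> B x" for r s x
      proof -
        obtain q where q: "q \<in> C" "q x \<le> s" using s unfolding B_def by blast
        then have "q (r *\<^sub>R x) \<le> r * s" using CA(1)[OF q(1)] r unfolding sublinear_def by simp
        with q(1) show ?thesis unfolding B_def by blast
      qed
      have zero: "Inf (B 0) = 0"
        using lower[of _ 0] mem[OF q0, of 0] sublinear_zero[OF CA(1)[OF q0]] sublinear_zero[OF p]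
        by (intro Inf_zeroI) auto
      have ne: "B x \<noteq> {}" for x using mem[OF q0, of x] by blast
      have "sublinear (\<lambda>x. Inf (B x))"
        unfolding sublinear_def
        by (intro conjI allI impI UNIV_I
    Inf_family_sublinear[OF subspace_UNIV, where A = B] ne bdd zero B_add B_scale)
      moreover have le: "Inf (B x) \<le> a x" if "a \<in> C" for a x using mem[OF that] bdd by (rule cInf_lower)
      moreover have "(\<lambda>x. Inf (B x)) \<le> p"
        using le[OF q0] CA(2)[OF q0] by (meson le_funI le_funD order_trans)
      ultimately show ?thesis by (intro bexI[of _ "\<lambda>x. Inf (B x)"]) (auto intro: le_funI)
    qed
  qed
  then obtain q where q: "sublinear q" "q \<le> p" "\<And>a. sublinear a \<Longrightarrow> a \<le> p \<Longrightarrow> a \<le> q \<Longrightarrow> a = q"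
    by auto
  then show ?thesis using that[of q] order_trans by blast
qed

text \<open>A minimal sublinear functional agrees with its directional modifications, hence is linear.\<close>

theorem hahn_banach_sublinear:
  assumes p: "sublinear p"
  obtains F where "linear F" "\<And>x. F x \<le> p x" "F x0 = p x0"
proof -
  \<comment> \<open>Minimality alone would give some linear minorant; modifying \<open>p\<close>
    along \<open>x0\<close> first forces equality at \<open>x0\<close>.\<close>
  obtain p' where p': "sublinear p'" "\<And>y. p' y \<le> p y" "p' (- x0) \<le> - p x0"
    using sublinear_directional[OF p] by blast
  obtain q where q: "sublinear q" "q \<le> p'" "\<And>r. sublinear r \<Longrightarrow> r \<le> q \<Longrightarrow> r = q"
    using exists_minimal_sublinear[OF p'(1)] by blast
  have neg: "q (- x) = - q x" for x
  proof -
    obtain r where r: "sublinear r" "\<And>y. r y \<le> q y" "r (- x) \<le> - q x"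
      using sublinear_directional[OF q(1)] by blast
    then have "r = q" by (intro q(3)) (auto intro: le_funI)
    then have "q (- x) \<le> - q x" using r(3) by simp
    then show ?thesis using sublinear_lower[OF q(1), of x] by linarith
  qed
  have sub: "q (x + y) \<le> q x + q y" for x y using q(1) unfolding sublinear_def by blast
  have scale: "q (r *\<^sub>R x) = r * q x" if "r \<ge> 0" for r x
    using q(1) that unfolding sublinear_def by blast
  have "linear q"
  proof (rule linearI)
    fix x y show "q (x + y) = q x + q y"
      using sub[of x y] sub[of "- x" "- y"] neg[of "x + y"] neg[of x] neg[of y] by simp
  next
    fix r x show "q (r *\<^sub>R x) = r *\<^sub>R q x"
    proof (cases "r \<ge> 0")
      case False
      then have "q ((- r) *\<^sub>R x) = (- r) * q x" by (intro scale) simp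
      then show ?thesis using neg[of "r *\<^sub>R x"] by simp
    qed (simp add: scale)
  qed
  moreover have le: "q x \<le> p x" for x using le_funD[OF q(2)] p'(2) order_trans by blast
  moreover have "q x0 = p x0"
    using le_funD[OF q(2), of "- x0"] p'(3) neg[of x0] le[of x0] by simp
  ultimately show ?thesis using that by blast
qed

text \<open>The structure that lets Hahn-Banach act on the space of all real functions on a set of
  points.\<close>

instantiation "fun" :: (type, real_vector) real_vector
begin

definition scaleR_fun :: "real \<Rightarrow> ('a \<Rightarrow> 'b) \<Rightarrow> 'a \<Rightarrow> 'b" where
  "scaleR_fun r f = (\<lambda>x. r *\<^sub>R f x)"

instance
  by standard (simp_all add: scaleR_fun_def fun_eq_iff algebra_simps)

end

lemma scaleR_fun_apply [simp]: "(r *\<^sub>R f) x = r *\<^sub>R f x"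
  by (simp add: scaleR_fun_def)

lemma exists_linear_projection:
  fixes E :: "'v::real_vector set"
  assumes E: "subspace E"
  obtains P where "linear P" "range P \<subseteq> E" "\<And>x. x \<in> E \<Longrightarrow> P x = x"
proof -
  obtain P where "range P \<subseteq> E" "linear P" "\<forall>v\<in>E. P (id v) = v"
    using linear_exists_left_inverse_on[OF linear_id E inj_on_id] by blast
  with that show ?thesis by auto
qed

text \<open>Only the values of \<open>p\<close> on \<open>E\<close> matter: compose with a linear projection onto \<open>E\<close>.\<close>

corollary hahn_banach_subspace:
  fixes E :: "'v::real_vector set"
  assumes E: "subspace E"
    and add: "\<And>x y. x \<in> E \<Longrightarrow> y \<in> E \<Longrightarrow> p (x + y) \<le> p x + p y"
    and scale: "\<And>r x. r \<ge> 0 \<Longrightarrow> x \<in> E \<Longrightarrow> p (r *\<^sub>R x) = r * p x"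
    and x0: "x0 \<in> E"
  obtains F where "linear F" "\<And>x. x \<in> E \<Longrightarrow> F x \<le> p x" "F x0 = p x0"
proof -
  obtain P where P: "linear P" "range P \<subseteq> E" "\<And>x. x \<in> E \<Longrightarrow> P x = x"
    using exists_linear_projection[OF E] by blast
  have "sublinear (\<lambda>x. p (P x))"
    unfolding sublinear_def using P(2)
    by (auto simp: linear_add[OF P(1)] linear_scale[OF P(1)] intro!: add scale)
  then obtain F where F: "linear F" "\<And>x. F x \<le> p (P x)" "F x0 = p (P x0)"
    using hahn_banach_sublinear by blast
  show ?thesis using that[OF F(1)] F(2,3) P(3) x0 by metis
qed

section \<open>Closed cones in the finest locally convex topology\<close>

text \<open>Balls pull back to convex sets under a functional. Since the induced topology is coarser
  than the finest one, every linear functional is continuous for the finest one.\<close>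

lemma locally_convex_pullback:
  fixes F :: "'v::real_vector \<Rightarrow> real"
  assumes E: "subspace E" and F: "linear F"
  shows "locally_convex_topology E (pullback_topology E F euclideanreal)"
proof -
  let ?T = "pullback_topology E F euclideanreal"
  have ts: "topspace ?T = E" by (simp add: topspace_pullback_topology)
  have cF: "continuous_map ?T euclideanreal F"
    using continuous_map_pullback[OF continuous_map_id[of euclideanreal], of E F] by simp
  have "continuous_map (prod_topology ?T ?T) ?T (\<lambda>(x, y). x + y)"
  proof (rule continuous_map_pullback')
    have "continuous_map (prod_topology ?T ?T) euclideanreal (\<lambda>p. F (fst p) + F (snd p))"
      by (intro continuous_map_add continuous_map_compose[OF continuous_map_fst cF, unfolded o_def]
          continuous_map_compose[OF continuous_map_snd cF, unfolded o_def])
    then show "continuous_map (prod_topology ?T ?T) euclideanreal (F \<circ> (\<lambda>(x, y). x + y))"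
      by (simp add: o_def case_prod_beta linear_add[OF F])
  qed (auto simp: ts subspace_add[OF E])
  moreover have "continuous_map (prod_topology euclideanreal ?T) ?T (\<lambda>(r, x). r *\<^sub>R x)"
  proof (rule continuous_map_pullback')
    have "continuous_map (prod_topology euclideanreal ?T) euclideanreal (\<lambda>p. fst p * F (snd p))"
      by (intro continuous_map_real_mult continuous_map_fst
          continuous_map_compose[OF continuous_map_snd cF, unfolded o_def])
    then show "continuous_map (prod_topology euclideanreal ?T) euclideanreal (F \<circ> (\<lambda>(r, x). r *\<^sub>R x))"
      by (simp add: o_def case_prod_beta linear_scale[OF F])
  qed (auto simp: ts subspace_scale[OF E])
  moreover have "\<exists>C. openin ?T C \<and> 0 \<in> C \<and> convex C \<and> C \<subseteq> U" if U: "openin ?T U" "0 \<in> U" for U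
  proof -
    obtain V where V: "open V" "U = F -` V \<inter> E" using U(1) by (auto simp: openin_pullback_topology)
    then obtain e where e: "e > 0" "ball 0 e \<subseteq> V"
      using U(2) linear_0[OF F] by (auto simp: open_contains_ball)
    have "convex (F -` ball 0 e \<inter> E)"
      by (intro convex_Int convex_linear_vimage F convex_ball subspace_imp_convex E)
    moreover have "openin ?T (F -` ball 0 e \<inter> E)"
      unfolding openin_pullback_topology by (intro exI[of _ "ball 0 e"]) simp
    ultimately show ?thesis
      using e V subspace_0[OF E] linear_0[OF F] by (intro exI[of _ "F -` ball 0 e \<inter> E"]) auto
  qed
  ultimately show ?thesis using ts unfolding locally_convex_topology_def by blast
qed

lemma closedin_halfspace_finest:
  fixes F :: "'v::real_vector \<Rightarrow> real"
  assumes E: "subspace E" and F: "linear F"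
  shows "closedin (finest_locally_convex E) {f \<in> E. F f \<ge> 0}"
proof -
  have ts: "topspace (finest_locally_convex E) = E"
    using locally_convex_finest_locally_convex[OF E] by (simp add: locally_convex_topology_def)
  have "openin (pullback_topology E F euclideanreal) (F -` {..<0} \<inter> E)"
    unfolding openin_pullback_topology by (intro exI[of _ "{..<0}"]) simp
  then have "openin (finest_locally_convex E) (F -` {..<0} \<inter> E)"
    by (rule openin_finest_locally_convex[OF locally_convex_pullback[OF E F]])
  moreover have "E - {f \<in> E. F f \<ge> 0} = F -` {..<0} \<inter> E" by auto
  ultimately show ?thesis by (auto simp: closedin_def ts)
qed

text \<open>\<open>C\<close> comes from continuity of c \<mapsto> v - c at 0, and it absorbs each y
  because r \<mapsto> r y is continuous at 0. The sign suits decompositions v = n + t c with n in a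
  cone.\<close>

lemma finest_neighbourhood:
  assumes E: "subspace E" and v: "v \<in> E" and U: "openin (finest_locally_convex E) U" "v \<in> U"
  obtains C where "convex C" "C \<subseteq> E" "0 \<in> C" "\<And>c. c \<in> C \<Longrightarrow> v - c \<in> U"
    "\<And>y. y \<in> E \<Longrightarrow> \<exists>t>0. t *\<^sub>R y \<in> C"
proof -
  let ?T = "finest_locally_convex E"
  note lc = locally_convex_finest_locally_convex[OF E, unfolded locally_convex_topology_def]
  have ts: "topspace ?T = E" using lc by blast
  have mul: "continuous_map (prod_topology euclideanreal ?T) ?T (\<lambda>(r, x). r *\<^sub>R x)"
    and add: "continuous_map (prod_topology ?T ?T) ?T (\<lambda>(x, y). x + y)" using lc by blast+
  have "continuous_map ?T (prod_topology euclideanreal ?T) (\<lambda>c. (-1, c))"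
    by (simp add: continuous_map_pairedI)
  from continuous_map_compose[OF this mul] have "continuous_map ?T ?T (\<lambda>c. - c)" by (simp add: o_def)
  then have "continuous_map ?T (prod_topology ?T ?T) (\<lambda>c. (v, - c))"
    by (simp add: continuous_map_pairedI ts v)
  from continuous_map_compose[OF this add] have "continuous_map ?T ?T (\<lambda>c. v - c)" by (simp add: o_def)
  then have "openin ?T {c \<in> topspace ?T. v - c \<in> U}" using U(1) by (rule openin_continuous_map_preimage)
  then obtain C where C: "openin ?T C" "0 \<in> C" "convex C" "C \<subseteq> {c \<in> topspace ?T. v - c \<in> U}"
    using lc U(2) subspace_0[OF E] ts by (metis (no_types, lifting) diff_zero mem_Collect_eq)
  have "\<exists>t>0. t *\<^sub>R y \<in> C" if y: "y \<in> E" for y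
  proof -
    have "continuous_map euclideanreal (prod_topology euclideanreal ?T) (\<lambda>r. (r, y))"
      by (simp add: continuous_map_pairedI ts y)
    from continuous_map_compose[OF this mul] have "continuous_map euclideanreal ?T (\<lambda>r. r *\<^sub>R y)"
      by (simp add: o_def)
    from openin_continuous_map_preimage[OF this C(1)] have "open {r. r *\<^sub>R y \<in> C}" by simp
    moreover have "(0::real) \<in> {r. r *\<^sub>R y \<in> C}" using C(2) by simp
    ultimately obtain e where e: "e > 0" "ball 0 e \<subseteq> {r. r *\<^sub>R y \<in> C}"
      unfolding open_contains_ball by blast
    then have "(e / 2) *\<^sub>R y \<in> C" by (auto simp: subset_iff)
    then show ?thesis using e(1) by (intro exI[of _ "e / 2"]) simp
  qed
  then show ?thesis using that[of C] C ts by blast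
qed

text \<open>The infimum \<open>d y\<close> of the t > 0 with y in N + t C is sublinear, zero on
  \<open>N\<close> and at least 1 at \<open>v\<close>: a decomposition of \<open>v\<close> with t <
  1 would put a point of \<open>N\<close> into \<open>U\<close>. A linear \<open>F\<close> below
  \<open>d\<close> with F v = d v is at most 0 on \<open>N\<close>, so its negative
  separates.\<close>

lemma cone_separation:
  fixes N :: "'v::real_vector set"
  assumes E: "subspace E" and N: "N \<subseteq> E" "0 \<in> N"
    and N_add: "\<And>x y. x \<in> N \<Longrightarrow> y \<in> N \<Longrightarrow> x + y \<in> N"
    and N_scale: "\<And>r x. r \<ge> 0 \<Longrightarrow> x \<in> N \<Longrightarrow> r *\<^sub>R x \<in> N"
    and v: "v \<in> E" "v \<notin> finest_locally_convex E closure_of N"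
  obtains F :: "'v \<Rightarrow> real" where "linear F" "\<And>n. n \<in> N \<Longrightarrow> F n \<ge> 0" "F v < 0"
proof -
  have "v \<in> topspace (finest_locally_convex E)"
    using locally_convex_finest_locally_convex[OF E] v(1) by (simp add: locally_convex_topology_def)
  then obtain U where U: "openin (finest_locally_convex E) U" "v \<in> U" "U \<inter> N = {}"
    using v(2) by (auto simp: in_closure_of)
  obtain C where C: "convex C" "C \<subseteq> E" "0 \<in> C" "\<And>c. c \<in> C \<Longrightarrow> v - c \<in> U"
    and absorb: "\<And>y. y \<in> E \<Longrightarrow> \<exists>t>0. t *\<^sub>R y \<in> C"
    using finest_neighbourhood[OF E v(1) U(1,2)] by metis
  \<comment> \<open>the distance to \<open>N\<close> in the gauge of \<open>C\<close>\<close>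
  define A where "A y = {t. t > 0 \<and> (\<exists>n\<in>N. \<exists>c\<in>C. y = n + t *\<^sub>R c)}" for y
  define d where "d y = Inf (A y)" for y
  have bdd: "bdd_below (A y)" for y by (auto simp: A_def intro!: bdd_belowI[of _ 0])
  have ne: "A y \<noteq> {}" if y: "y \<in> E" for y
  proof -
    obtain t where t: "t > 0" "t *\<^sub>R y \<in> C" using absorb[OF y] by blast
    then have "y = 0 + inverse t *\<^sub>R (t *\<^sub>R y)" by simp
    then have "inverse t \<in> A y" unfolding A_def using N(2) t
      by (metis (mono_tags, lifting) inverse_positive_iff_positive mem_Collect_eq)
    then show ?thesis by blast
  qed
  have A_add: "s + t \<in> A (x + y)" if st: "s \<in> A x" "t \<in> A y" for s t x y
  proof -
    obtain n c n' c' where *: "n \<in> N" "c \<in> C" "x = n + s *\<^sub>R c" "n' \<in> N" "c' \<in> C" "y = n' + t *\<^sub>R c'"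
      "s > 0" "t > 0" using st unfolding A_def by blast
    let ?c = "(s / (s + t)) *\<^sub>R c + (t / (s + t)) *\<^sub>R c'"
    have "?c \<in> C" using * by (intro convexD[OF C(1)]) (auto simp flip: add_divide_distrib)
    moreover have "x + y = (n + n') + (s + t) *\<^sub>R ?c"
      using * by (simp add: scaleR_add_right)
    ultimately have "\<exists>n\<in>N. \<exists>c\<in>C. x + y = n + (s + t) *\<^sub>R c"
      using N_add[OF *(1,4)] by blast
    then show ?thesis unfolding A_def using *(7,8) by simp
  qed
  have A_scale: "r * t \<in> A (r *\<^sub>R x)" if rt: "r > 0" "t \<in> A x" for r t x
  proof -
    obtain n c where *: "n \<in> N" "c \<in> C" "x = n + t *\<^sub>R c" "t > 0" using rt unfolding A_def by blast
    have "r *\<^sub>R x = r *\<^sub>R n + (r * t) *\<^sub>R c" using * by (simp add: scaleR_add_right)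
    moreover have "r *\<^sub>R n \<in> N" using rt *(1) by (intro N_scale) auto
    ultimately show ?thesis unfolding A_def using *(2,4) rt(1) by auto
  qed
  have d_nonneg: "0 \<le> d y" if "y \<in> E" for y
    unfolding d_def by (rule cInf_greatest[OF ne[OF that]]) (auto simp: A_def)
  have d_N: "d n = 0" if n: "n \<in> N" for n
  proof (rule antisym)
    show "0 \<le> d n" using n N by (intro d_nonneg) auto
    show "d n \<le> 0"
    proof (rule field_le_epsilon)
      fix e :: real assume "e > 0"
      have "n = n + e *\<^sub>R 0" by simp
      then have "\<exists>m\<in>N. \<exists>c\<in>C. n = m + e *\<^sub>R c" using n C(3) by blast
      with \<open>e > 0\<close> have "e \<in> A n" by (simp add: A_def)
      then show "d n \<le> 0 + e" unfolding d_def using bdd by (simp add: cInf_lower)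
    qed
  qed
  have d_v: "1 \<le> d v"
    unfolding d_def
  proof (rule cInf_greatest[OF ne[OF v(1)]])
    fix t assume "t \<in> A v"
    then obtain n c where *: "n \<in> N" "c \<in> C" "v = n + t *\<^sub>R c" "t > 0" unfolding A_def by blast
    show "1 \<le> t"
    proof (rule ccontr)
      assume "\<not> 1 \<le> t"
      then have "t *\<^sub>R c + (1 - t) *\<^sub>R 0 \<in> C" using * C(3) by (intro convexD[OF C(1)]) auto
      then have "v - t *\<^sub>R c \<in> U" using C(4) by simp
      moreover have "v - t *\<^sub>R c = n" using *(3) by simp
      ultimately show False using *(1) U(3) by auto
    qed
  qed
  have zero: "Inf (A 0) = 0" using d_N[OF N(2)] by (simp add: d_def)
  have sublin: "\<And>x y. x \<in> E \<Longrightarrow> y \<in> E \<Longrightarrow> d (x + y) \<le> d x + d y"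
    "\<And>r x. r \<ge> 0 \<Longrightarrow> x \<in> E \<Longrightarrow> d (r *\<^sub>R x) = r * d x"
    unfolding d_def by (rule Inf_family_sublinear[OF E, where A = A]; simp add: ne bdd zero A_add A_scale)+
  obtain F where F: "linear F" "\<And>x. x \<in> E \<Longrightarrow> F x \<le> d x" "F v = d v"
    by (rule hahn_banach_subspace[OF E sublin v(1)]) blast+
  show ?thesis
  proof (rule that[of "\<lambda>x. - F x"])
    show "linear (\<lambda>x. - F x)" using F(1) by (rule linear_compose_neg)
    show "- F n \<ge> 0" if "n \<in> N" for n using F(2)[of n] d_N[OF that] N(1) that by auto
    show "- F v < 0" using F(3) d_v by simp
  qed
qed

text \<open>The bipolar theorem for cones: closed half-spaces give one inclusion, separation the
  other. The functionals range over the full algebraic dual because all of them are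
  continuous.\<close>

theorem closure_of_cone_finest:
  fixes N :: "'v::real_vector set"
  assumes E: "subspace E" and N: "N \<subseteq> E" "0 \<in> N"
    and N_add: "\<And>x y. x \<in> N \<Longrightarrow> y \<in> N \<Longrightarrow> x + y \<in> N"
    and N_scale: "\<And>r x. r \<ge> 0 \<Longrightarrow> x \<in> N \<Longrightarrow> r *\<^sub>R x \<in> N"
  shows "finest_locally_convex E closure_of N =
    {v \<in> E. \<forall>F :: 'v \<Rightarrow> real. linear F \<longrightarrow> (\<forall>n\<in>N. F n \<ge> 0) \<longrightarrow> F v \<ge> 0}"
proof (intro equalityI subsetI)
  fix v assume v: "v \<in> finest_locally_convex E closure_of N"
  have "v \<in> E"
    using v closure_of_subset_topspace[of "finest_locally_convex E" N]
      locally_convex_finest_locally_convex[OF E] by (auto simp: locally_convex_topology_def)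
  moreover have "F v \<ge> 0" if F: "linear F" "\<forall>n\<in>N. F n \<ge> 0" for F :: "'v \<Rightarrow> real"
  proof -
    have "finest_locally_convex E closure_of N \<subseteq> {f \<in> E. F f \<ge> 0}"
      using F(2) N(1) by (intro closure_of_minimal closedin_halfspace_finest[OF E F(1)]) auto
    then show ?thesis using v by auto
  qed
  ultimately show "v \<in> {v \<in> E. \<forall>F :: 'v \<Rightarrow> real. linear F \<longrightarrow> (\<forall>n\<in>N. F n \<ge> 0) \<longrightarrow> F v \<ge> 0}" by auto
next
  fix v assume v: "v \<in> {v \<in> E. \<forall>F :: 'v \<Rightarrow> real. linear F \<longrightarrow> (\<forall>n\<in>N. F n \<ge> 0) \<longrightarrow> F v \<ge> 0}"
  show "v \<in> finest_locally_convex E closure_of N"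
  proof (rule ccontr)
    assume "v \<notin> finest_locally_convex E closure_of N"
    with v obtain F :: "'v \<Rightarrow> real" where "linear F" "\<And>n. n \<in> N \<Longrightarrow> F n \<ge> 0" "F v < 0"
      using cone_separation[OF E N N_add N_scale, of v] by blast
    with v show False by fastforce
  qed
qed

section \<open>Measures on the Cantor space\<close>

definition cylinder :: "('i \<Rightarrow> bool) set \<Rightarrow> bool" where
  "cylinder A \<longleftrightarrow> (\<exists>J. finite J \<and> (\<forall>b b'. (\<forall>i\<in>J. b i = b' i) \<longrightarrow> (b \<in> A \<longleftrightarrow> b' \<in> A)))"

lemma cylinderI:
  assumes "finite J" "\<And>b b'. \<forall>i\<in>J. b i = b' i \<Longrightarrow> b \<in> A \<Longrightarrow> b' \<in> A"
  shows "cylinder A"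
  unfolding cylinder_def using assms by (intro exI[of _ J]) (metis (mono_tags, lifting))

lemma closedin_cylinder:
  fixes A :: "('i \<Rightarrow> bool) set"
  assumes "cylinder A"
  shows "closedin (product_topology (\<lambda>_. discrete_topology UNIV) UNIV) A"
proof -
  let ?X = "product_topology (\<lambda>_. discrete_topology UNIV) (UNIV :: 'i set)"
  obtain J where J: "finite J" "\<And>b b'. \<forall>i\<in>J. b i = b' i \<Longrightarrow> (b \<in> A \<longleftrightarrow> b' \<in> A)"
    using assms unfolding cylinder_def by blast
  have "openin ?X (- A)"
    unfolding openin_product_topology_alt
  proof
    fix b :: "'i \<Rightarrow> bool" assume b: "b \<in> - A"
    let ?U = "\<lambda>i. if i \<in> J then {b i} else UNIV"
    have "finite {i \<in> UNIV. ?U i \<noteq> topspace (discrete_topology UNIV)}"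
      by (rule finite_subset[OF _ J(1)]) auto
    moreover have "Pi\<^sub>E UNIV ?U \<subseteq> - A"
    proof
      fix b' assume "b' \<in> Pi\<^sub>E UNIV ?U"
      then have "\<forall>i\<in>J. b i = b' i" by (auto simp: PiE_iff split: if_splits)
      with b J(2) show "b' \<in> - A" by blast
    qed
    ultimately show "\<exists>U. finite {i \<in> UNIV. U i \<noteq> topspace (discrete_topology UNIV)} \<and>
        (\<forall>i\<in>UNIV. openin (discrete_topology UNIV) (U i)) \<and> b \<in> Pi\<^sub>E UNIV U \<and> Pi\<^sub>E UNIV U \<subseteq> - A"
      by (intro exI[of _ ?U]) auto
  qed
  then show ?thesis by (simp add: closedin_def Compl_eq_Diff_UNIV)
qed

lemma algebra_cylinder: "algebra UNIV {A :: ('i \<Rightarrow> bool) set. cylinder A}"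
  unfolding algebra_iff_Un
proof (intro conjI ballI)
  show "{} \<in> {A :: ('i \<Rightarrow> bool) set. cylinder A}" by (auto intro: cylinderI[of "{}"])
  fix A B :: "('i \<Rightarrow> bool) set" assume "A \<in> {A. cylinder A}" "B \<in> {A. cylinder A}"
  then obtain J L where
    J: "finite J" "\<And>b b'. \<forall>i\<in>J. b i = b' i \<Longrightarrow> (b \<in> A \<longleftrightarrow> b' \<in> A)" and
    L: "finite L" "\<And>b b'. \<forall>i\<in>L. b i = b' i \<Longrightarrow> (b \<in> B \<longleftrightarrow> b' \<in> B)"
    unfolding cylinder_def by blast
  show "UNIV - A \<in> {A. cylinder A}"
    unfolding mem_Collect_eq by (rule cylinderI[OF J(1)]) (use J(2) in blast)
  have "cylinder (A \<union> B)"
  proof (rule cylinderI)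
    show "finite (J \<union> L)" using J(1) L(1) by simp
    fix b b' :: "'i \<Rightarrow> bool"
    assume "\<forall>i\<in>J \<union> L. b i = b' i" "b \<in> A \<union> B"
    then show "b' \<in> A \<union> B" using J(2)[of b b'] L(2)[of b b'] by simp
  qed
  then show "A \<union> B \<in> {A. cylinder A}" by simp
qed simp

text \<open>
  Compactness of the Cantor space makes every finitely additive set function on the cylinder
  sets countably additive.
\<close>

lemma finitely_additive_extends:
  fixes m :: "('i \<Rightarrow> bool) set \<Rightarrow> real"
  assumes nonneg: "\<And>A. 0 \<le> m A"
    and add: "\<And>A B. A \<inter> B = {} \<Longrightarrow> m (A \<union> B) = m A + m B"
  obtains M where "space M = UNIV" "\<And>A. cylinder A \<Longrightarrow> A \<in> sets M"
    "\<And>A. cylinder A \<Longrightarrow> emeasure M A = ennreal (m A)"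
proof -
  let ?C = "{A :: ('i \<Rightarrow> bool) set. cylinder A}"
  interpret algebra UNIV ?C by (rule algebra_cylinder)
  have empty: "m {} = 0" using add[of "{}" "{}"] by simp
  have "\<exists>\<mu>. (\<forall>s\<in>?C. \<mu> s = ennreal (m s)) \<and> measure_space UNIV (sigma_sets UNIV ?C) \<mu>"
  proof (rule caratheodory_empty_continuous)
    show "positive ?C (\<lambda>A. ennreal (m A))" by (simp add: positive_def empty)
    show "additive ?C (\<lambda>A. ennreal (m A))"
      unfolding additive_def using nonneg by (auto simp: add ennreal_plus)
    fix A :: "nat \<Rightarrow> ('i \<Rightarrow> bool) set"
    assume A: "range A \<subseteq> ?C" "decseq A" "(\<Inter>i. A i) = {}"
    \<comment> \<open>Nested nonempty closed sets in a compact space meet, so a decreasing sequence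
      of cylinders with empty intersection reaches the empty set.\<close>
    have "\<exists>n. A n = {}"
    proof (rule ccontr)
      assume "\<nexists>n. A n = {}"
      then have "(\<Inter>n. A n) \<noteq> {}"
        using A by (intro compact_space_imp_nest[where
          X = "product_topology (\<lambda>_. discrete_topology (UNIV :: bool set)) UNIV"] closedin_cylinder)
          (auto simp: compact_space_product_topology compact_space_discrete_topology)
      with A(3) show False by simp
    qed
    then obtain n where n: "A n = {}" by blast
    have "A k = {}" if "k \<ge> n" for k using A(2) n that by (auto simp: decseq_def)
    then have "\<forall>\<^sub>F k in sequentially. ennreal (m (A k)) = 0"
      by (auto intro!: eventually_sequentiallyI[of n] simp: empty)
    then show "(\<lambda>k. ennreal (m (A k))) \<longlonglongrightarrow> 0" by (rule tendsto_eventually)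
  qed simp
  then obtain \<mu> where \<mu>: "\<And>s. cylinder s \<Longrightarrow> \<mu> s = ennreal (m s)"
    "measure_space UNIV (sigma_sets UNIV ?C) \<mu>" by blast
  let ?M = "measure_of UNIV ?C \<mu>"
  have "emeasure ?M A = ennreal (m A)" if "cylinder A" for A
    using emeasure_measure_of_sigma[of UNIV "sigma_sets UNIV ?C" \<mu> A] \<mu> that
    by (auto simp: measure_space_def sigma_sets.Basic emeasure_measure_of_conv)
  then show ?thesis using that[of ?M] by (auto simp: space_measure_of_conv sets_measure_of sigma_sets.Basic)
qed

text \<open>Rounding down to the grid of multiples of 1/k inside [-k, k), and 0 outside. The form as
  a finite sum of comparisons with rational thresholds makes the value depend on finitely many
  bits.\<close>

definition step :: "nat \<Rightarrow> real \<Rightarrow> real" where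
  "step k t = (\<Sum>l\<in>{-(int k)\<^sup>2..<(int k)\<^sup>2}.
     real_of_int l / real k * of_bool (real_of_int l / real k \<le> t \<and> t < real_of_int (l + 1) / real k))"

lemma step_eq:
  assumes k: "k > 0"
  shows "step k t = (if - real k \<le> t \<and> t < real k then real_of_int \<lfloor>t * real k\<rfloor> / real k else 0)"
proof -
  have iff: "real_of_int l / real k \<le> t \<and> t < real_of_int (l + 1) / real k \<longleftrightarrow> l = \<lfloor>t * real k\<rfloor>" for l
    using k floor_eq_iff[of "t * real k" l] by (auto simp: field_simps)
  have mem: "\<lfloor>t * real k\<rfloor> \<in> {-(int k)\<^sup>2..<(int k)\<^sup>2} \<longleftrightarrow> - real k \<le> t \<and> t < real k"
  proof -
    have "-(int k)\<^sup>2 \<le> \<lfloor>t * real k\<rfloor> \<longleftrightarrow> - (real k * real k) \<le> t * real k"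
      by (simp add: le_floor_iff power2_eq_square)
    also have "\<dots> \<longleftrightarrow> - real k \<le> t"
      using mult_le_cancel_right_pos[of "real k" "- real k" t] k by simp
    finally have 1: "-(int k)\<^sup>2 \<le> \<lfloor>t * real k\<rfloor> \<longleftrightarrow> - real k \<le> t" .
    have "\<lfloor>t * real k\<rfloor> < (int k)\<^sup>2 \<longleftrightarrow> t * real k < real k * real k"
      by (simp add: floor_less_iff power2_eq_square)
    also have "\<dots> \<longleftrightarrow> t < real k" using k by simp
    finally show ?thesis using 1 by simp
  qed
  have "(\<Sum>l\<in>S. f l * of_bool (l = a)) = (if a \<in> S then f a else 0)"
    if "finite S" for f :: "int \<Rightarrow> real" and S a
    using that by (simp add: of_bool_def if_distrib cong: if_cong)
  from this[of "{-(int k)\<^sup>2..<(int k)\<^sup>2}" "\<lambda>l. real_of_int l / real k" "\<lfloor>t * real k\<rfloor>"]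
  show ?thesis unfolding step_def iff mem by simp
qed

lemma step_close:
  assumes k: "k > 0" and t: "- real k \<le> t" "t < real k"
  shows "\<bar>step k t - t\<bar> \<le> 1 / real k"
proof -
  have "\<bar>real_of_int \<lfloor>t * real k\<rfloor> - t * real k\<bar> \<le> 1" by linarith
  then have "\<bar>real_of_int \<lfloor>t * real k\<rfloor> - t * real k\<bar> / real k \<le> 1 / real k"
    using k by (simp add: divide_right_mono)
  moreover have "\<bar>real_of_int \<lfloor>t * real k\<rfloor> - t * real k\<bar> / real k = \<bar>step k t - t\<bar>"
  proof -
    have "step k t - t = (real_of_int \<lfloor>t * real k\<rfloor> - t * real k) / real k"
      using k t by (simp add: step_eq diff_divide_distrib)
    then show ?thesis by simp
  qed
  ultimately show ?thesis by simp
qed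

text \<open>Outside [-k, k) the value is 0 and the error |t| is at most t^2/k because |t| \<ge> k.
  The quadratic bound is the point: 1 + f^2 is regular for regular f, so the functional controls
  it.\<close>

lemma step_error:
  assumes k: "k > 0"
  shows "\<bar>step k t - t\<bar> \<le> (1 + t\<^sup>2) / real k"
proof (cases "- real k \<le> t \<and> t < real k")
  case True
  then have "\<bar>step k t - t\<bar> \<le> 1 / real k" by (intro step_close k) auto
  also have "\<dots> \<le> (1 + t\<^sup>2) / real k" by (simp add: divide_right_mono)
  finally show ?thesis .
next
  case False
  then have "real k \<le> \<bar>t\<bar>" by linarith
  then have "real k * \<bar>t\<bar> \<le> \<bar>t\<bar> * \<bar>t\<bar>" by (intro mult_right_mono) auto
  then have "\<bar>t\<bar> \<le> (1 + t\<^sup>2) / real k" using k by (simp add: field_simps power2_eq_square)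
  moreover have "step k t = 0" using False unfolding step_eq[OF k] by (rule if_not_P)
  ultimately show ?thesis by simp
qed

section \<open>From a finitely additive integral to a measure on the Cantor space\<close>

locale positive_functional =
  fixes K :: "'x set" and I :: "('x \<Rightarrow> real) \<Rightarrow> real" and g :: "nat \<Rightarrow> 'x \<Rightarrow> real"
  assumes linear: "linear I"
    and positive: "\<And>h c j. (\<And>x. x \<in> K \<Longrightarrow> \<bar>h x\<bar> \<le> c * (1 + (g j x)\<^sup>2)) \<Longrightarrow>
      (\<And>x. x \<in> K \<Longrightarrow> 0 \<le> h x) \<Longrightarrow> 0 \<le> I h"
begin

text \<open>\<open>I\<close> is defined on all functions, but its positivity is guaranteed only for
  those bounded on \<open>K\<close> by a multiple of some 1 + (g j)^2; every comparison of integrals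
  is made inside this class.\<close>

definition dominated :: "nat \<Rightarrow> ('x \<Rightarrow> real) \<Rightarrow> bool" where
  "dominated j h \<longleftrightarrow> (\<exists>c. \<forall>x\<in>K. \<bar>h x\<bar> \<le> c * (1 + (g j x)\<^sup>2))"

lemma dominated_bounded:
  assumes "\<And>x. x \<in> K \<Longrightarrow> \<bar>h x\<bar> \<le> c"
  shows "dominated j h"
  unfolding dominated_def
proof (intro exI ballI)
  fix x assume "x \<in> K"
  then have "\<bar>h x\<bar> \<le> \<bar>c\<bar>" using assms[of x] by linarith
  also have "\<dots> \<le> \<bar>c\<bar> * (1 + (g j x)\<^sup>2)" by (simp add: mult_le_cancel_left1)
  finally show "\<bar>h x\<bar> \<le> \<bar>c\<bar> * (1 + (g j x)\<^sup>2)" .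
qed

lemma dominated_add:
  assumes "dominated j h" "dominated j h'"
  shows "dominated j (\<lambda>x. h x + h' x)"
proof -
  obtain c c' where "\<And>x. x \<in> K \<Longrightarrow> \<bar>h x\<bar> \<le> c * (1 + (g j x)\<^sup>2)"
    "\<And>x. x \<in> K \<Longrightarrow> \<bar>h' x\<bar> \<le> c' * (1 + (g j x)\<^sup>2)" using assms unfolding dominated_def by blast
  then have "\<And>x. x \<in> K \<Longrightarrow> \<bar>h x + h' x\<bar> \<le> (c + c') * (1 + (g j x)\<^sup>2)"
    unfolding distrib_right by (meson abs_triangle_ineq add_mono order_trans)
  then show ?thesis unfolding dominated_def by blast
qed

lemma dominated_minus: "dominated j h \<Longrightarrow> dominated j (\<lambda>x. - h x)"
  by (simp add: dominated_def)

lemma dominated_diff: "dominated j h \<Longrightarrow> dominated j h' \<Longrightarrow> dominated j (\<lambda>x. h x - h' x)"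
  using dominated_add[OF _ dominated_minus] by fastforce

lemma dominated_square: "dominated j (\<lambda>x. c * (1 + (g j x)\<^sup>2))"
  unfolding dominated_def by (intro exI[of _ "\<bar>c\<bar>"]) (simp add: abs_mult)

lemma dominated_self: "dominated j (g j)"
  unfolding dominated_def
proof (intro exI[of _ 1] ballI)
  fix x
  have "0 \<le> (\<bar>g j x\<bar> - 1)\<^sup>2 + (g j x)\<^sup>2 + 1" by simp
  then show "\<bar>g j x\<bar> \<le> 1 * (1 + (g j x)\<^sup>2)" by (simp add: power2_eq_square algebra_simps)
qed

lemma I_add: "I (\<lambda>x. h x + h' x) = I h + I h'"
  using linear_add[OF linear, of h h'] by (simp add: plus_fun_def)

lemma I_scale: "I (\<lambda>x. c * h x) = c * I h"
  using linear_scale[OF linear, of c h] by (simp add: scaleR_fun_def)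

lemma I_zero [simp]: "I (\<lambda>x. 0) = 0"
  using I_scale[of 0 "\<lambda>_. 0"] by simp

lemma I_diff: "I (\<lambda>x. h x - h' x) = I h - I h'"
  using linear_diff[OF linear, of h h'] by (simp add: fun_diff_def)

lemma I_sum: "I (\<lambda>x. \<Sum>i\<in>S. h i x) = (\<Sum>i\<in>S. I (h i))"
proof (cases "finite S")
  case True
  then show ?thesis
    by induction (simp_all add: I_add)
qed simp

lemma I_nonneg: "dominated j h \<Longrightarrow> (\<And>x. x \<in> K \<Longrightarrow> 0 \<le> h x) \<Longrightarrow> 0 \<le> I h"
  unfolding dominated_def using positive by blast

lemma I_mono:
  assumes "dominated j h" "dominated j h'" "\<And>x. x \<in> K \<Longrightarrow> h x \<le> h' x"
  shows "I h \<le> I h'"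
  using I_nonneg[OF dominated_diff[OF assms(2,1)]] assms(3) by (simp add: I_diff)

lemma I_abs_le:
  assumes "dominated j h" "dominated j h'" "\<And>x. x \<in> K \<Longrightarrow> \<bar>h x\<bar> \<le> h' x"
  shows "\<bar>I h\<bar> \<le> I h'"
proof -
  have "I h \<le> I h'" using assms(3) by (intro I_mono[OF assms(1,2)]) fastforce
  moreover have "I (\<lambda>x. - h x) \<le> I h'"
    using assms(3) by (intro I_mono[OF dominated_minus[OF assms(1)] assms(2)]) fastforce
  moreover have "I (\<lambda>x. - h x) = - I h" using I_scale[of "-1" h] by simp
  ultimately show ?thesis by linarith
qed

text \<open>
  The bits of \<open>x\<close> are the truth values of \<open>g j x < q\<close>. They determine \<open>step k (g j x)\<close>, so
  \<open>bit_step j k\<close> below is the \<open>k\<close>-th approximation of \<open>g j\<close> as a function of the bits.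
\<close>

definition bits :: "'x \<Rightarrow> nat \<times> rat \<Rightarrow> bool" where
  "bits x = (\<lambda>(j, q). g j x < of_rat q)"

text \<open>The image under \<open>bits\<close> of the finitely additive set function that
  \<open>I\<close> defines through indicators.\<close>

definition content :: "(nat \<times> rat \<Rightarrow> bool) set \<Rightarrow> real" where
  "content A = I (\<lambda>x. of_bool (bits x \<in> A))"

lemma content_nonneg: "0 \<le> content A"
  unfolding content_def by (rule I_nonneg[OF dominated_bounded[of _ 1]]) auto

lemma content_Un: "A \<inter> B = {} \<Longrightarrow> content (A \<union> B) = content A + content B"
  unfolding content_def I_add[symmetric] by (rule arg_cong[of _ _ I]) (auto simp: fun_eq_iff)

definition cantor_measure :: "(nat \<times> rat \<Rightarrow> bool) measure" where
  "cantor_measure = (SOME M. space M = UNIV \<and>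
     (\<forall>A. cylinder A \<longrightarrow> A \<in> sets M \<and> emeasure M A = ennreal (content A)))"

lemma
  shows space_cantor: "space cantor_measure = UNIV"
    and sets_cantor: "cylinder A \<Longrightarrow> A \<in> sets cantor_measure"
    and emeasure_cantor: "cylinder A \<Longrightarrow> emeasure cantor_measure A = ennreal (content A)"
proof -
  have "\<exists>M. space M = UNIV \<and> (\<forall>A. cylinder A \<longrightarrow> A \<in> sets M \<and> emeasure M A = ennreal (content A))"
    using finitely_additive_extends[of content] content_nonneg content_Un by metis
  from someI_ex[OF this, folded cantor_measure_def]
  show "space cantor_measure = UNIV"
    and "cylinder A \<Longrightarrow> A \<in> sets cantor_measure"
    and "cylinder A \<Longrightarrow> emeasure cantor_measure A = ennreal (content A)" by blast+
qed

text \<open>Such a \<phi> is a combination of indicators of the atoms \<open>C P\<close>, where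
  \<open>P\<close> records the true bits in \<open>J\<close>; on an atom both integrals are
  \<open>content (C P)\<close>, and both are linear.\<close>

lemma cylinder_function_integral:
  fixes \<phi> :: "(nat \<times> rat \<Rightarrow> bool) \<Rightarrow> real"
  assumes J: "finite J" and dep: "\<And>b b'. \<forall>i\<in>J. b i = b' i \<Longrightarrow> \<phi> b = \<phi> b'"
  shows "\<phi> \<in> borel_measurable cantor_measure" "integrable cantor_measure \<phi>"
    "(\<integral>b. \<phi> b \<partial>cantor_measure) = I (\<lambda>x. \<phi> (bits x))"
proof -
  define C where "C P = {b. \<forall>i\<in>J. b i = (i \<in> P)}" for P
  have cyl: "cylinder (C P)" for P unfolding C_def by (rule cylinderI[OF J]) auto
  have \<phi>_eq: "\<phi> b = (\<Sum>P\<in>Pow J. \<phi> (\<lambda>i. i \<in> P) * of_bool (b \<in> C P))" for b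
  proof -
    let ?P = "{i \<in> J. b i}"
    have "b \<in> C P \<longleftrightarrow> P = ?P" if "P \<in> Pow J" for P using that unfolding C_def by auto
    then have "(\<Sum>P\<in>Pow J. \<phi> (\<lambda>i. i \<in> P) * of_bool (b \<in> C P)) =
        (\<Sum>P\<in>Pow J. if P = ?P then \<phi> (\<lambda>i. i \<in> ?P) else 0)" by (intro sum.cong) auto
    also have "\<dots> = \<phi> (\<lambda>i. i \<in> ?P)" using J by simp
    also have "\<dots> = \<phi> b" by (rule dep) auto
    finally show ?thesis by simp
  qed
  have ind: "integrable cantor_measure (\<lambda>b. of_bool (b \<in> C P) :: real)"
    "(\<integral>b. of_bool (b \<in> C P) \<partial>cantor_measure) = content (C P)" for P
  proof -
    have *: "(\<lambda>b. of_bool (b \<in> C P) :: real) = indicator (C P)" by (auto simp: indicator_def)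
    show "integrable cantor_measure (\<lambda>b. of_bool (b \<in> C P) :: real)"
      unfolding * using sets_cantor[OF cyl] emeasure_cantor[OF cyl, of P]
      by (intro integrable_real_indicator) auto
    show "(\<integral>b. of_bool (b \<in> C P) \<partial>cantor_measure) = content (C P)"
      unfolding * using sets_cantor[OF cyl] emeasure_cantor[OF cyl, of P] content_nonneg
      by (simp add: measure_def space_cantor)
  qed
  have int: "integrable cantor_measure (\<lambda>b. \<Sum>P\<in>Pow J. \<phi> (\<lambda>i. i \<in> P) * of_bool (b \<in> C P))"
    by (intro Bochner_Integration.integrable_sum integrable_mult_right ind)
  then show "integrable cantor_measure \<phi>" unfolding \<phi>_eq[symmetric] .
  then show "\<phi> \<in> borel_measurable cantor_measure" by simp
  have "(\<integral>b. \<phi> b \<partial>cantor_measure) = (\<Sum>P\<in>Pow J. \<phi> (\<lambda>i. i \<in> P) * content (C P))"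
  proof -
    have "(\<integral>b. \<phi> b \<partial>cantor_measure) =
        (\<integral>b. (\<Sum>P\<in>Pow J. \<phi> (\<lambda>i. i \<in> P) * of_bool (b \<in> C P)) \<partial>cantor_measure)"
      by (rule Bochner_Integration.integral_cong[OF refl \<phi>_eq])
    then show ?thesis using ind by (simp add: Bochner_Integration.integral_sum)
  qed
  also have "\<dots> = I (\<lambda>x. \<Sum>P\<in>Pow J. \<phi> (\<lambda>i. i \<in> P) * of_bool (bits x \<in> C P))"
    unfolding I_sum I_scale content_def ..
  also have "\<dots> = I (\<lambda>x. \<phi> (bits x))" unfolding \<phi>_eq[symmetric] ..
  finally show "(\<integral>b. \<phi> b \<partial>cantor_measure) = I (\<lambda>x. \<phi> (bits x))" .
qed

text \<open>For a finite \<open>J\<close> the exceptional set is a cylinder that contains no bits of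
  points of \<open>K\<close>, so its content is 0; there are only countably many \<open>J\<close>.
  The point \<open>x\<close> may depend on \<open>J\<close>: \<open>b\<close> itself need not be the
  bits of any point.\<close>

lemma AE_realizable:
  "AE b in cantor_measure. \<forall>J. finite J \<longrightarrow> (\<exists>x\<in>K. \<forall>i\<in>J. b i = bits x i)"
proof -
  have "AE b in cantor_measure. \<exists>x\<in>K. \<forall>i\<in>J. b i = bits x i" if J: "finite J" for J
  proof -
    let ?N = "{b. \<not> (\<exists>x\<in>K. \<forall>i\<in>J. b i = bits x i)}"
    have cyl: "cylinder ?N" by (rule cylinderI[OF J]) simp
    have "\<bar>content ?N\<bar> \<le> I (\<lambda>x. 0 * (1 + (g 0 x)\<^sup>2))"
      unfolding content_def
      by (intro I_abs_le[of 0] dominated_bounded[of _ 1] dominated_square) auto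
    then have "content ?N = 0" by simp
    then have "emeasure cantor_measure ?N = 0" using emeasure_cantor[OF cyl] by simp
    then show ?thesis using sets_cantor[OF cyl] by (intro AE_I[of _ _ ?N]) auto
  qed
  then have "AE b in cantor_measure. \<forall>J\<in>Collect finite. \<exists>x\<in>K. \<forall>i\<in>J. b i = bits x i"
    by (subst AE_ball_countable) (auto intro: countable_Collect_finite)
  then show ?thesis by simp
qed

text \<open>Chebyshev: the set where |g j x| \<ge> n has content at most I(1 + (g j)^2)/n. This
  excludes bit patterns with an infinite coordinate, so no mass escapes to infinity.\<close>

lemma AE_finite:
  "AE b in cantor_measure. \<exists>n::nat. b (j, of_nat n) \<and> \<not> b (j, - of_nat n)"
proof -
  define Z where "Z n = {b :: nat \<times> rat \<Rightarrow> bool. \<not> (b (j, of_nat n) \<and> \<not> b (j, - of_nat n))}" for n :: nat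
  let ?c = "I (\<lambda>x. 1 + (g j x)\<^sup>2)"
  have cyl: "cylinder (Z n)" for n unfolding Z_def by (rule cylinderI[of "{(j, of_nat n), (j, - of_nat n)}"]) auto
  have small: "content (Z n) \<le> ?c / real n" if n: "n > 0" for n
  proof -
    have "content (Z n) \<le> I (\<lambda>x. (1 / real n) * (1 + (g j x)\<^sup>2))"
      unfolding content_def
    proof (rule I_mono[OF dominated_bounded[of _ 1] dominated_square[of j]])
      fix x assume "x \<in> K"
      show "of_bool (bits x \<in> Z n) \<le> 1 / real n * (1 + (g j x)\<^sup>2)"
      proof (cases "bits x \<in> Z n")
        case True
        then have *: "real n \<le> \<bar>g j x\<bar>" by (auto simp: bits_def of_rat_minus Z_def)
        have "1 * real n \<le> \<bar>g j x\<bar> * \<bar>g j x\<bar>" using n * by (intro mult_mono) auto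
        then show ?thesis using n by (simp add: field_simps power2_eq_square)
      qed simp
    qed auto
    then show ?thesis unfolding I_scale by simp
  qed
  have "emeasure cantor_measure (\<Inter>n. Z n) \<le> ennreal (?c / real (Suc n))" for n
  proof -
    have "emeasure cantor_measure (\<Inter>n. Z n) \<le> emeasure cantor_measure (Z (Suc n))"
      using sets_cantor[OF cyl] by (intro emeasure_mono INT_lower) auto
    also have "\<dots> \<le> ennreal (?c / real (Suc n))"
      unfolding emeasure_cantor[OF cyl] by (intro ennreal_leI small) simp
    finally show ?thesis .
  qed
  moreover have "(\<lambda>n. ennreal (?c / real (Suc n))) \<longlonglongrightarrow> ennreal 0"
    by (intro tendsto_ennrealI LIMSEQ_Suc[OF lim_const_over_n])
  ultimately have "emeasure cantor_measure (\<Inter>n. Z n) \<le> ennreal 0"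
    by (intro LIMSEQ_le_const[where X = "\<lambda>n. ennreal (?c / real (Suc n))"]) auto
  moreover have "(\<Inter>n. Z n) \<in> sets cantor_measure"
    using sets_cantor[OF cyl] by (intro sets.countable_INT) auto
  ultimately show ?thesis by (intro AE_I[of _ _ "\<Inter>n. Z n"]) (auto simp: Z_def)
qed

definition bit_step :: "nat \<Rightarrow> nat \<Rightarrow> (nat \<times> rat \<Rightarrow> bool) \<Rightarrow> real" where
  "bit_step j k b = (\<Sum>l\<in>{-(int k)\<^sup>2..<(int k)\<^sup>2}. real_of_int l / real k *
     of_bool (\<not> b (j, of_int l / of_nat k) \<and> b (j, of_int (l + 1) / of_nat k)))"

text \<open>The upper end is included, unlike in the sum, because the last term also reads the
  threshold (l + 1)/k.\<close>

definition bit_support :: "nat \<Rightarrow> nat \<Rightarrow> (nat \<times> rat) set" where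
  "bit_support j k = (\<lambda>l. (j, of_int l / of_nat k)) ` {-(int k)\<^sup>2..(int k)\<^sup>2}"

lemma finite_bit_support: "finite (bit_support j k)"
  by (simp add: bit_support_def)

lemma bit_step_cong:
  assumes "\<forall>i\<in>bit_support j k. b i = b' i"
  shows "bit_step j k b = bit_step j k b'"
  unfolding bit_step_def
proof (rule sum.cong)
  fix l assume l: "l \<in> {-(int k)\<^sup>2..<(int k)\<^sup>2}"
  then have "(j, of_int l / of_nat k) \<in> bit_support j k" "(j, of_int (l + 1) / of_nat k) \<in> bit_support j k"
    unfolding bit_support_def by (intro imageI; simp)+
  with assms show "real_of_int l / real k *
     of_bool (\<not> b (j, of_int l / of_nat k) \<and> b (j, of_int (l + 1) / of_nat k)) =
    real_of_int l / real k *
     of_bool (\<not> b' (j, of_int l / of_nat k) \<and> b' (j, of_int (l + 1) / of_nat k))" by simp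
qed simp

lemma bit_step_bits: "bit_step j k (bits x) = step k (g j x)"
  unfolding bit_step_def step_def bits_def
  by (simp only: prod.case of_rat_divide of_rat_of_int_eq of_rat_of_nat_eq not_less)

lemma bit_step_integral:
  "bit_step j k \<in> borel_measurable cantor_measure" "integrable cantor_measure (bit_step j k)"
  "(\<integral>b. bit_step j k b \<partial>cantor_measure) = I (\<lambda>x. bit_step j k (bits x))"
  using cylinder_function_integral[of "bit_support j k" "bit_step j k"] finite_bit_support bit_step_cong
  by blast+

text \<open>The coordinate \<open>j\<close> recovered from the bits alone. Where the limit does not
  exist, \<open>lim\<close> is an arbitrary value; by \<open>AE_tendsto\<close> this concerns only a
  null set.\<close>

definition limit_var :: "nat \<Rightarrow> (nat \<times> rat \<Rightarrow> bool) \<Rightarrow> real" where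
  "limit_var j b = lim (\<lambda>k. bit_step j k b)"

lemma limit_var_measurable: "limit_var j \<in> borel_measurable cantor_measure"
  unfolding limit_var_def[abs_def] by (intro borel_measurable_lim_metric bit_step_integral(1))

context
  fixes b j and n :: nat
  assumes realizable: "\<And>J. finite J \<Longrightarrow> \<exists>x\<in>K. \<forall>i\<in>J. b i = bits x i"
    and bounded: "b (j, of_nat n)" "\<not> b (j, - of_nat n)"
begin

text \<open>One point \<open>x\<close> of \<open>K\<close> matches all bits read by both
  approximations and by the bounds, so both are compared with the same number \<open>g j x\<close>,
  which lies in [-n, n).\<close>

lemma bit_step_near:
  assumes k: "k > 0" "k \<ge> n" and l: "l > 0" "l \<ge> n"
  shows "\<bar>bit_step j k b - bit_step j l b\<bar> \<le> 1 / real k + 1 / real l"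
proof -
  let ?J = "{(j, of_nat n), (j, - of_nat n)} \<union> (bit_support j k \<union> bit_support j l)"
  have "finite ?J" by (simp add: finite_bit_support)
  from realizable[OF this] obtain x where x: "x \<in> K" "\<forall>i\<in>?J. b i = bits x i" by (elim bexE)
  then have "b (j, of_nat n) = bits x (j, of_nat n)" "b (j, - of_nat n) = bits x (j, - of_nat n)"
    by blast+
  with bounded have gx: "g j x < real n" "- real n \<le> g j x" by (simp_all add: bits_def of_rat_minus)
  have "bit_step j k b = bit_step j k (bits x)" "bit_step j l b = bit_step j l (bits x)"
    by (rule bit_step_cong, use x(2) in blast)+
  then have "bit_step j k b = step k (g j x)" "bit_step j l b = step l (g j x)"
    by (simp_all only: bit_step_bits)
  moreover have "\<bar>step k (g j x) - g j x\<bar> \<le> 1 / real k"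
    using gx k by (intro step_close) auto
  moreover have "\<bar>step l (g j x) - g j x\<bar> \<le> 1 / real l"
    using gx l by (intro step_close) auto
  ultimately show ?thesis by linarith
qed

lemma bit_step_tendsto: "(\<lambda>k. bit_step j k b) \<longlonglongrightarrow> limit_var j b"
proof -
  have "Cauchy (\<lambda>k. bit_step j k b)"
  proof (rule metric_CauchyI)
    fix e :: real assume e: "e > 0"
    obtain N :: nat where N: "2 / e < real N" using reals_Archimedean2 by blast
    moreover have "0 < 2 / e" using e by simp
    ultimately have "0 < real N" by linarith
    with N have N: "N > 0" "2 / e < real N" by simp_all
    show "\<exists>M. \<forall>k\<ge>M. \<forall>l\<ge>M. dist (bit_step j k b) (bit_step j l b) < e"
    proof (intro exI[of _ "max N n"] allI impI)
      fix k l assume kl: "k \<ge> max N n" "l \<ge> max N n"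
      then have "1 / real k \<le> 1 / real N" "1 / real l \<le> 1 / real N"
        using N(1) by (auto intro!: divide_left_mono mult_pos_pos)
      moreover have "1 / real N + 1 / real N < e" using N e by (simp add: field_simps)
      moreover have "\<bar>bit_step j k b - bit_step j l b\<bar> \<le> 1 / real k + 1 / real l"
        using kl N(1) by (intro bit_step_near) auto
      ultimately show "dist (bit_step j k b) (bit_step j l b) < e"
        unfolding dist_real_def by linarith
    qed
  qed
  then show ?thesis
    unfolding limit_var_def by (simp add: Cauchy_convergent_iff convergent_LIMSEQ_iff)
qed

lemma bit_step_limit_var:
  assumes k: "k > 0" "k \<ge> n"
  shows "\<bar>bit_step j k b - limit_var j b\<bar> \<le> 1 / real k"
proof (rule LIMSEQ_le)
  show "(\<lambda>l. \<bar>bit_step j k b - bit_step j l b\<bar>) \<longlonglongrightarrow> \<bar>bit_step j k b - limit_var j b\<bar>"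
    by (intro tendsto_intros bit_step_tendsto)
  show "(\<lambda>l. 1 / real k + 1 / real l) \<longlonglongrightarrow> 1 / real k"
    using tendsto_add[OF tendsto_const lim_const_over_n[of 1], of "1 / real k"] by simp
  show "\<exists>N. \<forall>l\<ge>N. \<bar>bit_step j k b - bit_step j l b\<bar> \<le> 1 / real k + 1 / real l"
    using bit_step_near[OF k] by (intro exI[of _ "max 1 n"]) simp
qed

end

text \<open>Almost every \<open>b\<close> yields coordinates that are limits of coordinates of
  points of \<open>K\<close>, although no single point need have the bits \<open>b\<close>.
  Closedness of \<open>K\<close> later turns the limit into a point.\<close>

lemma AE_approximable:
  "AE b in cantor_measure. \<forall>n. \<exists>x\<in>K. \<forall>j<n. \<bar>limit_var j b - g j x\<bar> \<le> 1 / real (Suc n)"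
proof -
  have "AE b in cantor_measure. \<forall>j. \<exists>n::nat. b (j, of_nat n) \<and> \<not> b (j, - of_nat n)"
    using AE_finite by (subst AE_all_countable) blast
  with AE_realizable show ?thesis
  proof eventually_elim
    case (elim b)
    then obtain N :: "nat \<Rightarrow> nat" where N: "\<And>j. b (j, of_nat (N j))" "\<And>j. \<not> b (j, - of_nat (N j))"
      by metis
    have real: "\<And>J. finite J \<Longrightarrow> \<exists>x\<in>K. \<forall>i\<in>J. b i = bits x i" using elim by blast
    show ?case
    proof
      fix n
      \<comment> \<open>The factor 2 leaves room for two errors of 1/k within
        \<open>1 / real (Suc n)\<close>; the sum is a common upper bound for the \<open>N j\<close>
        with j < n, so that \<open>step_close\<close> applies to each coordinate.\<close>
      define k where "k = 2 * Suc n + (\<Sum>j<n. N j)"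
      have k: "k > 0" "k \<ge> 2 * Suc n" by (auto simp: k_def)
      have kN: "k \<ge> N j" if "j < n" for j
        using that member_le_sum[of j "{..<n}" N] by (simp add: k_def)
      let ?J = "\<Union>j\<in>{..<n}. {(j, of_nat (N j)), (j, - of_nat (N j))} \<union> bit_support j k"
      have "finite ?J" by (simp add: finite_bit_support)
      then obtain x where x: "x \<in> K" "\<forall>i\<in>?J. b i = bits x i" using real by blast
      have "\<bar>limit_var j b - g j x\<bar> \<le> 1 / real (Suc n)" if j: "j < n" for j
      proof -
        have "bits x (j, of_nat (N j))" "\<not> bits x (j, - of_nat (N j))" using N x(2) j by auto
        then have gx: "g j x < real (N j)" "- real (N j) \<le> g j x" by (auto simp: bits_def of_rat_minus)
        have "bit_step j k b = step k (g j x)"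
          unfolding bit_step_bits[symmetric] using x(2) j by (intro bit_step_cong) auto
        moreover have "\<bar>step k (g j x) - g j x\<bar> \<le> 1 / real k"
          using gx k kN[OF j] by (intro step_close) auto
        moreover have "\<bar>bit_step j k b - limit_var j b\<bar> \<le> 1 / real k"
          by (intro bit_step_limit_var[OF real N(1) N(2)] k kN j)
        ultimately have "\<bar>limit_var j b - g j x\<bar> \<le> 2 * (1 / real k)" by linarith
        also have "\<dots> \<le> 2 * (1 / real (2 * Suc n))" using k by (intro mult_left_mono frac_le) auto
        also have "\<dots> = 1 / real (Suc n)" by (simp add: field_simps)
        finally show ?thesis .
      qed
      with x(1) show "\<exists>x\<in>K. \<forall>j<n. \<bar>limit_var j b - g j x\<bar> \<le> 1 / real (Suc n)" by blast
    qed
  qed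
qed

lemma AE_tendsto: "AE b in cantor_measure. (\<lambda>k. bit_step j k b) \<longlonglongrightarrow> limit_var j b"
  using AE_realizable AE_finite[of j]
proof eventually_elim
  case (elim b)
  then obtain n :: nat where "b (j, of_nat n)" "\<not> b (j, - of_nat n)" by blast
  then show ?case using elim(1) by (intro bit_step_tendsto[of b j n]) auto
qed

lemma dominated_step:
  assumes "k > 0"
  shows "dominated j (\<lambda>x. step k (g j x))"
proof -
  have "dominated j (\<lambda>x. step k (g j x) - g j x)"
    unfolding dominated_def using step_error[OF assms] by (intro exI[of _ "1 / real k"]) simp
  from dominated_add[OF this dominated_self] show ?thesis by simp
qed

text \<open>Both rounding errors are multiples of 1 + (g j)^2, which \<open>I\<close> can integrate.
  Almost sure convergence of the approximations alone would not control their integrals.\<close>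

lemma bit_step_L1:
  assumes k: "k > 0" and l: "l > 0"
  shows "(\<integral>\<^sup>+b. ennreal \<bar>bit_step j k b - bit_step j l b\<bar> \<partial>cantor_measure) \<le>
    ennreal ((1 / real k + 1 / real l) * I (\<lambda>x. 1 + (g j x)\<^sup>2))"
proof -
  let ?\<phi> = "\<lambda>b. \<bar>bit_step j k b - bit_step j l b\<bar>"
  have \<phi>: "integrable cantor_measure ?\<phi>" "(\<integral>b. ?\<phi> b \<partial>cantor_measure) = I (\<lambda>x. ?\<phi> (bits x))"
  proof -
    have fin: "finite (bit_support j k \<union> bit_support j l)" by (simp add: finite_bit_support)
    have dep: "?\<phi> b = ?\<phi> b'" if "\<forall>i\<in>bit_support j k \<union> bit_support j l. b i = b' i" for b b'
      using that bit_step_cong[of j k b b'] bit_step_cong[of j l b b'] by simp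
    show "integrable cantor_measure ?\<phi>" "(\<integral>b. ?\<phi> b \<partial>cantor_measure) = I (\<lambda>x. ?\<phi> (bits x))"
      using cylinder_function_integral(2,3)[OF fin, of ?\<phi>] dep by blast+
  qed
  have "I (\<lambda>x. ?\<phi> (bits x)) \<le> I (\<lambda>x. (1 / real k + 1 / real l) * (1 + (g j x)\<^sup>2))"
    unfolding bit_step_bits
  proof (intro I_mono[of j] dominated_square)
    have "dominated j (\<lambda>x. step k (g j x) - step l (g j x))"
      by (intro dominated_diff dominated_step k l)
    then show "dominated j (\<lambda>x. \<bar>step k (g j x) - step l (g j x)\<bar>)" by (simp add: dominated_def)
    fix x
    show "\<bar>step k (g j x) - step l (g j x)\<bar> \<le> (1 / real k + 1 / real l) * (1 + (g j x)\<^sup>2)"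
      using step_error[OF k, of "g j x"] step_error[OF l, of "g j x"]
      by (simp add: distrib_right add_divide_distrib)
  qed
  then have "(\<integral>b. ?\<phi> b \<partial>cantor_measure) \<le> (1 / real k + 1 / real l) * I (\<lambda>x. 1 + (g j x)\<^sup>2)"
    unfolding \<phi>(2) I_scale .
  then show ?thesis
    by (subst nn_integral_eq_integral[OF \<phi>(1)]) (auto intro: ennreal_leI)
qed

text \<open>Fatou's lemma applied to \<open>bit_step_L1\<close> as l tends to infinity; the 2 comes
  from 1/k + 1/l \<le> 2/k for l \<ge> k.\<close>

lemma limit_var_L1:
  assumes k: "k > 0"
  shows "(\<integral>\<^sup>+b. ennreal \<bar>bit_step j k b - limit_var j b\<bar> \<partial>cantor_measure) \<le>
    ennreal (2 / real k * I (\<lambda>x. 1 + (g j x)\<^sup>2))"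
proof -
  let ?u = "\<lambda>l b. ennreal \<bar>bit_step j k b - bit_step j l b\<bar>"
  have c: "0 \<le> I (\<lambda>x. 1 + (g j x)\<^sup>2)"
    using I_nonneg[OF dominated_square[of j 1]] by simp
  have "AE b in cantor_measure. ennreal \<bar>bit_step j k b - limit_var j b\<bar> = liminf (\<lambda>l. ?u l b)"
    using AE_tendsto[of j]
  proof eventually_elim
    case (elim b)
    then have "(\<lambda>l. ?u l b) \<longlonglongrightarrow> ennreal \<bar>bit_step j k b - limit_var j b\<bar>"
      by (intro tendsto_ennrealI tendsto_intros)
    then show ?case by (intro lim_imp_Liminf[symmetric] sequentially_bot)
  qed
  then have "(\<integral>\<^sup>+b. ennreal \<bar>bit_step j k b - limit_var j b\<bar> \<partial>cantor_measure) =
      (\<integral>\<^sup>+b. liminf (\<lambda>l. ?u l b) \<partial>cantor_measure)" by (rule nn_integral_cong_AE)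
  also have "\<dots> \<le> liminf (\<lambda>l. \<integral>\<^sup>+b. ?u l b \<partial>cantor_measure)"
    using bit_step_integral(1) by (intro nn_integral_liminf) auto
  also have "\<dots> \<le> liminf (\<lambda>l. ennreal (2 / real k * I (\<lambda>x. 1 + (g j x)\<^sup>2)))"
  proof (rule Liminf_mono, rule eventually_sequentiallyI[of k])
    fix l assume l: "k \<le> l"
    have "(1 / real k + 1 / real l) \<le> 2 / real k" using k l by (simp add: field_simps)
    then have "(1 / real k + 1 / real l) * I (\<lambda>x. 1 + (g j x)\<^sup>2) \<le> 2 / real k * I (\<lambda>x. 1 + (g j x)\<^sup>2)"
      using c by (rule mult_right_mono)
    with bit_step_L1[OF k, of l j] k l
    show "(\<integral>\<^sup>+b. ?u l b \<partial>cantor_measure) \<le> ennreal (2 / real k * I (\<lambda>x. 1 + (g j x)\<^sup>2))"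
      by (meson ennreal_leI order_trans order_less_le_trans)
  qed
  also have "\<dots> = ennreal (2 / real k * I (\<lambda>x. 1 + (g j x)\<^sup>2))" by (simp add: Liminf_const)
  finally show ?thesis .
qed

lemma limit_var_integrable: "integrable cantor_measure (limit_var j)"
proof -
  have "integrable cantor_measure (\<lambda>b. bit_step j 1 b - limit_var j b)"
  proof (rule integrableI_bounded)
    show "(\<lambda>b. bit_step j 1 b - limit_var j b) \<in> borel_measurable cantor_measure"
      using bit_step_integral(1) limit_var_measurable by auto
    show "(\<integral>\<^sup>+b. ennreal (norm (bit_step j 1 b - limit_var j b)) \<partial>cantor_measure) < \<infinity>"
      using limit_var_L1[of 1 j] by (auto intro: order_le_less_trans)
  qed
  from Bochner_Integration.integrable_diff[OF bit_step_integral(2)[of j 1] this] show ?thesis by simp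
qed

lemma limit_var_integral: "(\<integral>b. limit_var j b \<partial>cantor_measure) = I (g j)"
proof -
  let ?c = "I (\<lambda>x. 1 + (g j x)\<^sup>2)"
  have c: "0 \<le> ?c" using I_nonneg[OF dominated_square[of j 1]] by simp
  \<comment> \<open>Of the 3, two parts bound the L1 distance from \<open>bit_step j k\<close> to
    \<open>limit_var j\<close>, and one bounds the rounding error under \<open>I\<close>.\<close>
  have bound: "\<bar>(\<integral>b. limit_var j b \<partial>cantor_measure) - I (g j)\<bar> \<le> 3 * ?c / real k" if k: "k > 0" for k
  proof -
    have "\<bar>(\<integral>b. bit_step j k b - limit_var j b \<partial>cantor_measure)\<bar> \<le>
        (\<integral>b. \<bar>bit_step j k b - limit_var j b\<bar> \<partial>cantor_measure)"
      by (rule integral_abs_bound)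
    also have "\<dots> \<le> 2 / real k * ?c"
    proof -
      have "integrable cantor_measure (\<lambda>b. \<bar>bit_step j k b - limit_var j b\<bar>)"
        using bit_step_integral(2) limit_var_integrable by auto
      then have "ennreal (\<integral>b. \<bar>bit_step j k b - limit_var j b\<bar> \<partial>cantor_measure) \<le> ennreal (2 / real k * ?c)"
        using limit_var_L1[OF k, of j] by (simp add: nn_integral_eq_integral)
      then show ?thesis using c by (subst (asm) ennreal_le_iff) auto
    qed
    finally have 1: "\<bar>(\<integral>b. bit_step j k b - limit_var j b \<partial>cantor_measure)\<bar> \<le> 2 / real k * ?c" .
    have "(\<integral>b. bit_step j k b - limit_var j b \<partial>cantor_measure) =
        I (\<lambda>x. step k (g j x)) - (\<integral>b. limit_var j b \<partial>cantor_measure)"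
      using bit_step_integral(2) limit_var_integrable
      by (simp add: bit_step_integral(3) bit_step_bits)
    moreover have "\<bar>I (\<lambda>x. step k (g j x) - g j x)\<bar> \<le> I (\<lambda>x. 1 / real k * (1 + (g j x)\<^sup>2))"
      using step_error[OF k]
      by (intro I_abs_le[of j] dominated_diff dominated_step dominated_self dominated_square k) auto
    then have "\<bar>I (\<lambda>x. step k (g j x)) - I (g j)\<bar> \<le> 1 / real k * ?c"
      unfolding I_scale I_diff .
    ultimately show ?thesis using 1 by (simp add: algebra_simps add_divide_distrib)
  qed
  have "\<bar>(\<integral>b. limit_var j b \<partial>cantor_measure) - I (g j)\<bar> \<le> 0"
  proof (rule LIMSEQ_le_const)
    show "(\<lambda>k. 3 * ?c / real k) \<longlonglongrightarrow> 0" by (rule lim_const_over_n)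
    show "\<exists>N. \<forall>k\<ge>N. \<bar>(\<integral>b. limit_var j b \<partial>cantor_measure) - I (g j)\<bar> \<le> 3 * ?c / real k"
      using bound by (intro exI[of _ 1]) auto
  qed
  then show ?thesis by simp
qed

end

section \<open>Real points\<close>

lemma real_pointsD:
  assumes "x \<in> real_points"
  shows "linear x" "x 1 = 1" "x (f * h) = x f * x h"
  using assms by (auto simp: real_points_def alg_hom_def)

lemma real_point_simps:
  assumes "x \<in> real_points"
  shows "x (f + h) = x f + x h" "x (f - h) = x f - x h" "x (- f) = - x f" "x 0 = 0"
    "x (r *\<^sub>R f) = r * x f" "x (f\<^sup>2) = (x f)\<^sup>2"
  using real_pointsD[OF assms]
  by (simp_all add: linear_add linear_diff linear_neg linear_0 linear_scale power2_eq_square)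

text \<open>The monomials in finitely many generators, as products of lists. Finite type enters the
  later arguments through this countable family.\<close>

lemma countable_spanning_sequence:
  assumes "affine_variety TYPE('a::real_comm_algebra)"
  obtains e :: "nat \<Rightarrow> 'a::real_comm_algebra" where "span (range e) = UNIV"
proof -
  obtain S :: "'a set" where S: "finite S" "subalgebra hull S = UNIV"
    using assms by (auto simp: affine_variety_def)
  define Mon where "Mon = prod_list ` lists S"
  have Mon_mult: "x * y \<in> Mon" if "x \<in> Mon" "y \<in> Mon" for x y
  proof -
    obtain xs ys where xs: "xs \<in> lists S" "x = prod_list xs" and ys: "ys \<in> lists S" "y = prod_list ys"
      using \<open>x \<in> Mon\<close> \<open>y \<in> Mon\<close> unfolding Mon_def by (elim imageE)
    have "xs @ ys \<in> lists S" using xs(1) ys(1) by simp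
    moreover have "x * y = prod_list (xs @ ys)" by (simp add: xs(2) ys(2))
    ultimately show ?thesis unfolding Mon_def by (rule rev_image_eqI)
  qed
  have "prod_list [] \<in> Mon" unfolding Mon_def by (intro imageI) simp
  then have one: "1 \<in> Mon" by simp
  have mult1: "x * y \<in> span Mon" if x: "x \<in> span Mon" and y: "y \<in> Mon" for x y
    using x
  proof (induction rule: span_induct_alt)
    case base show ?case by (simp add: span_zero)
  next
    case (step c z w)
    have "c *\<^sub>R (z * y) + w * y \<in> span Mon"
      by (intro span_add span_scale span_base Mon_mult step y)
    then show ?case by (simp add: distrib_right)
  qed
  have mult: "x * y \<in> span Mon" if x: "x \<in> span Mon" and y: "y \<in> span Mon" for x y
    using y
  proof (induction rule: span_induct_alt)
    case base show ?case by (simp add: span_zero)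
  next
    case (step c z w)
    have "c *\<^sub>R (x * z) + x * w \<in> span Mon"
      by (intro span_add span_scale mult1 step x)
    then show ?case by (simp add: distrib_left)
  qed
  have "S \<subseteq> Mon"
  proof
    fix s assume "s \<in> S"
    then have "[s] \<in> lists S" by simp
    then show "s \<in> Mon" unfolding Mon_def by (rule rev_image_eqI) simp
  qed
  then have "S \<subseteq> span Mon" using span_superset by blast
  moreover have "subalgebra (span Mon)"
    unfolding subalgebra_def using mult one by (auto intro: span_base)
  ultimately have "subalgebra hull S \<subseteq> span Mon" by (rule hull_minimal)
  then have "span Mon = UNIV" using S(2) by auto
  moreover have "countable Mon"
    unfolding Mon_def by (intro countable_image countable_lists countable_finite S(1))
  then have "range (from_nat_into Mon) = Mon" using one by (intro range_from_nat_into) auto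
  ultimately show ?thesis using that[of "from_nat_into Mon"] by simp
qed

section \<open>Functionals as sequences of reals\<close>

locale spanning_sequence =
  fixes e :: "nat \<Rightarrow> 'a::real_vector"
  assumes span: "span (range e) = UNIV"
begin

text \<open>The sequence \<open>e\<close> need not be independent, so one finite expansion is chosen
  for each \<open>f\<close>; any choice evaluates a linear functional correctly.\<close>

definition coords :: "'a \<Rightarrow> nat set \<times> (nat \<Rightarrow> real)" where
  "coords f = (SOME (J, c). finite J \<and> f = (\<Sum>j\<in>J. c j *\<^sub>R e j))"

lemma expand: "f = (\<Sum>j\<in>fst (coords f). snd (coords f) j *\<^sub>R e j)"
proof -
  have "f \<in> span (range e)" by (simp add: span)
  then obtain t r where t: "finite t" "t \<subseteq> range e" "f = (\<Sum>a\<in>t. r a *\<^sub>R a)"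
    unfolding span_explicit by blast
  then obtain J where J: "inj_on e J" "t = e ` J" unfolding subset_image_inj by blast
  then have "finite J" using t(1) finite_imageD by blast
  moreover have "f = (\<Sum>j\<in>J. r (e j) *\<^sub>R e j)" unfolding t(3) J(2) by (simp add: sum.reindex[OF J(1)])
  ultimately have "\<exists>p. case p of (J, c) \<Rightarrow> finite J \<and> f = (\<Sum>j\<in>J. c j *\<^sub>R e j)"
    by (intro exI[of _ "(J, \<lambda>j. r (e j))"]) simp
  from someI_ex[OF this, folded coords_def]
  show ?thesis by (auto simp: case_prod_beta)
qed

text \<open>The functional with prescribed values on the sequence (junk if there is none).\<close>

definition decode :: "(nat \<Rightarrow> real) \<Rightarrow> 'a \<Rightarrow> real" where
  "decode v f = (\<Sum>j\<in>fst (coords f). snd (coords f) j * v j)"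

lemma decode_linear:
  assumes "linear x"
  shows "decode (\<lambda>j. x (e j)) = x"
proof
  fix f
  have "x f = x (\<Sum>j\<in>fst (coords f). snd (coords f) j *\<^sub>R e j)"
    by (rule arg_cong[OF expand])
  also have "\<dots> = decode (\<lambda>j. x (e j)) f"
    by (simp add: decode_def linear_sum[OF assms] linear_scale[OF assms])
  finally show "decode (\<lambda>j. x (e j)) f = x f" ..
qed

lemma continuous_decode: "continuous_on UNIV decode"
  unfolding decode_def[abs_def]
  by (intro continuous_on_coordinatewise_then_product continuous_intros continuous_on_product_coordinates)

lemma decode_measurable: "decode \<in> borel_measurable borel"
  by (rule borel_measurable_continuous_onI[OF continuous_decode])

text \<open>In a product over an uncountable index set, measurability of all evaluations does not by
  itself give Borel measurability. Factoring through the countable product and the continuous map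
  \<open>decode\<close> does.\<close>

lemma measurable_functionals:
  fixes y :: "'w \<Rightarrow> 'a \<Rightarrow> real"
  assumes lin: "\<And>\<omega>. \<omega> \<in> space M \<Longrightarrow> linear (y \<omega>)"
    and meas: "\<And>j. (\<lambda>\<omega>. y \<omega> (e j)) \<in> borel_measurable M"
  shows "y \<in> borel_measurable M"
proof -
  have "(\<lambda>\<omega>. decode (\<lambda>j. y \<omega> (e j))) \<in> borel_measurable M"
    by (intro measurable_compose[OF _ decode_measurable] measurable_coordinatewise_then_product meas)
  moreover have "(\<lambda>\<omega>. decode (\<lambda>j. y \<omega> (e j))) \<in> borel_measurable M \<longleftrightarrow> y \<in> borel_measurable M"
    using lin by (intro measurable_cong decode_linear)
  ultimately show ?thesis by simp
qed

end

lemma eval_measurable: "(\<lambda>y :: 'a \<Rightarrow> real. y f) \<in> borel_measurable borel"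
  by (intro borel_measurable_continuous_onI continuous_on_product_coordinates)

lemma basic_closed_points: "basic_closed K \<Longrightarrow> x \<in> K \<Longrightarrow> x \<in> real_points"
  by (auto simp: basic_closed_def)

lemma basic_closed_limit:
  assumes K: "basic_closed K" and x: "\<And>n::nat. x n \<in> K" and lim: "\<And>f. (\<lambda>n. x n f) \<longlonglongrightarrow> y f"
  shows "y \<in> K"
proof -
  obtain F where F: "K = {x \<in> real_points. \<forall>f\<in>F. x f \<ge> 0}" using K unfolding basic_closed_def by blast
  have xr: "x n \<in> real_points" for n using x F by blast
  have "y (f + h) = y f + y h" for f h
    using LIMSEQ_unique[OF lim[of "f + h"]] tendsto_add[OF lim[of f] lim[of h]] real_point_simps(1)[OF xr] by simp
  moreover have "y (r *\<^sub>R f) = r * y f" for r f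
    using LIMSEQ_unique[OF lim[of "r *\<^sub>R f"]] tendsto_mult_left[OF lim[of f], of r] real_point_simps(5)[OF xr] by simp
  moreover have "y (f * h) = y f * y h" for f h
    using LIMSEQ_unique[OF lim[of "f * h"]] tendsto_mult[OF lim[of f] lim[of h]] real_pointsD(3)[OF xr] by simp
  moreover have "y 1 = 1" using LIMSEQ_unique[OF lim[of 1]] real_pointsD(2)[OF xr] by simp
  ultimately have "y \<in> real_points" by (simp add: real_points_def alg_hom_def linear_iff)
  moreover have "y f \<ge> 0" if "f \<in> F" for f
    using x F that by (intro LIMSEQ_le_const[OF lim[of f]]) auto
  ultimately show ?thesis using F by blast
qed

section \<open>Haviland's theorem\<close>

text \<open>\<open>h\<close> ranges over arbitrary functions, since indicators of arbitrary sets are needed for the content.\<close>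

lemma positive_extension:
  fixes L :: "'a::real_comm_algebra \<Rightarrow> real"
  assumes K: "K \<subseteq> real_points" and L: "linear L"
    and pos: "\<And>f. (\<And>x. x \<in> K \<Longrightarrow> 0 \<le> x f) \<Longrightarrow> 0 \<le> L f"
  obtains I :: "(('a \<Rightarrow> real) \<Rightarrow> real) \<Rightarrow> real" where "linear I" "\<And>f. I (\<lambda>x. x f) = L f"
    "\<And>h f. (\<And>x. x \<in> K \<Longrightarrow> \<bar>h x\<bar> \<le> x f) \<Longrightarrow> (\<And>x. x \<in> K \<Longrightarrow> 0 \<le> h x) \<Longrightarrow> 0 \<le> I h"
proof -
  note [simp] = real_point_simps[OF subsetD[OF K]]
  define D where "D = {h. \<exists>f. \<forall>x\<in>K. \<bar>h x\<bar> \<le> x f}"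
  \<comment> \<open>The infimum of \<open>A h\<close> is the upper integral of \<open>h\<close> over
    its regular majorants on \<open>K\<close>; it is finite on \<open>D\<close> and agrees with
    \<open>L\<close> on regular functions.\<close>
  define A where "A h = {L f | f. \<forall>x\<in>K. h x \<le> x f}" for h :: "('a \<Rightarrow> real) \<Rightarrow> real"
  have D: "subspace D"
    unfolding subspace_def
  proof (intro conjI ballI allI)
    show "0 \<in> D" unfolding D_def by (intro CollectI exI[of _ 0]) simp
    fix h h' assume "h \<in> D" "h' \<in> D"
    then obtain f f' where "\<forall>x\<in>K. \<bar>h x\<bar> \<le> x f" "\<forall>x\<in>K. \<bar>h' x\<bar> \<le> x f'" unfolding D_def by blast
    then show "h + h' \<in> D" unfolding D_def by (intro CollectI exI[of _ "f + f'"]) fastforce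
  next
    fix r h assume "h \<in> D"
    then obtain f where "\<forall>x\<in>K. \<bar>h x\<bar> \<le> x f" unfolding D_def by blast
    then show "r *\<^sub>R h \<in> D"
      unfolding D_def by (intro CollectI exI[of _ "\<bar>r\<bar> *\<^sub>R f"]) (simp add: abs_mult mult_left_mono)
  qed
  have ne: "A h \<noteq> {}" if h: "h \<in> D" for h
  proof -
    obtain f where "\<forall>x\<in>K. \<bar>h x\<bar> \<le> x f" using h unfolding D_def by blast
    then have "\<forall>x\<in>K. h x \<le> x f" by force
    then show ?thesis unfolding A_def by blast
  qed
  have bdd: "bdd_below (A h)" if h: "h \<in> D" for h
  proof -
    obtain f where f: "\<forall>x\<in>K. \<bar>h x\<bar> \<le> x f" using h unfolding D_def by blast
    have "- L f \<le> L f'" if "\<forall>x\<in>K. h x \<le> x f'" for f'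
    proof -
      have "0 \<le> x (f + f')" if "x \<in> K" for x
        using f \<open>\<forall>x\<in>K. h x \<le> x f'\<close> that by force
      then have "0 \<le> L (f + f')" by (rule pos)
      then show ?thesis by (simp add: linear_add[OF L])
    qed
    then show ?thesis unfolding A_def by (intro bdd_belowI[of _ "- L f"]) blast
  qed
  have A_add: "s + t \<in> A (h + h')" if st: "s \<in> A h" "t \<in> A h'" for s t h h'
  proof -
    obtain f f' where f: "s = L f" "\<forall>x\<in>K. h x \<le> x f" "t = L f'" "\<forall>x\<in>K. h' x \<le> x f'"
      using st unfolding A_def by blast
    then show ?thesis
      unfolding A_def by (intro CollectI exI[of _ "f + f'"]) (simp add: linear_add[OF L] add_mono)
  qed
  have A_scale: "r * s \<in> A (r *\<^sub>R h)" if r: "r > 0" "s \<in> A h" for r s h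
  proof -
    obtain f where f: "s = L f" "\<forall>x\<in>K. h x \<le> x f" using r unfolding A_def by blast
    then show ?thesis
      using r unfolding A_def by (intro CollectI exI[of _ "r *\<^sub>R f"]) (simp add: linear_scale[OF L])
  qed
  have zero: "Inf (A 0) = 0"
  proof (rule Inf_zeroI)
    show "0 \<le> s" if "s \<in> A 0" for s using that pos unfolding A_def by auto
    show "0 \<in> A 0" unfolding A_def by (intro CollectI exI[of _ 0]) (simp add: linear_0[OF L])
  qed
  obtain I where I: "linear I" "\<And>h. h \<in> D \<Longrightarrow> I h \<le> Inf (A h)"
  proof (rule hahn_banach_subspace[OF D, of "\<lambda>h. Inf (A h)" 0])
    show "Inf (A (x + y)) \<le> Inf (A x) + Inf (A y)" if "x \<in> D" "y \<in> D" for x y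
      by (rule Inf_family_sublinear[OF D, where A = A]; simp add: that ne bdd zero A_add A_scale)
    show "Inf (A (r *\<^sub>R x)) = r * Inf (A x)" if "r \<ge> 0" "x \<in> D" for r x
      by (rule Inf_family_sublinear[OF D, where A = A]; simp add: that ne bdd zero A_add A_scale)
    show "0 \<in> D" by (rule subspace_0[OF D])
  qed blast
  have upper: "I h \<le> L f" if "h \<in> D" "\<And>x. x \<in> K \<Longrightarrow> h x \<le> x f" for h f
  proof -
    have "L f \<in> A h" unfolding A_def using that(2) by blast
    from cInf_lower[OF this bdd[OF that(1)]] I(2)[OF that(1)] show ?thesis by linarith
  qed
  have eval_D: "(\<lambda>x. x f) \<in> D" for f
    unfolding D_def
  \<comment> \<open>The element 1 + f^2 is a regular majorant of |f|.\<close>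
  proof (intro CollectI exI[of _ "1 + f\<^sup>2"] ballI)
    fix x assume x: "x \<in> K"
    have "0 \<le> (\<bar>x f\<bar> - 1)\<^sup>2 + (x f)\<^sup>2 + 1" by simp
    then have "\<bar>x f\<bar> \<le> 1 + (x f)\<^sup>2" by (simp add: power2_eq_square algebra_simps)
    then show "\<bar>x f\<bar> \<le> x (1 + f\<^sup>2)" using x K real_pointsD(2)[of x] by auto
  qed
  show ?thesis
  proof (rule that[OF I(1)])
    fix f
    have "I (\<lambda>x. x f) \<le> L f" by (rule upper[OF eval_D]) simp
    moreover have "I (- (\<lambda>x. x f)) \<le> L (- f)"
      using subspace_neg[OF D eval_D[of f]] by (rule upper) simp
    ultimately show "I (\<lambda>x. x f) = L f" by (simp add: linear_neg[OF I(1)] linear_neg[OF L])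
  next
    fix h f assume h: "\<And>x. x \<in> K \<Longrightarrow> \<bar>h x\<bar> \<le> x f" "\<And>x. x \<in> K \<Longrightarrow> 0 \<le> h x"
    then have "h \<in> D" unfolding D_def by blast
    \<comment> \<open>Zero is a regular majorant of -h on \<open>K\<close>, so the upper integral of
      -h is at most L 0.\<close>
    then have "I (- h) \<le> L 0" using h(2) by (intro upper subspace_neg[OF D]) simp_all
    then show "0 \<le> I h" by (simp add: linear_neg[OF I(1)] linear_0[OF L])
  qed
qed

theorem haviland:
  fixes L :: "'a::real_comm_algebra \<Rightarrow> real"
  assumes V: "affine_variety TYPE('a)" and K: "basic_closed K" and L: "linear L"
    and pos: "\<And>f. (\<And>x. x \<in> K \<Longrightarrow> 0 \<le> x f) \<Longrightarrow> 0 \<le> L f"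
  obtains \<mu> where "moment_measure UNIV K \<mu>" "\<And>f. L f = (\<integral>x. x f \<partial>\<mu>)"
proof -
  have Kr: "K \<subseteq> real_points" using basic_closed_points[OF K] by blast
  obtain e :: "nat \<Rightarrow> 'a" where "span (range e) = UNIV" using countable_spanning_sequence[OF V] by blast
  then interpret spanning_sequence e by unfold_locales
  obtain I :: "(('a \<Rightarrow> real) \<Rightarrow> real) \<Rightarrow> real" where I: "linear I" "\<And>f. I (\<lambda>x. x f) = L f"
    "\<And>h f. (\<And>x. x \<in> K \<Longrightarrow> \<bar>h x\<bar> \<le> x f) \<Longrightarrow> (\<And>x. x \<in> K \<Longrightarrow> 0 \<le> h x) \<Longrightarrow> 0 \<le> I h"
    using positive_extension[OF Kr L pos] by blast
  interpret P: positive_functional K I "\<lambda>j x. x (e j)"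
  proof (rule positive_functional.intro)
    fix h c j
    assume h: "\<And>x. x \<in> K \<Longrightarrow> \<bar>h x\<bar> \<le> c * (1 + (x (e j))\<^sup>2)" "\<And>x. x \<in> K \<Longrightarrow> 0 \<le> h x"
    have "x (c *\<^sub>R (1 + (e j)\<^sup>2)) = c * (1 + (x (e j))\<^sup>2)" if "x \<in> K" for x
      using subsetD[OF Kr that] by (simp add: real_point_simps real_pointsD(2))
    with h show "0 \<le> I h" by (intro I(3)[of h "c *\<^sub>R (1 + (e j)\<^sup>2)"]) auto
  qed (rule I(1))
  let ?C = P.cantor_measure
  \<comment> \<open>The functional with the recovered coordinates; almost surely it is a pointwise
    limit of points of \<open>K\<close>, hence a point of \<open>K\<close>.\<close>
  define y where "y b = decode (\<lambda>j. P.limit_var j b)" for b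
  have "AE b in ?C. y b \<in> K"
    using P.AE_approximable
  proof eventually_elim
    case (elim b)
    then obtain x where x: "\<And>n. x n \<in> K"
      "\<And>n j. j < n \<Longrightarrow> \<bar>P.limit_var j b - x n (e j)\<bar> \<le> 1 / real (Suc n)" by metis
    have lim: "(\<lambda>n. x n (e j)) \<longlonglongrightarrow> P.limit_var j b" for j
    proof -
      have "(\<lambda>n. P.limit_var j b - x n (e j)) \<longlonglongrightarrow> 0"
      proof (rule Lim_null_comparison)
        show "\<forall>\<^sub>F n in sequentially. norm (P.limit_var j b - x n (e j)) \<le> 1 / real (Suc n)"
          using x(2) by (intro eventually_sequentiallyI[of "Suc j"]) simp
        show "(\<lambda>n. 1 / real (Suc n)) \<longlonglongrightarrow> 0" by (rule LIMSEQ_Suc[OF lim_const_over_n])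
      qed
      from tendsto_diff[OF tendsto_const[of "P.limit_var j b"] this] show ?thesis by simp
    qed
    show ?case
    proof (rule basic_closed_limit[OF K x(1)])
      fix f
      have "decode (\<lambda>j. x n (e j)) f = x n f" for n
        using decode_linear[OF real_pointsD(1)[OF subsetD[OF Kr x(1)]]] by simp
      moreover have "(\<lambda>n. decode (\<lambda>j. x n (e j)) f) \<longlonglongrightarrow> y b f"
        unfolding y_def decode_def by (intro tendsto_intros lim)
      ultimately show "(\<lambda>n. x n f) \<longlonglongrightarrow> y b f" by simp
    qed
  qed
  \<comment> \<open>Discarding the null set \<open>N\<close> makes \<open>y\<close> map into
    \<open>K\<close> everywhere, as required for an image measure on the Borel sets of
    \<open>K\<close>.\<close>
  then obtain N where N: "{b \<in> space ?C. y b \<notin> K} \<subseteq> N" "emeasure ?C N = 0" "N \<in> sets ?C"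
    by (rule AE_E)
  let ?\<Omega> = "space ?C - N"
  let ?R = "restrict_space ?C ?\<Omega>"
  let ?\<mu> = "distr ?R (restrict_space borel K) y"
  have AE\<Omega>: "AE b in ?C. b \<in> ?\<Omega>" using N(2,3) by (intro AE_I[of _ _ N]) auto
  have y_meas: "y \<in> borel_measurable ?C"
    unfolding y_def[abs_def]
    by (intro measurable_compose[OF _ decode_measurable] measurable_coordinatewise_then_product
        P.limit_var_measurable)
  have y\<Omega>: "y \<in> measurable ?R (restrict_space borel K)"
    using N(1) by (intro measurable_restrict_space2 measurable_restrict_space1 y_meas)
      (auto simp: space_restrict_space)
  have \<Omega>: "?\<Omega> \<inter> space ?C \<in> sets ?C" using N(3) by auto
  have eval: "(\<lambda>x. x f) \<in> borel_measurable (restrict_space borel K)" for f :: 'a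
    by (intro measurable_restrict_space1 eval_measurable)
  have int_y: "integrable ?C (\<lambda>b. y b f)" "(\<integral>b. y b f \<partial>?C) = L f" for f
  proof -
    show "integrable ?C (\<lambda>b. y b f)"
      unfolding y_def decode_def
      by (intro Bochner_Integration.integrable_sum integrable_mult_right P.limit_var_integrable)
    have "(\<integral>b. y b f \<partial>?C) = (\<Sum>j\<in>fst (coords f). snd (coords f) j * L (e j))"
      unfolding y_def decode_def using P.limit_var_integrable
      by (simp add: Bochner_Integration.integral_sum P.limit_var_integral I(2))
    also have "\<dots> = L f" using fun_cong[OF decode_linear[OF L], of f] by (simp add: decode_def)
    finally show "(\<integral>b. y b f \<partial>?C) = L f" .
  qed
  have int_R: "integrable ?R (\<lambda>b. y b f)" "(\<integral>b. y b f \<partial>?R) = L f" for f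
  proof -
    have ae: "AE b in ?C. indicator ?\<Omega> b *\<^sub>R y b f = y b f" using AE\<Omega> by eventually_elim simp
    have m: "(\<lambda>b. y b f) \<in> borel_measurable ?C" using int_y(1) by simp
    have m': "(\<lambda>b. indicator ?\<Omega> b *\<^sub>R y b f) \<in> borel_measurable ?C"
      using N(3) m by (intro borel_measurable_scaleR borel_measurable_indicator) auto
    show "integrable ?R (\<lambda>b. y b f)"
      unfolding integrable_restrict_space[OF \<Omega>] using integrable_cong_AE[OF m' m ae] int_y(1) by simp
    show "(\<integral>b. y b f \<partial>?R) = L f"
      unfolding integral_restrict_space[OF \<Omega>] using integral_cong_AE[OF m' m ae] int_y(2) by simp
  qed
  show ?thesis
  proof (rule that)
    show "moment_measure UNIV K ?\<mu>"
      unfolding moment_measure_def using int_R(1) by (simp add: integrable_distr_eq[OF y\<Omega> eval])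
    show "L f = (\<integral>x. x f \<partial>?\<mu>)" for f
      using int_R(2) by (simp add: integral_distr[OF y\<Omega> eval])
  qed
qed

section \<open>Tensor products and group actions\<close>

lemma tsum_linear: "linear T \<Longrightarrow> T (tsum \<beta> xs) = tsum (\<lambda>a b. T (\<beta> a b)) xs"
  by (induction xs) (auto simp: linear_0 linear_add)

lemma tensor_lift_linear: "linear T \<Longrightarrow> T (tensor_lift \<beta> t) = tensor_lift (\<lambda>a b. T (\<beta> a b)) t"
  unfolding tensor_lift_def by (rule tsum_linear)

lemma tensor_lift_abs:
  assumes "bilinear \<beta>"
  shows "tensor_lift \<beta> (abs_tensor xs) = tsum \<beta> xs"
proof -
  have "tensor_rel (rep_tensor (abs_tensor xs)) xs"
    by (rule Quotient3_rep_abs[OF Quotient3_tensor]) (simp add: tensor_rel_def)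
  from tensor_rel_tsum[OF this assms] show ?thesis by (simp add: tensor_lift_def)
qed

lemma alg_hom_tensor_lift:
  fixes \<beta> :: "'a::real_comm_algebra \<Rightarrow> 'b::real_comm_algebra \<Rightarrow> 'c::real_comm_algebra"
  assumes bil: "bilinear \<beta>" and one: "\<beta> 1 1 = 1"
    and mult: "\<And>a a' b b'. \<beta> (a * a') (b * b') = \<beta> a b * \<beta> a' b'"
  shows "alg_hom (tensor_lift \<beta>)"
  unfolding alg_hom_def
proof (intro conjI allI)
  show "linear (tensor_lift \<beta>)" by (rule linear_tensor_lift[OF bil])
  show "tensor_lift \<beta> 1 = 1" unfolding one_tensor_def by (simp add: tensor_lift_abs[OF bil] one)
  have left: "tsum (\<lambda>a' b'. u * \<beta> a' b') ys = u * tsum \<beta> ys" for u ys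
    by (induction ys) (auto simp: distrib_left)
  have right: "tsum (\<lambda>a b. \<beta> a b * u) xs = tsum \<beta> xs * u" for u xs
    by (induction xs) (auto simp: distrib_right)
  show "tensor_lift \<beta> (s * t) = tensor_lift \<beta> s * tensor_lift \<beta> t" for s t
    by (induction s, induction t)
      (simp add: times_tensor.abs_eq tensor_lift_abs[OF bil] tsum_tmul mult left right)
qed

lemma bilinear_scaleR: "linear u \<Longrightarrow> linear T \<Longrightarrow> bilinear (\<lambda>a b. u a *\<^sub>R T b)"
  by (auto simp: bilinear_def linear_iff algebra_simps)

text \<open>The map \<open>T\<close>, which is g \<otimes> h \<otimes> id, is applied to both sides
  of the coaction identity. The order is reversed on functions: f^(gh) = (f^g)^h.\<close>

lemma act_mult:
  fixes \<delta> :: "'a::real_comm_algebra \<Rightarrow> ('h::real_comm_algebra, 'a) tensor"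
  assumes action: "group_action \<Delta> \<epsilon> \<delta>" and g: "g \<in> real_points" and h: "h \<in> real_points"
  shows "act \<delta> (move \<Delta> g h) f = act \<delta> h (act \<delta> g f)"
proof -
  note lin = real_pointsD(1)[OF g] real_pointsD(1)[OF h]
  have lin\<delta>: "linear \<delta>" using action by (simp add: group_action_def alg_hom_def)
  define T' where "T' = tensor_lift (\<lambda>b p. h b *\<^sub>R (p :: 'a))"
  have bil': "bilinear (\<lambda>b p. h b *\<^sub>R (p :: 'a))" using bilinear_scaleR[OF lin(2) linear_id] by simp
  have T': "linear T'" "\<And>b p. T' (b \<otimes>\<^sub>R p) = h b *\<^sub>R p"
    unfolding T'_def by (simp_all add: linear_tensor_lift[OF bil'] tensor_lift_pure[OF bil'])
  define T where "T = tensor_lift (\<lambda>a t. g a *\<^sub>R T' t)"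
  have bil: "bilinear (\<lambda>a t. g a *\<^sub>R T' t)" by (rule bilinear_scaleR[OF lin(1) T'(1)])
  have T: "linear T" "\<And>a t. T (a \<otimes>\<^sub>R t) = g a *\<^sub>R T' t"
    unfolding T_def by (simp_all add: linear_tensor_lift[OF bil] tensor_lift_pure[OF bil])
  have lin_scale: "linear (\<lambda>r. r *\<^sub>R p)" for p :: 'a by (simp add: linear_iff scaleR_add_left)
  have mv: "move \<Delta> g h c = tensor_lift (\<lambda>a b. g a * h b) (\<Delta> c)" for c
    unfolding move_def act_def tensor_lift_linear[OF lin(2)] by (simp add: linear_scale[OF lin(2)])
  have "T (tensor_lift (\<lambda>c p. tensor_lift (\<lambda>a b. a \<otimes>\<^sub>R (b \<otimes>\<^sub>R p)) (\<Delta> c)) (\<delta> f)) =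
      tensor_lift (\<lambda>c p. tensor_lift (\<lambda>a b. (g a * h b) *\<^sub>R p) (\<Delta> c)) (\<delta> f)"
    by (simp add: tensor_lift_linear[OF T(1)] T(2) T'(2))
  also have "(\<lambda>c p. tensor_lift (\<lambda>a b. (g a * h b) *\<^sub>R p) (\<Delta> c)) = (\<lambda>c (p :: 'a). move \<Delta> g h c *\<^sub>R p)"
    by (intro ext) (simp only: mv tensor_lift_linear[OF lin_scale])
  also have "tensor_lift (\<lambda>c p. move \<Delta> g h c *\<^sub>R p) (\<delta> f) = act \<delta> (move \<Delta> g h) f"
    by (simp only: act_def)
  finally have 1: "T (tensor_lift (\<lambda>c p. tensor_lift (\<lambda>a b. a \<otimes>\<^sub>R (b \<otimes>\<^sub>R p)) (\<Delta> c)) (\<delta> f)) =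
      act \<delta> (move \<Delta> g h) f" .
  have "linear (\<lambda>f. T' (\<delta> f))" by (rule linear_compose[OF lin\<delta> T'(1), unfolded o_def])
  then have lin_act: "linear (act \<delta> h)" by (simp add: act_def[abs_def] T'_def)
  have "T (tensor_lift (\<lambda>c p. c \<otimes>\<^sub>R \<delta> p) (\<delta> f)) = tensor_lift (\<lambda>c p. g c *\<^sub>R act \<delta> h p) (\<delta> f)"
    by (simp add: tensor_lift_linear[OF T(1)] T(2) act_def T'_def)
  also have "\<dots> = act \<delta> h (act \<delta> g f)"
    unfolding act_def[of \<delta> g] tensor_lift_linear[OF lin_act] linear_scale[OF lin_act] ..
  finally show ?thesis using 1 action by (simp add: group_action_def)
qed

locale algebraic_group_action =
  fixes \<Delta> :: "'h::real_comm_algebra \<Rightarrow> ('h, 'h) tensor" and \<epsilon> :: "'h \<Rightarrow> real" and S :: "'h \<Rightarrow> 'h"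
    and \<delta> :: "'a::real_comm_algebra \<Rightarrow> ('h, 'a) tensor"
  assumes group: "linear_algebraic_group \<Delta> \<epsilon> S" and action: "group_action \<Delta> \<epsilon> \<delta>"
begin

lemma alg_hom_act:
  assumes g: "g \<in> real_points"
  shows "alg_hom (act \<delta> g)"
proof -
  have \<delta>: "alg_hom \<delta>" using action by (simp add: group_action_def)
  have "bilinear (\<lambda>c p. g c *\<^sub>R (p :: 'a))" using bilinear_scaleR[OF real_pointsD(1)[OF g] linear_id] by simp
  then have "alg_hom (tensor_lift (\<lambda>c p. g c *\<^sub>R (p :: 'a)))"
    by (rule alg_hom_tensor_lift) (simp_all add: real_pointsD[OF g])
  with \<delta> show ?thesis
    unfolding act_def[abs_def] alg_hom_def by (auto intro: linear_compose[unfolded o_def])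
qed

lemma linear_act: "g \<in> real_points \<Longrightarrow> linear (act \<delta> g)"
  using alg_hom_act by (simp add: alg_hom_def)

lemma move_real_points: "g \<in> real_points \<Longrightarrow> x \<in> real_points \<Longrightarrow> move \<delta> g x \<in> real_points"
  using alg_hom_act[of g] unfolding real_points_def alg_hom_def move_def
  by (auto intro: linear_compose[unfolded o_def])

lemma act_counit: "act \<delta> \<epsilon> f = f"
  using action by (simp add: group_action_def act_def)

lemma counit_real_point: "\<epsilon> \<in> real_points"
  using group by (simp add: linear_algebraic_group_def real_points_def)

definition inverse_point :: "('h \<Rightarrow> real) \<Rightarrow> 'h \<Rightarrow> real" where
  "inverse_point g = (\<lambda>c. g (S c))"

lemma inverse_real_point: "g \<in> real_points \<Longrightarrow> inverse_point g \<in> real_points"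
  using group unfolding linear_algebraic_group_def real_points_def alg_hom_def inverse_point_def
  by (auto intro: linear_compose[unfolded o_def])

lemma move_inverse:
  assumes g: "g \<in> real_points"
  shows "move \<Delta> (inverse_point g) g = \<epsilon>" "move \<Delta> g (inverse_point g) = \<epsilon>"
proof -
  note lin = real_pointsD(1)[OF g] real_pointsD(1)[OF inverse_real_point[OF g]]
  have S: "tensor_lift (\<lambda>a b. S a * b) (\<Delta> c) = \<epsilon> c *\<^sub>R 1" "tensor_lift (\<lambda>a b. a * S b) (\<Delta> c) = \<epsilon> c *\<^sub>R 1" for c
    using group by (auto simp: linear_algebraic_group_def)
  have "move \<Delta> (inverse_point g) g c = g (tensor_lift (\<lambda>a b. S a * b) (\<Delta> c))" for c
    unfolding move_def act_def tensor_lift_linear[OF lin(1)]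
    by (simp add: linear_scale[OF lin(1)] inverse_point_def real_pointsD(3)[OF g])
  then show "move \<Delta> (inverse_point g) g = \<epsilon>"
    by (simp add: S fun_eq_iff real_point_simps[OF g] real_pointsD(2)[OF g])
  have "move \<Delta> g (inverse_point g) c = g (tensor_lift (\<lambda>a b. a * S b) (\<Delta> c))" for c
    unfolding move_def act_def tensor_lift_linear[OF lin(2)] tensor_lift_linear[OF lin(1)]
      linear_scale[OF lin(2)] by (simp add: inverse_point_def real_pointsD(3)[OF g])
  then show "move \<Delta> g (inverse_point g) = \<epsilon>"
    by (simp add: S fun_eq_iff real_point_simps[OF g] real_pointsD(2)[OF g])
qed

lemma act_inverse:
  assumes g: "g \<in> real_points"
  shows "act \<delta> g (act \<delta> (inverse_point g) f) = f" "act \<delta> (inverse_point g) (act \<delta> g f) = f"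
  using act_mult[OF action inverse_real_point[OF g] g, of f] act_mult[OF action g inverse_real_point[OF g], of f]
  by (simp_all add: move_inverse[OF g] act_counit)

text \<open>The matrix coefficient \<open>g \<mapsto> \<phi> (f\<^sup>g)\<close> as a regular function on the group.\<close>

definition coefficient :: "('a \<Rightarrow> real) \<Rightarrow> 'a \<Rightarrow> 'h" where
  "coefficient \<phi> f = tensor_lift (\<lambda>c p. \<phi> p *\<^sub>R c) (\<delta> f)"

lemma eval_coefficient:
  assumes "linear \<phi>" "linear g"
  shows "g (coefficient \<phi> f) = \<phi> (act \<delta> g f)"
  unfolding coefficient_def act_def tensor_lift_linear[OF assms(1)] tensor_lift_linear[OF assms(2)]
  by (simp add: linear_scale[OF assms(1)] linear_scale[OF assms(2)] mult.commute)

end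

lemma group_action_comul:
  "linear_algebraic_group \<Delta> \<epsilon> S \<Longrightarrow> group_action \<Delta> \<epsilon> \<Delta>"
  by (simp add: linear_algebraic_group_def group_action_def)

locale compact_algebraic_group =
  fixes \<Delta> :: "'h::real_comm_algebra \<Rightarrow> ('h, 'h) tensor" and \<epsilon> :: "'h \<Rightarrow> real" and S :: "'h \<Rightarrow> 'h"
  assumes linear_algebraic_group: "linear_algebraic_group \<Delta> \<epsilon> S"
    and compact_points: "compact (real_points :: ('h \<Rightarrow> real) set)"

text \<open>The group acts on itself by left multiplication, with the comultiplication as coaction,
  so \<open>move \<Delta> g k\<close> is the product gk and \<open>act \<Delta> g\<close> is
  translation of functions.\<close>

sublocale compact_algebraic_group \<subseteq> algebraic_group_action \<Delta> \<epsilon> S \<Delta>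
  by unfold_locales (use linear_algebraic_group group_action_comul in auto)

section \<open>Haar measure\<close>

context compact_algebraic_group
begin

text \<open>Normalized positive functionals: they stand in for probability measures on G(R) before
  any measure is available.\<close>

definition states :: "('h \<Rightarrow> real) set" where
  "states = {h. linear h \<and> h 1 = 1 \<and> (\<forall>c. (\<forall>g\<in>real_points. 0 \<le> g c) \<longrightarrow> 0 \<le> h c)}"

lemma counit_state: "\<epsilon> \<in> states"
  using counit_real_point real_pointsD[OF counit_real_point] by (auto simp: states_def)

lemma state_mono:
  assumes h: "h \<in> states" and le: "\<And>g. g \<in> real_points \<Longrightarrow> g c \<le> g d"
  shows "h c \<le> h d"
proof -
  have "0 \<le> g (d - c)" if "g \<in> real_points" for g
    using le[OF that] by (simp add: real_point_simps[OF that])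
  then have "0 \<le> h (d - c)" using h by (auto simp: states_def)
  then show ?thesis using h by (simp add: states_def linear_diff)
qed

lemma state_const:
  assumes h: "h \<in> states" and eq: "\<And>g. g \<in> real_points \<Longrightarrow> g c = r"
  shows "h c = r"
proof -
  have g1: "g (r *\<^sub>R 1) = g c" if "g \<in> real_points" for g
    using that eq by (simp add: real_point_simps real_pointsD)
  have "h c = h (r *\<^sub>R 1)"
    by (intro antisym state_mono[OF h]) (simp_all add: g1)
  also have "\<dots> = r" using h by (simp add: states_def linear_scale)
  finally show ?thesis .
qed

definition bound :: "'h \<Rightarrow> real" where
  "bound c = (SOME B. \<forall>g\<in>real_points. \<bar>g c\<bar> \<le> B)"

lemma bound: "g \<in> real_points \<Longrightarrow> \<bar>g c\<bar> \<le> bound c"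
proof -
  have "compact ((\<lambda>g. g c) ` real_points)"
    by (intro compact_continuous_image compact_points continuous_on_product_coordinates
        continuous_on_subset[OF continuous_on_product_coordinates subset_UNIV])
  then have "bounded ((\<lambda>g. g c) ` (real_points :: ('h \<Rightarrow> real) set))" by (rule compact_imp_bounded)
  then have "\<exists>B. \<forall>g\<in>real_points. \<bar>g c\<bar> \<le> B" by (auto simp: bounded_iff)
  from someI_ex[OF this, folded bound_def] show "g \<in> real_points \<Longrightarrow> \<bar>g c\<bar> \<le> bound c" by blast
qed

lemma state_bound:
  assumes h: "h \<in> states"
  shows "\<bar>h c\<bar> \<le> bound c"
proof -
  have lin: "linear h" and one: "h 1 = 1" using h by (auto simp: states_def)
  have g1: "g (r *\<^sub>R 1) = r" if "g \<in> real_points" for g r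
    using that by (simp add: real_point_simps real_pointsD)
  have h1: "h (r *\<^sub>R 1) = r" for r by (simp add: linear_scale[OF lin] one)
  have "h c \<le> h (bound c *\<^sub>R 1)"
  proof (rule state_mono[OF h])
    fix g :: "'h \<Rightarrow> real" assume g: "g \<in> real_points"
    show "g c \<le> g (bound c *\<^sub>R 1)" unfolding g1[OF g] using bound[OF g, of c] by linarith
  qed
  moreover have "h ((- bound c) *\<^sub>R 1) \<le> h c"
  proof (rule state_mono[OF h])
    fix g :: "'h \<Rightarrow> real" assume g: "g \<in> real_points"
    show "g ((- bound c) *\<^sub>R 1) \<le> g c" unfolding g1[OF g] using bound[OF g, of c] by linarith
  qed
  ultimately show ?thesis unfolding h1 by linarith
qed

lemma closed_states: "closed states"
proof -
  have cont: "continuous_on UNIV (\<lambda>h :: 'h \<Rightarrow> real. h c)" for c by (rule continuous_on_product_coordinates)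
  have imp: "closed {h :: 'h \<Rightarrow> real. A \<longrightarrow> 0 \<le> h c}" for A c
    by (cases A) (auto intro!: closed_Collect_le cont continuous_on_const)
  show ?thesis
    unfolding states_def linear_iff
    by (intro closed_Collect_conj closed_Collect_all closed_Collect_eq imp continuous_on_add
        continuous_on_const continuous_on_scaleR cont)
qed

text \<open>Banach-Alaoglu: the states form a closed subset of a product of compact
  intervals.\<close>

lemma compact_states: "compact states"
proof -
  let ?P = "Pi\<^sub>E UNIV (\<lambda>c. {- bound c..bound c})"
  have "compactin (product_topology (\<lambda>_. euclideanreal) UNIV) ?P"
    by (simp add: compactin_PiE)
  then have P: "compact ?P" unfolding euclidean_product_topology compactin_euclidean_iff .
  have "states \<subseteq> ?P"
  proof
    fix h assume h: "h \<in> states"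
    have "h c \<in> {- bound c..bound c}" for c using state_bound[OF h, of c] by auto
    then show "h \<in> ?P" by auto
  qed
  then show ?thesis using compact_Int_closed[OF P closed_states] by (simp add: inf.absorb2)
qed

lemma translate_state:
  assumes h: "h \<in> states" and g: "g \<in> real_points"
  shows "(\<lambda>c. h (act \<Delta> g c)) \<in> states"
proof -
  have act: "linear (act \<Delta> g)" "act \<Delta> g 1 = 1" using alg_hom_act[OF g] by (auto simp: alg_hom_def)
  have "0 \<le> h (act \<Delta> g c)" if "\<forall>k\<in>real_points. 0 \<le> k c" for c
  proof -
    have "0 \<le> k (act \<Delta> g c)" if "k \<in> real_points" for k
      using move_real_points[OF g that] \<open>\<forall>k\<in>real_points. 0 \<le> k c\<close> by (auto simp: move_def)
    then show ?thesis using h by (auto simp: states_def)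
  qed
  moreover have "linear (\<lambda>c. h (act \<Delta> g c))"
    using linear_compose[OF act(1)] h by (auto simp: states_def o_def)
  ultimately show ?thesis using h act(2) by (auto simp: states_def)
qed

end

text \<open>
  A strictly convex continuous function \<open>energy\<close> on the compact convex set of states; the state
  that minimizes the supremum of \<open>energy\<close> over its orbit is unique, hence invariant.
\<close>

locale compact_algebraic_group_basis =
  compact_algebraic_group \<Delta> \<epsilon> S + spanning_sequence e
  for \<Delta> :: "'h::real_comm_algebra \<Rightarrow> ('h, 'h) tensor" and \<epsilon> S and e :: "nat \<Rightarrow> 'h"
begin

text \<open>The geometric factor and the bound on \<open>h (e j)\<close> give uniform convergence on
  the states, hence continuity of the energy. Positivity of all weights makes it strictly convex,
  because \<open>e\<close> spans.\<close>

definition weight :: "nat \<Rightarrow> real" where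
  "weight j = (1 / 2) ^ j / (1 + (bound (e j))\<^sup>2)"

definition energy :: "('h \<Rightarrow> real) \<Rightarrow> real" where
  "energy h = (\<Sum>j. weight j * (h (e j))\<^sup>2)"

lemma weight_pos: "weight j > 0"
proof -
  have "1 + (bound (e j))\<^sup>2 > 0" by (simp add: add_pos_nonneg)
  then show ?thesis by (simp add: weight_def)
qed

lemma energy_term_bound:
  assumes "h \<in> states"
  shows "norm (weight j * (h (e j))\<^sup>2) \<le> (1 / 2) ^ j"
proof -
  have pos: "1 + (bound (e j))\<^sup>2 > 0" by (simp add: add_pos_nonneg)
  have "(h (e j))\<^sup>2 \<le> (bound (e j))\<^sup>2"
    using power_mono[OF state_bound[OF assms, of "e j"], of 2] by simp
  then have "(1 / 2) ^ j * (h (e j))\<^sup>2 \<le> (1 / 2) ^ j * (1 + (bound (e j))\<^sup>2)"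
    by (intro mult_left_mono) auto
  then show ?thesis using pos by (simp add: weight_def divide_le_eq)
qed

lemma energy_summable: "h \<in> states \<Longrightarrow> summable (\<lambda>j. weight j * (h (e j))\<^sup>2)"
  using energy_term_bound by (intro summable_comparison_test[OF _ summable_geometric[of "1 / 2 :: real"]]) auto

lemma continuous_energy: "continuous_on states energy"
proof (rule uniform_limit_theorem)
  show "uniform_limit states (\<lambda>n h. \<Sum>j<n. weight j * (h (e j))\<^sup>2) energy sequentially"
    unfolding energy_def[abs_def]
    by (rule Weierstrass_m_test[OF energy_term_bound]) (auto intro: summable_geometric)
  show "\<forall>\<^sub>F n in sequentially. continuous_on states (\<lambda>h. \<Sum>j<n. weight j * (h (e j))\<^sup>2)"
    by (intro always_eventually allI continuous_intros
        continuous_on_subset[OF continuous_on_product_coordinates subset_UNIV])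
qed simp

definition orbit_energy :: "('h \<Rightarrow> real) \<Rightarrow> ('h \<Rightarrow> real) \<Rightarrow> real" where
  "orbit_energy h g = energy (\<lambda>c. h (act \<Delta> g c))"

lemma continuous_orbit_energy_state:
  assumes g: "g \<in> real_points"
  shows "continuous_on states (\<lambda>h. orbit_energy h g)"
  unfolding orbit_energy_def
proof (rule continuous_on_compose2[OF continuous_energy])
  show "continuous_on states (\<lambda>h c. h (act \<Delta> g c))"
    by (intro continuous_on_coordinatewise_then_product
        continuous_on_subset[OF continuous_on_product_coordinates subset_UNIV])
qed (use translate_state[OF _ g] in auto)

lemma continuous_orbit_energy_point:
  assumes h: "h \<in> states"
  shows "continuous_on real_points (orbit_energy h)"
  unfolding orbit_energy_def[abs_def]
proof (rule continuous_on_compose2[OF continuous_energy])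
  have lin: "linear h" using h by (simp add: states_def)
  show "continuous_on real_points (\<lambda>g c. h (act \<Delta> g c))"
  proof (rule continuous_on_coordinatewise_then_product)
    fix c
    \<comment> \<open>As a function of \<open>g\<close> the value is the evaluation of one regular
      function, a matrix coefficient.\<close>
    have "continuous_on real_points (\<lambda>g. g (coefficient h c))"
      by (rule continuous_on_subset[OF continuous_on_product_coordinates subset_UNIV])
    then show "continuous_on real_points (\<lambda>g. h (act \<Delta> g c))"
      by (rule continuous_on_eq) (simp add: eval_coefficient[OF lin real_pointsD(1)])
  qed
qed (use translate_state[OF h] in auto)

definition sublevel :: "real \<Rightarrow> ('h \<Rightarrow> real) set" where
  "sublevel a = {h \<in> states. \<forall>g\<in>real_points. orbit_energy h g \<le> a}"

lemma closed_sublevel: "closed (sublevel a)"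
proof -
  have "sublevel a = (\<Inter>g\<in>real_points. {h \<in> states. orbit_energy h g \<le> a})"
    using counit_real_point by (auto simp: sublevel_def)
  moreover have "closed {h \<in> states. orbit_energy h g \<le> a}" if "g \<in> real_points" for g
    by (intro continuous_on_closed_Collect_le continuous_orbit_energy_state that continuous_on_const
        closed_states)
  ultimately show ?thesis by (simp add: closed_INT)
qed

lemma energy_nonneg: "h \<in> states \<Longrightarrow> 0 \<le> energy h"
  unfolding energy_def
  by (intro suminf_nonneg energy_summable mult_nonneg_nonneg less_imp_le[OF weight_pos] zero_le_power2)

text \<open>Compactness of G(R) makes the supremum over the orbit a maximum. Strict convexity at
  single group elements would not survive a supremum that is only approached.\<close>

lemma exists_maximal_point:
  assumes h: "h \<in> states"
  obtains g where "g \<in> real_points" "h \<in> sublevel (orbit_energy h g)"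
proof -
  have ne: "(real_points :: ('h \<Rightarrow> real) set) \<noteq> {}" using counit_real_point by blast
  obtain g where "g \<in> real_points" "\<forall>k\<in>real_points. orbit_energy h k \<le> orbit_energy h g"
    using continuous_attains_sup[OF compact_points ne continuous_orbit_energy_point[OF h]] by blast
  with h that show ?thesis by (auto simp: sublevel_def)
qed

text \<open>The infimum of the possible orbit maxima is attained: the sublevels for m + 1/(n + 1)
  are nested, nonempty and closed in the compact set of states.\<close>

lemma minimal_sublevel:
  obtains m where "sublevel m \<noteq> {}" "\<And>a. sublevel a \<noteq> {} \<Longrightarrow> m \<le> a"
proof -
  define A where "A = {a. sublevel a \<noteq> {}}"
  define m where "m = Inf A"
  obtain g where "\<epsilon> \<in> sublevel (orbit_energy \<epsilon> g)" using exists_maximal_point[OF counit_state] by blast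
  then have ne: "A \<noteq> {}" by (auto simp: A_def)
  have "0 \<le> a" if a: "a \<in> A" for a
  proof -
    obtain h where h: "h \<in> sublevel a" using a by (auto simp: A_def)
    then have "0 \<le> orbit_energy h \<epsilon>"
      unfolding orbit_energy_def
      by (intro energy_nonneg translate_state counit_real_point) (simp add: sublevel_def)
    also have "\<dots> \<le> a" using h counit_real_point by (simp add: sublevel_def)
    finally show ?thesis .
  qed
  then have bdd: "bdd_below A" by (rule bdd_belowI)
  have mono: "sublevel a \<subseteq> sublevel b" if "a \<le> b" for a b using that by (force simp: sublevel_def)
  have nonempty: "sublevel a \<noteq> {}" if a: "m < a" for a
  proof -
    obtain b where "b \<in> A" "b < a" using cInf_lessD[OF ne] a unfolding m_def by blast
    then show ?thesis using mono[of b a] by (auto simp: A_def)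
  qed
  have "states \<inter> (\<Inter>n::nat. sublevel (m + 1 / real (Suc n))) \<noteq> {}"
  proof (rule compact_imp_fip_image[OF compact_states closed_sublevel])
    fix I' :: "nat set" assume I': "finite I'"
    define N where "N = Max (insert 0 I')"
    have "sublevel (m + 1 / real (Suc N)) \<noteq> {}" by (rule nonempty) simp
    moreover have "sublevel (m + 1 / real (Suc N)) \<subseteq> sublevel (m + 1 / real (Suc n))" if "n \<in> I'" for n
    proof (rule mono)
      have "n \<le> N" unfolding N_def using I' that by (intro Max_ge) auto
      then show "m + 1 / real (Suc N) \<le> m + 1 / real (Suc n)" by (simp add: frac_le)
    qed
    moreover have "sublevel a \<subseteq> states" for a by (auto simp: sublevel_def)
    ultimately show "states \<inter> (\<Inter>n\<in>I'. sublevel (m + 1 / real (Suc n))) \<noteq> {}" by fast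
  qed
  then obtain h where h: "h \<in> states" "\<And>n. h \<in> sublevel (m + 1 / real (Suc n))" by blast
  have "orbit_energy h g \<le> m" if g: "g \<in> real_points" for g
  proof (rule LIMSEQ_le_const)
    show "(\<lambda>n. m + 1 / real (Suc n)) \<longlonglongrightarrow> m"
      using tendsto_add[OF tendsto_const LIMSEQ_Suc[OF lim_const_over_n[of 1]], of m] by simp
    show "\<exists>N. \<forall>n\<ge>N. orbit_energy h g \<le> m + 1 / real (Suc n)" using h(2) g by (auto simp: sublevel_def)
  qed
  then have "h \<in> sublevel m" using h(1) by (simp add: sublevel_def)
  moreover have "m \<le> a" if "sublevel a \<noteq> {}" for a
    unfolding m_def using that by (intro cInf_lower bdd) (simp add: A_def)
  ultimately show ?thesis using that by blast
qed

text \<open>Parallelogram identity: the energy of (h - k)/2 is the mean of the two energies minus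
  that of the midpoint, here at most 0. As all weights are positive, \<open>h\<close> and
  \<open>k\<close> agree on the spanning sequence.\<close>

lemma energy_midpoint:
  assumes h: "h \<in> states" "k \<in> states"
  defines "mid \<equiv> \<lambda>c. (h c + k c) / 2"
  shows "mid \<in> states" "energy h \<le> a \<Longrightarrow> energy k \<le> a \<Longrightarrow> a \<le> energy mid \<Longrightarrow> h = k"
proof -
  have lin: "linear h" "linear k" using h by (auto simp: states_def)
  show mid: "mid \<in> states"
    using h by (auto simp: states_def mid_def linear_iff algebra_simps add_divide_distrib)
  assume a: "energy h \<le> a" "energy k \<le> a" "a \<le> energy mid"
  let ?d = "\<lambda>j. weight j * ((h (e j) - k (e j)) / 2)\<^sup>2"
  have d_eq: "?d j = (1 / 2) * (weight j * (h (e j))\<^sup>2) + (1 / 2) * (weight j * (k (e j))\<^sup>2)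
      - weight j * (mid (e j))\<^sup>2" for j
    by (simp add: mid_def power2_eq_square field_simps)
  have term_sums: "(\<lambda>j. weight j * (f (e j))\<^sup>2) sums energy f" if "f \<in> states" for f
    unfolding energy_def by (rule summable_sums[OF energy_summable[OF that]])
  have d: "?d sums ((1 / 2) * energy h + (1 / 2) * energy k - energy mid)"
    unfolding d_eq by (intro sums_diff sums_add sums_mult term_sums h mid)
  have d_nonneg: "0 \<le> ?d j" for j
    by (intro mult_nonneg_nonneg less_imp_le[OF weight_pos] zero_le_power2)
  have "suminf ?d \<le> 0" using a sums_unique[OF d] by linarith
  then have "suminf ?d = 0" using suminf_nonneg[OF sums_summable[OF d] d_nonneg] by linarith
  then have d0: "\<forall>j. ?d j = 0" using suminf_eq_zero_iff[OF sums_summable[OF d] d_nonneg] by (rule iffD1[rotated])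
  have "h (e j) = k (e j)" for j using spec[OF d0, of j] weight_pos[of j] by simp
  then have "decode (\<lambda>j. h (e j)) = decode (\<lambda>j. k (e j))" by presburger
  then show "h = k" by (simp only: decode_linear lin)
qed

text \<open>Take two minimizers and a \<open>g\<close> where their midpoint attains its orbit
  maximum. The translates by \<open>g\<close> have energy at most m and their midpoint at least m,
  so they coincide, and translating back shows that the minimizers do. A translate of a minimizer
  runs through the same orbit, so it is a minimizer too.\<close>

lemma invariant_state:
  obtains h where "h \<in> states" "\<And>g c. g \<in> real_points \<Longrightarrow> h (act \<Delta> g c) = h c"
proof -
  obtain m where m: "sublevel m \<noteq> {}" "\<And>a. sublevel a \<noteq> {} \<Longrightarrow> m \<le> a"
    using minimal_sublevel by blast
  have unique: "h = k" if h: "h \<in> sublevel m" and k: "k \<in> sublevel m" for h k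
  proof -
    let ?mid = "\<lambda>c. (h c + k c) / 2"
    have st: "h \<in> states" "k \<in> states" using h k by (auto simp: sublevel_def)
    obtain g where g: "g \<in> real_points" "?mid \<in> sublevel (orbit_energy ?mid g)"
      using exists_maximal_point[OF energy_midpoint(1)[OF st]] by blast
    then have "m \<le> orbit_energy ?mid g" by (intro m(2)) blast
    moreover have "orbit_energy h g \<le> m" "orbit_energy k g \<le> m" using h k g(1) by (auto simp: sublevel_def)
    ultimately have "(\<lambda>c. h (act \<Delta> g c)) = (\<lambda>c. k (act \<Delta> g c))"
      unfolding orbit_energy_def
      by (intro energy_midpoint(2)[OF translate_state[OF st(1) g(1)] translate_state[OF st(2) g(1)]])
    then have "h (act \<Delta> g (act \<Delta> (inverse_point g) c)) = k (act \<Delta> g (act \<Delta> (inverse_point g) c))" for c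
      by (rule fun_cong)
    then show ?thesis by (simp add: act_inverse[OF g(1)] fun_eq_iff)
  qed
  obtain h where h: "h \<in> sublevel m" using m(1) by blast
  then have st: "h \<in> states" by (simp add: sublevel_def)
  have "(\<lambda>c. h (act \<Delta> g c)) = h" if g: "g \<in> real_points" for g
  proof (rule unique[OF _ h])
    have "orbit_energy (\<lambda>c. h (act \<Delta> g c)) k \<le> m" if k: "k \<in> real_points" for k
    proof -
      have "orbit_energy (\<lambda>c. h (act \<Delta> g c)) k = orbit_energy h (move \<Delta> k g)"
        by (simp add: orbit_energy_def act_mult[OF action k g])
      then show ?thesis using h move_real_points[OF k g] by (simp add: sublevel_def)
    qed
    then show "(\<lambda>c. h (act \<Delta> g c)) \<in> sublevel m"
      using translate_state[OF st g] by (simp add: sublevel_def)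
  qed
  then have "h (act \<Delta> g c) = h c" if "g \<in> real_points" for g c using fun_cong that by metis
  with st that show ?thesis by blast
qed

end

section \<open>Moments determine a measure on a compact set\<close>

lemma moment_measure_space: "moment_measure B K \<mu> \<Longrightarrow> space \<mu> = K"
  using sets_eq_imp_space_eq[of \<mu> "restrict_space borel K"]
  by (simp add: moment_measure_def space_restrict_space)

lemma moment_measure_finite:
  assumes \<mu>: "moment_measure UNIV K \<mu>" and K: "K \<subseteq> real_points"
  shows "finite_measure \<mu>"
proof
  have sp: "space \<mu> = K" by (rule moment_measure_space[OF \<mu>])
  have "integrable \<mu> (\<lambda>y. y 1)" using \<mu> by (simp add: moment_measure_def)
  moreover have "integrable \<mu> (\<lambda>y. y 1) \<longleftrightarrow> integrable \<mu> (\<lambda>y. 1 :: real)"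
    using sp K real_pointsD(2) by (intro Bochner_Integration.integrable_cong) auto
  ultimately have "integrable \<mu> (\<lambda>y. 1 :: real)" by simp
  then show "emeasure \<mu> (space \<mu>) \<noteq> \<infinity>" by (simp add: integrable_iff_bounded)
qed

lemma moment_measure_measurable:
  assumes "moment_measure B K \<mu>" "f \<in> measurable borel N"
  shows "f \<in> measurable \<mu> N"
  using measurable_restrict_space1[OF assms(2), of K] assms(1)
  by (simp add: moment_measure_def cong: measurable_cong_sets)

text \<open>On a compact set, Stone--Weierstrass reduces continuous functions to regular ones.\<close>

lemma moments_determine_integral:
  fixes \<phi> :: "(nat \<Rightarrow> real) \<Rightarrow> real" and e :: "nat \<Rightarrow> 'a::real_comm_algebra"
  assumes e: "span (range e) = UNIV" and K: "compact K" "K \<subseteq> real_points"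
    and \<mu>: "moment_measure UNIV K \<mu>" and \<nu>: "moment_measure UNIV K \<nu>"
    and eq: "\<And>f. (\<integral>x. x f \<partial>\<mu>) = (\<integral>x. x f \<partial>\<nu>)"
    and \<phi>: "continuous_on UNIV \<phi>"
  shows "(\<integral>x. \<phi> (\<lambda>j. x (e j)) \<partial>\<mu>) = (\<integral>x. \<phi> (\<lambda>j. x (e j)) \<partial>\<nu>)"
proof -
  interpret spanning_sequence e by unfold_locales (rule e)
  define J where "J = (\<lambda>(x :: 'a \<Rightarrow> real) j. x (e j))"
  have J: "continuous_on UNIV J"
    unfolding J_def by (intro continuous_on_coordinatewise_then_product continuous_on_product_coordinates)
  have dec: "decode (J x) = x" if "x \<in> K" for x
    unfolding J_def by (rule decode_linear[OF real_pointsD(1)[OF subsetD[OF K(2) that]]])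
  \<comment> \<open>Only the values on the image of \<open>K\<close> are prescribed:
    \<open>R\<close> consists of the functions of sequences that become regular functions on
    \<open>K\<close>.\<close>
  define R where "R = {p. \<exists>f. \<forall>y\<in>J ` K. p y = decode y f}"
  have RI: "p \<in> R" if "\<And>x. x \<in> K \<Longrightarrow> p (J x) = x f" for p f
    unfolding R_def
  proof (intro CollectI exI[of _ f] ballI)
    fix y assume "y \<in> J ` K"
    then obtain x where "x \<in> K" "y = J x" by (elim imageE)
    then show "p y = decode y f" using that[of x] dec[of x] by simp
  qed
  have RE: "\<exists>f. \<forall>x\<in>K. p (J x) = x f" if p: "p \<in> R" for p
  proof -
    obtain f where f: "\<forall>y\<in>J ` K. p y = decode y f" using p unfolding R_def mem_Collect_eq by (elim exE)
    have "p (J x) = x f" if "x \<in> K" for x using bspec[OF f imageI[OF that]] dec[OF that] by simp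
    then show ?thesis by blast
  qed
  note pts = real_point_simps[OF subsetD[OF K(2)]] real_pointsD(2,3)[OF subsetD[OF K(2)]]
  have ring: "function_ring_on R (J ` K)"
  proof
    show "compact (J ` K)"
      by (intro compact_continuous_image K(1) continuous_on_subset[OF J subset_UNIV])
    show "continuous_on (J ` K) p" if p: "p \<in> R" for p
    proof -
      from p obtain f where f: "\<forall>y\<in>J ` K. p y = decode y f" unfolding R_def mem_Collect_eq by (elim exE)
      have "continuous_on (J ` K) (\<lambda>y. decode y f)"
        using continuous_on_product_then_coordinatewise[OF continuous_decode]
        by (rule continuous_on_subset) simp
      then show ?thesis by (rule continuous_on_eq) (simp add: f)
    qed
    show "(\<lambda>y. p y + q y) \<in> R" "(\<lambda>y. p y * q y) \<in> R" if pq: "p \<in> R" "q \<in> R" for p q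
    proof -
      from RE[OF pq(1)] obtain f where f: "\<forall>x\<in>K. p (J x) = x f" by (elim exE)
      from RE[OF pq(2)] obtain f' where f': "\<forall>x\<in>K. q (J x) = x f'" by (elim exE)
      show "(\<lambda>y. p y + q y) \<in> R" by (rule RI[of _ "f + f'"]) (simp add: f f' pts)
      show "(\<lambda>y. p y * q y) \<in> R" by (rule RI[of _ "f * f'"]) (simp add: f f' pts)
    qed
    show "(\<lambda>_. c) \<in> R" for c by (rule RI[of _ "c *\<^sub>R 1"]) (simp add: pts)
    show "\<exists>p\<in>R. p x \<noteq> p y" if "x \<in> J ` K" "y \<in> J ` K" "x \<noteq> y" for x y
    proof -
      obtain j where j: "x j \<noteq> y j" using \<open>x \<noteq> y\<close> by (auto simp: fun_eq_iff)
      have "(\<lambda>y. y j) \<in> R" by (rule RI[of _ "e j"]) (simp add: J_def)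
      with j show ?thesis by (intro bexI[of _ "\<lambda>y. y j"])
    qed
  qed
  have \<phi>J_meas: "(\<lambda>x. \<phi> (J x)) \<in> borel_measurable borel"
    using continuous_on_compose2[OF \<phi> J] by (intro borel_measurable_continuous_onI) simp
  have "bounded ((\<lambda>x. \<phi> (J x)) ` K)"
    using continuous_on_compose2[OF \<phi> J]
    by (intro compact_imp_bounded compact_continuous_image K(1)) (auto intro: continuous_on_subset)
  then obtain B where B: "\<And>x. x \<in> K \<Longrightarrow> \<bar>\<phi> (J x)\<bar> \<le> B" by (auto simp: bounded_iff)
  have close: "\<bar>(\<integral>x. \<phi> (J x) \<partial>\<mu>) - (\<integral>x. x f \<partial>\<mu>)\<bar> \<le> d * measure \<mu> K"
    if f: "\<And>x. x \<in> K \<Longrightarrow> \<bar>\<phi> (J x) - x f\<bar> \<le> d" and \<mu>: "moment_measure UNIV K \<mu>" for f d \<mu>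
  proof -
    interpret finite_measure \<mu> by (rule moment_measure_finite[OF \<mu> K(2)])
    have sp: "space \<mu> = K" by (rule moment_measure_space[OF \<mu>])
    have i1: "integrable \<mu> (\<lambda>x. \<phi> (J x))"
      using B sp by (intro integrable_const_bound[of _ B] moment_measure_measurable[OF \<mu> \<phi>J_meas]) auto
    have i2: "integrable \<mu> (\<lambda>x. x f)" using \<mu> by (simp add: moment_measure_def)
    have "\<bar>\<integral>x. \<phi> (J x) - x f \<partial>\<mu>\<bar> \<le> (\<integral>x. \<bar>\<phi> (J x) - x f\<bar> \<partial>\<mu>)" by (rule integral_abs_bound)
    also have "\<dots> \<le> (\<integral>x. d \<partial>\<mu>)"
      using i1 i2 f sp by (intro integral_mono) auto
    also have "\<dots> = d * measure \<mu> K" by (simp add: sp)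
    finally show ?thesis using i1 i2 by simp
  qed
  have diff: "\<bar>(\<integral>x. \<phi> (J x) \<partial>\<mu>) - (\<integral>x. \<phi> (J x) \<partial>\<nu>)\<bar> \<le> d * (measure \<mu> K + measure \<nu> K)" if d: "d > 0" for d
  proof -
    obtain F where F: "F \<in> UNIV \<rightarrow> R" "uniform_limit (J ` K) F \<phi> sequentially"
      using function_ring_on.Stone_Weierstrass[OF ring continuous_on_subset[OF \<phi> subset_UNIV]] by blast
    from eventually_happens[OF uniform_limitD[OF F(2) d]]
    obtain n where n: "\<forall>y\<in>J ` K. dist (F n y) (\<phi> y) < d" by auto
    have "F n \<in> R" using F(1) by auto
    from RE[OF this] obtain f where f: "\<forall>x\<in>K. F n (J x) = x f" by (elim exE)
    have "\<bar>\<phi> (J x) - x f\<bar> \<le> d" if "x \<in> K" for x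
      using bspec[OF n imageI[OF that]] bspec[OF f that] by (simp add: dist_real_def abs_minus_commute)
    from close[OF this \<mu>] close[OF this \<nu>] show ?thesis by (simp add: eq distrib_left)
  qed
  let ?m = "measure \<mu> K + measure \<nu> K"
  \<comment> \<open>The added 1 keeps the quotient r / (?m + 1) meaningful when both measures
    vanish.\<close>
  have m: "?m + 1 > 0" by (intro add_nonneg_pos add_nonneg_nonneg measure_nonneg) simp
  have "\<bar>(\<integral>x. \<phi> (J x) \<partial>\<mu>) - (\<integral>x. \<phi> (J x) \<partial>\<nu>)\<bar> \<le> 0 + r" if r: "r > 0" for r
  proof -
    have "\<bar>(\<integral>x. \<phi> (J x) \<partial>\<mu>) - (\<integral>x. \<phi> (J x) \<partial>\<nu>)\<bar> \<le> r / (?m + 1) * ?m"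
      by (rule diff) (rule divide_pos_pos[OF r m])
    also have "\<dots> \<le> r / (?m + 1) * (?m + 1)"
      using divide_pos_pos[OF r m] by (intro mult_left_mono) auto
    also have "\<dots> = r" using m by simp
    finally show ?thesis by simp
  qed
  then have "\<bar>(\<integral>x. \<phi> (J x) \<partial>\<mu>) - (\<integral>x. \<phi> (J x) \<partial>\<nu>)\<bar> \<le> 0"
    by (rule field_le_epsilon)
  then show ?thesis by (simp add: J_def)
qed

text \<open>For a nonempty closed \<open>C\<close> the functions max 0 (1 - n dist(y, C)) decrease
  to its indicator, and the closed sets are a generator stable under intersection.\<close>

lemma finite_borel_measure_eqI:
  fixes M N :: "'b::metric_space measure"
  assumes sets: "sets M = sets borel" "sets N = sets borel" and fin: "finite_measure M" "finite_measure N"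
    and eq: "\<And>\<phi> :: 'b \<Rightarrow> real. continuous_on UNIV \<phi> \<Longrightarrow> (\<And>y. 0 \<le> \<phi> y \<and> \<phi> y \<le> 1) \<Longrightarrow> (\<integral>y. \<phi> y \<partial>M) = (\<integral>y. \<phi> y \<partial>N)"
  shows "M = N"
proof (rule measure_eqI_generator_eq[where E = "Collect closed" and \<Omega> = UNIV and A = "\<lambda>_. UNIV"])
  interpret M: finite_measure M by (rule fin)
  interpret N: finite_measure N by (rule fin)
  show "Int_stable (Collect closed :: 'b set set)" by (auto simp: Int_stable_def)
  show "sets M = sigma_sets UNIV (Collect closed)" "sets N = sigma_sets UNIV (Collect closed)"
    using sets by (simp_all add: borel_eq_closed)
  show "emeasure M UNIV \<noteq> \<infinity>" by simp
  fix C :: "'b set" assume "C \<in> Collect closed"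
  then have C: "closed C" by simp
  show "emeasure M C = emeasure N C"
  proof (cases "C = {}")
    case ne: False
    define \<phi> where "\<phi> n y = max 0 (1 - real n * infdist y C)" for n y
    have cont: "continuous_on UNIV (\<phi> n)" for n
      unfolding \<phi>_def by (intro continuous_intros)
    have range: "0 \<le> \<phi> n y \<and> \<phi> n y \<le> 1" for n y by (simp add: \<phi>_def infdist_nonneg)
    have lim: "(\<lambda>n. \<phi> n y) \<longlonglongrightarrow> indicator C y" for y
    proof (cases "y \<in> C")
      case True
      then show ?thesis by (simp add: \<phi>_def)
    next
      case False
      then have pos: "infdist y C > 0"
        using in_closed_iff_infdist_zero[OF C ne] infdist_nonneg[of y C] by (simp add: less_le)
      obtain N :: nat where N: "1 / infdist y C < real N" using reals_Archimedean2 by blast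
      have "\<phi> n y = 0" if "n \<ge> N" for n
      proof -
        have "1 / infdist y C \<le> real n" using N that by linarith
        then show ?thesis using pos by (simp add: \<phi>_def field_simps)
      qed
      then have "\<forall>\<^sub>F n in sequentially. \<phi> n y = 0" by (rule eventually_sequentiallyI)
      then show ?thesis using False by (simp add: tendsto_eventually)
    qed
    have conv: "(\<lambda>n. \<integral>y. \<phi> n y \<partial>L) \<longlonglongrightarrow> measure L C" if L: "sets L = sets borel" "finite_measure L" for L
    proof -
      interpret L: finite_measure L by (rule L(2))
      have "(\<lambda>n. \<integral>y. \<phi> n y \<partial>L) \<longlonglongrightarrow> (\<integral>y. indicator C y \<partial>L)"
      proof (rule integral_dominated_convergence[where w = "\<lambda>_. 1"])
        show "\<phi> n \<in> borel_measurable L" for n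
          using borel_measurable_continuous_onI[OF cont] L(1) by (simp cong: measurable_cong_sets)
        show "(indicator C :: 'b \<Rightarrow> real) \<in> borel_measurable L"
          using C L(1) by (intro borel_measurable_indicator) simp
        show "AE y in L. (\<lambda>n. \<phi> n y) \<longlonglongrightarrow> indicator C y" using lim by simp
        show "AE y in L. norm (\<phi> n y) \<le> 1" for n using range by simp
      qed simp
      moreover have "(\<integral>y. indicator C y \<partial>L) = measure L C"
        using C L(1) sets_eq_imp_space_eq[OF L(1)] by simp
      ultimately show ?thesis by simp
    qed
    have "(\<integral>y. \<phi> n y \<partial>M) = (\<integral>y. \<phi> n y \<partial>N)" for n by (rule eq[OF cont]) (rule range)
    then have "measure M C = measure N C"
      using LIMSEQ_unique[OF conv[OF sets(1) fin(1)]] conv[OF sets(2) fin(2)] by simp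
    then show ?thesis by (simp add: M.emeasure_eq_measure N.emeasure_eq_measure)
  qed simp
qed auto

text \<open>The comparison takes place on sequences of reals, a metric space. On \<open>K\<close>
  the map \<open>decode\<close> inverts the coordinate map, so every Borel subset of
  \<open>K\<close> is a preimage of a Borel set of sequences.\<close>

theorem moment_determinacy:
  fixes K :: "('a::real_comm_algebra \<Rightarrow> real) set"
  assumes V: "affine_variety TYPE('a)" and K: "compact K" "K \<subseteq> real_points"
    and \<mu>: "moment_measure UNIV K \<mu>" and \<nu>: "moment_measure UNIV K \<nu>"
    and eq: "\<And>f. (\<integral>x. x f \<partial>\<mu>) = (\<integral>x. x f \<partial>\<nu>)"
  shows "\<mu> = \<nu>"
proof -
  obtain e :: "nat \<Rightarrow> 'a" where e: "span (range e) = UNIV" using countable_spanning_sequence[OF V] by blast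
  interpret spanning_sequence e by unfold_locales (rule e)
  define J where "J = (\<lambda>(x :: 'a \<Rightarrow> real) j. x (e j))"
  have J: "J \<in> borel_measurable borel"
    unfolding J_def by (intro borel_measurable_continuous_onI continuous_on_coordinatewise_then_product
        continuous_on_product_coordinates)
  have dec: "decode (J x) = x" if "x \<in> K" for x
    unfolding J_def by (rule decode_linear[OF real_pointsD(1)[OF subsetD[OF K(2) that]]])
  have "distr \<mu> borel J = distr \<nu> borel J"
  proof (rule finite_borel_measure_eqI)
    have "finite_measure (distr L borel J)" if L: "moment_measure UNIV K L" for L
      by (rule finite_measure.finite_measure_distr[OF moment_measure_finite[OF L K(2)]
            moment_measure_measurable[OF L J]])
    then show "finite_measure (distr \<mu> borel J)" "finite_measure (distr \<nu> borel J)"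
      using \<mu> \<nu> by blast+
    fix \<phi> :: "(nat \<Rightarrow> real) \<Rightarrow> real" assume \<phi>: "continuous_on UNIV \<phi>"
    show "(\<integral>y. \<phi> y \<partial>distr \<mu> borel J) = (\<integral>y. \<phi> y \<partial>distr \<nu> borel J)"
      using moments_determine_integral[OF e K \<mu> \<nu> eq \<phi>] borel_measurable_continuous_onI[OF \<phi>]
        moment_measure_measurable[OF \<mu> J] moment_measure_measurable[OF \<nu> J]
      by (simp add: integral_distr J_def)
  qed simp_all
  then have distr_eq: "emeasure (distr \<mu> borel J) B = emeasure (distr \<nu> borel J) B" for B by simp
  show ?thesis
  proof (rule measure_eqI)
    show sets: "sets \<mu> = sets \<nu>" using \<mu> \<nu> by (simp add: moment_measure_def)
    fix A assume "A \<in> sets \<mu>"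
    then obtain B where B: "B \<in> sets borel" "A = B \<inter> K"
      using \<mu> by (auto simp: moment_measure_def sets_restrict_space)
    have dB: "decode -` B \<in> sets borel" using measurable_sets[OF decode_measurable B(1)] by simp
    have "J -` (decode -` B) \<inter> K = A" using dec B(2) by auto
    then show "emeasure \<mu> A = emeasure \<nu> A"
      using distr_eq[of "decode -` B"] moment_measure_measurable[OF \<mu> J] moment_measure_measurable[OF \<nu> J]
        moment_measure_space[OF \<mu>] moment_measure_space[OF \<nu>] by (simp add: emeasure_distr[OF _ dB])
  qed
qed

context algebraic_group_action
begin

lemma continuous_move: "continuous_on UNIV (move \<delta> g)"
  unfolding move_def[abs_def]
  by (intro continuous_on_coordinatewise_then_product continuous_on_product_coordinates)

lemma move_measurable:
  assumes "\<And>x. x \<in> K \<Longrightarrow> move \<delta> g x \<in> K"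
  shows "move \<delta> g \<in> measurable (restrict_space borel K) (restrict_space borel K)"
  using assms by (intro measurable_restrict_space2 measurable_restrict_space1
      borel_measurable_continuous_onI continuous_move) (auto simp: space_restrict_space)

end

context compact_algebraic_group
begin

lemma affine_group: "affine_variety TYPE('h)"
  using linear_algebraic_group by (simp add: linear_algebraic_group_def)

text \<open>A translate of the measure representing an invariant state has the same moments, so
  determinacy on G(R) carries invariance over from the functional to the measure.\<close>

theorem haar_measure:
  obtains h \<eta> where "h \<in> states" "\<And>g c. g \<in> real_points \<Longrightarrow> h (act \<Delta> g c) = h c"
    "moment_measure UNIV real_points \<eta>" "\<And>c. h c = (\<integral>g. g c \<partial>\<eta>)"
    "\<And>k. k \<in> real_points \<Longrightarrow> distr \<eta> \<eta> (move \<Delta> k) = \<eta>"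
proof -
  obtain e :: "nat \<Rightarrow> 'h" where "span (range e) = UNIV"
    using countable_spanning_sequence[OF affine_group] by blast
  then interpret compact_algebraic_group_basis \<Delta> \<epsilon> S e by unfold_locales
  obtain h where h: "h \<in> states" "\<And>g c. g \<in> real_points \<Longrightarrow> h (act \<Delta> g c) = h c"
    using invariant_state by blast
  have closed: "basic_closed (real_points :: ('h \<Rightarrow> real) set)"
    unfolding basic_closed_def by (intro exI[of _ "{}"]) simp
  obtain \<eta> where \<eta>: "moment_measure UNIV real_points \<eta>" "\<And>c. h c = (\<integral>g. g c \<partial>\<eta>)"
    using haviland[OF affine_group closed, of h] h(1) by (auto simp: states_def)
  have inv: "distr \<eta> \<eta> (move \<Delta> k) = \<eta>" if k: "k \<in> real_points" for k
  proof -
    have sets: "sets \<eta> = sets (restrict_space borel real_points)" using \<eta>(1) by (simp add: moment_measure_def)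
    have mv: "move \<Delta> k \<in> measurable \<eta> \<eta>"
      using move_measurable[OF move_real_points[OF k]] by (simp add: measurable_cong_sets[OF sets sets])
    have ev: "(\<lambda>g. g c) \<in> borel_measurable \<eta>" for c
      by (rule moment_measure_measurable[OF \<eta>(1) eval_measurable])
    show ?thesis
    proof (rule moment_determinacy[OF affine_group compact_points order_refl _ \<eta>(1)])
      have "integrable \<eta> (\<lambda>g. g (act \<Delta> k c))" for c using \<eta>(1) by (simp add: moment_measure_def)
      then show "moment_measure UNIV real_points (distr \<eta> \<eta> (move \<Delta> k))"
        using sets unfolding moment_measure_def by (simp add: integrable_distr_eq[OF mv ev] move_def)
      show "(\<integral>g. g c \<partial>distr \<eta> \<eta> (move \<Delta> k)) = (\<integral>g. g c \<partial>\<eta>)" for c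
        using h(2)[OF k, of c] by (simp add: integral_distr[OF mv ev] move_def \<eta>(2)[symmetric])
    qed
  qed
  show ?thesis using that[OF h \<eta> inv] .
qed

end

section \<open>Averaging over the group\<close>

lemma functional_separating:
  fixes v :: "'v::real_vector"
  assumes C: "subspace C" and v: "v \<notin> C"
  obtains \<phi> :: "'v \<Rightarrow> real" where "linear \<phi>" "\<And>c. c \<in> C \<Longrightarrow> \<phi> c = 0" "\<phi> v \<noteq> 0"
proof -
  obtain P where P: "linear P" "range P \<subseteq> C" "\<And>x. x \<in> C \<Longrightarrow> P x = x"
    by (rule exists_linear_projection[OF C]) (rule that)
  have "v - P v \<noteq> 0" using P(2) v by auto
  then have "independent {v - P v}" by simp
  then obtain \<psi> :: "'v \<Rightarrow> real" where \<psi>: "linear \<psi>" "\<psi> (v - P v) = 1"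
    using linear_independent_extend[of "{v - P v}" "\<lambda>_. 1 :: real"] by auto
  show ?thesis
  proof (rule that)
    show "linear (\<lambda>x. \<psi> (x - P x))"
      using linear_compose[OF linear_compose_sub[OF linear_id P(1)] \<psi>(1)] by (simp add: o_def)
    show "\<psi> (c - P c) = 0" if "c \<in> C" for c using P(3)[OF that] linear_0[OF \<psi>(1)] by simp
    show "\<psi> (v - P v) \<noteq> 0" using \<psi>(2) by simp
  qed
qed

lemma functional_eqI:
  fixes u v :: "'v::real_vector"
  assumes "\<And>\<phi> :: 'v \<Rightarrow> real. linear \<phi> \<Longrightarrow> \<phi> u = \<phi> v"
  shows "u = v"
proof (rule ccontr)
  assume "u \<noteq> v"
  then have "u - v \<notin> {0}" by simp
  then obtain \<phi> :: "'v \<Rightarrow> real" where "linear \<phi>" "\<And>c. c \<in> {0} \<Longrightarrow> \<phi> c = 0" "\<phi> (u - v) \<noteq> 0"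
    by (rule functional_separating[OF subspace_single_0]) (rule that)
  then show False using assms[of \<phi>] by (simp add: linear_diff)
qed

context algebraic_group_action
begin

lemma linear_act_functional:
  assumes "linear g"
  shows "linear (act \<delta> g)"
proof -
  have "linear \<delta>" using action by (simp add: group_action_def alg_hom_def)
  moreover have "bilinear (\<lambda>c p. g c *\<^sub>R (p :: 'a))" using bilinear_scaleR[OF assms linear_id] by simp
  ultimately show ?thesis
    unfolding act_def[abs_def] using linear_compose[OF _ linear_tensor_lift] by (simp add: o_def)
qed

lemma reynolds_decomposition:
  assumes "reynolds \<delta> \<rho>"
  obtains C u c where "subspace C" "\<forall>g\<in>real_points. act \<delta> g ` C \<subseteq> C" "invariants \<delta> \<inter> C = {0}"
    "f = u + c" "u \<in> invariants \<delta>" "c \<in> C" "\<rho> f = u" "\<And>g. g \<in> real_points \<Longrightarrow> \<rho> (act \<delta> g f) = u"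
proof -
  obtain C where C: "subspace C" "\<forall>g\<in>real_points. act \<delta> g ` C \<subseteq> C" "invariants \<delta> \<inter> C = {0}"
    "{f + c | f c. f \<in> invariants \<delta> \<and> c \<in> C} = UNIV" "linear \<rho>" "\<forall>f\<in>invariants \<delta>. \<rho> f = f" "\<forall>c\<in>C. \<rho> c = 0"
    using assms unfolding reynolds_def by (elim exE conjE)
  have "f \<in> {f + c | f c. f \<in> invariants \<delta> \<and> c \<in> C}" by (simp only: C(4) UNIV_I)
  then obtain u c where u: "f = u + c" "u \<in> invariants \<delta>" "c \<in> C" by blast
  have \<rho>: "\<rho> (u + c') = u" if "c' \<in> C" for c'
    using C(6,7) u(2) that by (simp add: linear_add[OF C(5)])
  have act_eq: "\<rho> (act \<delta> g f) = u" if g: "g \<in> real_points" for g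
  proof -
    have "act \<delta> g f = u + act \<delta> g c"
      using u(1,2) g by (simp add: linear_add[OF linear_act[OF g]] invariants_def)
    moreover have "act \<delta> g c \<in> C" using C(2) g u(3) by blast
    ultimately show ?thesis using \<rho> by simp
  qed
  have "\<rho> f = u" using \<rho>[OF u(3)] u(1) by simp
  from that[OF C(1-3) u this act_eq] show ?thesis .
qed

lemma subspace_invariants: "subspace (invariants \<delta>)"
  unfolding subspace_def invariants_def
  by (auto simp: linear_act linear_0 linear_add linear_scale)

end

section \<open>Averaging of functions and the Reynolds operator\<close>

locale compact_group_action =
  G: compact_algebraic_group \<Delta> \<epsilon> S + algebraic_group_action \<Delta> \<epsilon> S \<delta>
  for \<Delta> :: "'h::real_comm_algebra \<Rightarrow> ('h, 'h) tensor" and \<epsilon> :: "'h \<Rightarrow> real" and S :: "'h \<Rightarrow> 'h"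
    and \<delta> :: "'a::real_comm_algebra \<Rightarrow> ('h, 'a) tensor" +
  fixes h \<eta>
  assumes state: "h \<in> G.states" and invariant: "\<And>g c. g \<in> real_points \<Longrightarrow> h (act \<Delta> g c) = h c"
    and haar: "moment_measure UNIV real_points \<eta>" "\<And>c. h c = (\<integral>g. g c \<partial>\<eta>)"
    "\<And>k. k \<in> real_points \<Longrightarrow> distr \<eta> \<eta> (move \<Delta> k) = \<eta>"
begin

lemma linear_h: "linear h"
  using state by (simp add: G.states_def)

lemma linear_antipode: "linear S"
  using group by (simp add: linear_algebraic_group_def alg_hom_def)

text \<open>\<open>average f\<close> is the weak integral of \<open>k \<mapsto> f\<close> moved by \<open>k\<^sup>-\<^sup>1\<close>.\<close>

definition average :: "'a \<Rightarrow> 'a" where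
  "average = act \<delta> (inverse_point h)"

lemma linear_inverse_h: "linear (inverse_point h)"
  using linear_compose[OF linear_antipode linear_h] by (simp add: inverse_point_def[abs_def] o_def)

lemma linear_average: "linear average"
  unfolding average_def by (rule linear_act_functional[OF linear_inverse_h])

text \<open>The element \<open>S (coefficient \<phi> f)\<close> is the regular function k \<mapsto>
  \<phi>(f^(k^-1)), which \<open>h\<close> integrates. Testing with functionals reduces statements
  about \<open>average\<close> to statements about \<open>h\<close>.\<close>

lemma functional_average:
  fixes \<phi> :: "'a \<Rightarrow> real"
  assumes "linear \<phi>"
  shows "\<phi> (average f) = h (S (coefficient \<phi> f))"
  using eval_coefficient[OF assms linear_inverse_h, of f] by (simp add: average_def inverse_point_def)

lemma eval_antipode_coefficient:
  fixes \<phi> :: "'a \<Rightarrow> real"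
  assumes "linear \<phi>" "k \<in> real_points"
  shows "k (S (coefficient \<phi> f)) = \<phi> (act \<delta> (inverse_point k) f)"
  using eval_coefficient[OF assms(1) real_pointsD(1)[OF inverse_real_point[OF assms(2)]], of f]
  by (simp add: inverse_point_def)

lemma functional_average_const:
  fixes \<phi> :: "'a \<Rightarrow> real"
  assumes "linear \<phi>" "\<And>k. k \<in> real_points \<Longrightarrow> \<phi> (act \<delta> k f) = r"
  shows "\<phi> (average f) = r"
  unfolding functional_average[OF assms(1)]
  by (rule G.state_const[OF state])
    (simp add: eval_antipode_coefficient[OF assms(1)] assms(2) inverse_real_point)

lemma functional_average_nonneg:
  fixes \<phi> :: "'a \<Rightarrow> real"
  assumes "linear \<phi>" "\<And>k. k \<in> real_points \<Longrightarrow> 0 \<le> \<phi> (act \<delta> k f)"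
  shows "0 \<le> \<phi> (average f)"
proof -
  have "0 \<le> k (S (coefficient \<phi> f))" if "k \<in> real_points" for k
    using that assms(2) by (simp add: eval_antipode_coefficient[OF assms(1)] inverse_real_point)
  then show ?thesis
    unfolding functional_average[OF assms(1)] using state by (auto simp: G.states_def)
qed

text \<open>Since f \<mapsto> f^g is a right action, (f^(k^-1))^g = f^((g^-1 k)^-1). The inverse in
  \<open>average\<close> thus turns the action into a left translation of k, under which
  \<open>h\<close> is invariant.\<close>

lemma average_invariant: "average f \<in> invariants \<delta>"
  unfolding invariants_def
proof (intro CollectI ballI, rule functional_eqI)
  fix g :: "'h \<Rightarrow> real" and \<phi> :: "'a \<Rightarrow> real" assume g: "g \<in> real_points" and \<phi>: "linear \<phi>"
  let ?\<psi> = "\<lambda>f. \<phi> (act \<delta> g f)"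
  have \<psi>: "linear ?\<psi>" using linear_compose[OF linear_act[OF g] \<phi>] by (simp add: o_def)
  have key: "k (act \<Delta> g (S (coefficient ?\<psi> f))) = k (S (coefficient \<phi> f))" if k: "k \<in> real_points" for k
  proof -
    have gk: "move \<Delta> g k \<in> real_points" by (rule G.move_real_points[OF g k])
    let ?u = "act \<delta> (inverse_point (move \<Delta> g k)) f"
    have "act \<delta> k (act \<delta> g ?u) = f"
      using act_inverse(1)[OF gk, of f] by (simp add: act_mult[OF action g k])
    then have u: "act \<delta> g ?u = act \<delta> (inverse_point k) f"
      using act_inverse(2)[OF k, of "act \<delta> g ?u"] by simp
    have "k (act \<Delta> g (S (coefficient ?\<psi> f))) = move \<Delta> g k (S (coefficient ?\<psi> f))"
      by (simp add: move_def)
    also have "\<dots> = \<phi> (act \<delta> g ?u)" by (rule eval_antipode_coefficient[OF \<psi> gk])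
    also have "\<dots> = k (S (coefficient \<phi> f))" unfolding u eval_antipode_coefficient[OF \<phi> k] ..
    finally show ?thesis .
  qed
  have "\<phi> (act \<delta> g (average f)) = h (act \<Delta> g (S (coefficient ?\<psi> f)))"
    using functional_average[OF \<psi>, of f] invariant[OF g] by simp
  also have "\<dots> = h (S (coefficient \<phi> f))"
    by (intro antisym G.state_mono[OF state]) (simp_all add: key)
  also have "\<dots> = \<phi> (average f)" by (rule functional_average[OF \<phi>, symmetric])
  finally show "\<phi> (act \<delta> g (average f)) = \<phi> (average f)" .
qed

text \<open>A stable complement \<open>C\<close> is averaged into itself, since functionals
  vanishing on \<open>C\<close> also vanish on averages of its elements; an invariant element of
  \<open>C\<close> is 0. So \<open>average\<close> kills \<open>C\<close> and fixes the invariants,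
  as \<rho> does.\<close>

lemma reynolds_average:
  assumes "reynolds \<delta> \<rho>"
  shows "\<rho> = average"
proof
  fix f
  obtain C u c where C: "subspace C" "\<forall>g\<in>real_points. act \<delta> g ` C \<subseteq> C" "invariants \<delta> \<inter> C = {0}"
    and u: "f = u + c" "u \<in> invariants \<delta>" "c \<in> C" and \<rho>: "\<rho> f = u"
      "\<And>g. g \<in> real_points \<Longrightarrow> \<rho> (act \<delta> g f) = u"
    by (rule reynolds_decomposition[OF assms, of f]) (rule that)
  have "average u = u"
    by (rule functional_eqI, rule functional_average_const) (use u(2) in \<open>auto simp: invariants_def\<close>)
  moreover have "average c = 0"
  proof -
    have "average c \<in> C"
    proof (rule ccontr)
      assume "average c \<notin> C"
      then obtain \<phi> :: "'a \<Rightarrow> real" where \<phi>: "linear \<phi>" "\<And>c. c \<in> C \<Longrightarrow> \<phi> c = 0" "\<phi> (average c) \<noteq> 0"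
        by (rule functional_separating[OF C(1)]) (rule that)
      have "\<phi> (average c) = 0"
        using C(2) u(3) by (intro functional_average_const[OF \<phi>(1)] \<phi>(2)) blast
      with \<phi>(3) show False by simp
    qed
    then show ?thesis using average_invariant[of c] C(3) by blast
  qed
  ultimately show "\<rho> f = average f"
    using \<rho>(1) u(1) by (simp add: linear_add[OF linear_average])
qed

lemma invariant_functional_average:
  fixes L :: "'a \<Rightarrow> real"
  assumes "linear L" "\<forall>g\<in>real_points. \<forall>f. L (act \<delta> g f) = L f"
  shows "L (average f) = L f"
  by (rule functional_average_const) (use assms in blast)+

lemma average_nonneg_on:
  assumes "K \<subseteq> real_points" and inv: "invariant_set \<delta> K" and f: "\<And>x. x \<in> K \<Longrightarrow> 0 \<le> x f" and x: "x \<in> K"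
  shows "0 \<le> x (average f)"
proof (rule functional_average_nonneg)
  show "linear x" using assms(1) x real_pointsD(1) by auto
  show "0 \<le> x (act \<delta> k f)" if "k \<in> real_points" for k
  proof -
    have "move \<delta> k x \<in> K" using inv that x by (auto simp: invariant_set_def)
    from f[OF this] show ?thesis by (simp add: move_def)
  qed
qed

end

section \<open>Averaging of measures\<close>

lemma (in pair_sigma_finite) integrable_product:
  fixes u v :: "_ \<Rightarrow> real"
  assumes u: "integrable M1 u" and v: "integrable M2 v"
  shows "integrable (M1 \<Otimes>\<^sub>M M2) (\<lambda>z. u (fst z) * v (snd z))"
    and "(\<integral>z. u (fst z) * v (snd z) \<partial>(M1 \<Otimes>\<^sub>M M2)) = (\<integral>x. u x \<partial>M1) * (\<integral>y. v y \<partial>M2)"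
proof -
  have [measurable]: "u \<in> borel_measurable M1" "v \<in> borel_measurable M2" using u v by auto
  show int: "integrable (M1 \<Otimes>\<^sub>M M2) (\<lambda>z. u (fst z) * v (snd z))"
  proof (rule Fubini_integrable)
    show "integrable M1 (\<lambda>x. \<integral>y. norm (u (fst (x, y)) * v (snd (x, y))) \<partial>M2)"
      using u by (simp add: abs_mult)
  qed (use v in auto)
  show "(\<integral>z. u (fst z) * v (snd z) \<partial>(M1 \<Otimes>\<^sub>M M2)) = (\<integral>x. u x \<partial>M1) * (\<integral>y. v y \<partial>M2)"
    using integral_fst'[OF int] by simp
qed

context compact_group_action
begin

text \<open>The measure from Haviland's theorem need not be invariant, but the image of \<eta>
  \<otimes> \<mu> under (g, x) \<mapsto> gx is, because k(gx) = (kg)x and \<eta> is left invariant.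
  Its moments are still those of \<open>L\<close> because \<open>L\<close> is invariant.\<close>

lemma averaged_measure:
  assumes V: "affine_variety TYPE('a)" and K: "basic_closed K" and inv: "invariant_set \<delta> K"
    and L: "linear L" "\<And>g f. g \<in> real_points \<Longrightarrow> L (act \<delta> g f) = L f"
    and pos: "\<And>f. (\<And>x. x \<in> K \<Longrightarrow> 0 \<le> x f) \<Longrightarrow> 0 \<le> L f"
  obtains \<mu> where "moment_measure UNIV K \<mu>" "invariant_measure \<delta> \<mu>" "\<And>f. L f = (\<integral>x. x f \<partial>\<mu>)"
proof -
  have "\<exists>\<mu>. moment_measure UNIV K \<mu> \<and> (\<forall>f. L f = (\<integral>x. x f \<partial>\<mu>))"
  proof (rule haviland[OF V K L(1)])
    show "0 \<le> L f" if "\<And>x. x \<in> K \<Longrightarrow> 0 \<le> x f" for f by (rule pos[OF that])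
  qed blast
  then obtain \<mu> where \<mu>: "moment_measure UNIV K \<mu>" "\<And>f. L f = (\<integral>x. x f \<partial>\<mu>)" by blast
  have Kr: "K \<subseteq> real_points" using basic_closed_points[OF K] by blast
  have mvK: "move \<delta> g x \<in> K" if "g \<in> real_points" "x \<in> K" for g x
    using inv that by (auto simp: invariant_set_def)
  obtain e :: "nat \<Rightarrow> 'a" where "span (range e) = UNIV" using countable_spanning_sequence[OF V] by blast
  then interpret spanning_sequence e by unfold_locales
  interpret M: finite_measure \<mu> by (rule moment_measure_finite[OF \<mu>(1) Kr])
  interpret H: finite_measure \<eta> by (rule moment_measure_finite[OF haar(1) order_refl])
  interpret P: pair_sigma_finite \<eta> \<mu> by unfold_locales
  let ?P = "\<eta> \<Otimes>\<^sub>M \<mu>" and ?R = "restrict_space borel K"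
  have sp: "space \<eta> = real_points" "space \<mu> = K"
    using moment_measure_space[OF haar(1)] moment_measure_space[OF \<mu>(1)] .
  have sets_\<mu>: "sets \<mu> = sets ?R" using \<mu>(1) by (simp add: moment_measure_def)
  define \<alpha> where "\<alpha> z = move \<delta> (fst z) (snd z)" for z :: "('h \<Rightarrow> real) \<times> ('a \<Rightarrow> real)"
  \<comment> \<open>The value of \<open>f\<close> at gx is a finite sum of products of a function of
    g and a function of x (\<open>\<alpha>_eq\<close>), so integrability and Fubini reduce to single
    products.\<close>
  have sum_int: "integrable ?P (\<lambda>z. tsum (\<lambda>c p. fst z c * snd z p) xs) \<and>
      (\<integral>z. tsum (\<lambda>c p. fst z c * snd z p) xs \<partial>?P) = tsum (\<lambda>c p. h c * L p) xs" for xs :: "('h \<times> 'a) list"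
  proof (induction xs)
    case (Cons q xs)
    obtain c p where q: "q = (c, p)" by (cases q)
    have "integrable \<eta> (\<lambda>g. g c)" "integrable \<mu> (\<lambda>x. x p)"
      using haar(1) \<mu>(1) by (simp_all add: moment_measure_def)
    from P.integrable_product[OF this] Cons show ?case
      by (simp add: q haar(2) \<mu>(2))
  qed simp
  have \<alpha>_eq: "\<alpha> z f = tsum (\<lambda>c p. fst z c * snd z p) (rep_tensor (\<delta> f))" if "z \<in> space ?P" for z f
  proof -
    have "snd z \<in> real_points" using that Kr by (auto simp: space_pair_measure sp)
    then have lin: "linear (snd z)" by (rule real_pointsD)
    have "\<alpha> z f = tensor_lift (\<lambda>c p. snd z (fst z c *\<^sub>R p)) (\<delta> f)"
      unfolding \<alpha>_def move_def act_def by (rule tensor_lift_linear[OF lin])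
    then show ?thesis by (simp add: linear_scale[OF lin] tensor_lift_def)
  qed
  have \<alpha>_int: "integrable ?P (\<lambda>z. \<alpha> z f)" "(\<integral>z. \<alpha> z f \<partial>?P) = L f" for f
  proof -
    show "integrable ?P (\<lambda>z. \<alpha> z f)"
      using sum_int[of "rep_tensor (\<delta> f)"] by (simp add: \<alpha>_eq cong: Bochner_Integration.integrable_cong)
    have "(\<integral>z. \<alpha> z f \<partial>?P) = tsum (\<lambda>c p. h c * L p) (rep_tensor (\<delta> f))"
      using sum_int[of "rep_tensor (\<delta> f)"] by (simp add: \<alpha>_eq cong: Bochner_Integration.integral_cong)
    \<comment> \<open>The moment is the state \<open>h\<close> at the regular function g \<mapsto>
      L(f^g), which has the constant value L f on G(R).\<close>
    also have "\<dots> = h (coefficient L f)"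
      unfolding coefficient_def tensor_lift_linear[OF linear_h]
      by (simp add: linear_scale[OF linear_h] tensor_lift_def mult.commute)
    also have "\<dots> = L f"
      by (rule G.state_const[OF state]) (simp add: eval_coefficient[OF L(1) real_pointsD(1)] L(2))
    finally show "(\<integral>z. \<alpha> z f \<partial>?P) = L f" .
  qed
  have \<alpha>K: "\<alpha> z \<in> K" if "z \<in> space ?P" for z
    using that mvK by (auto simp: \<alpha>_def space_pair_measure sp)
  have "\<alpha> \<in> borel_measurable ?P"
  proof (rule measurable_functionals)
    show "linear (\<alpha> z)" if "z \<in> space ?P" for z
      using \<alpha>K[OF that] Kr real_pointsD(1) by blast
    show "(\<lambda>z. \<alpha> z (e j)) \<in> borel_measurable ?P" for j
      using \<alpha>_int(1) by (rule borel_measurable_integrable)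
  qed
  then have \<alpha>: "\<alpha> \<in> measurable ?P ?R" using \<alpha>K by (intro measurable_restrict_space2) auto
  have eval: "(\<lambda>x. x f) \<in> borel_measurable ?R" for f :: 'a
    by (intro measurable_restrict_space1 eval_measurable)
  let ?T = "distr ?P ?R \<alpha>"
  have "distr ?T ?T (move \<delta> k) = ?T" if k: "k \<in> real_points" for k
  proof -
    have mk: "move \<delta> k \<in> measurable ?R ?R" by (rule move_measurable[OF mvK[OF k]])
    have mh: "move \<Delta> k \<in> measurable \<eta> \<eta>"
    proof -
      have s: "sets \<eta> = sets (restrict_space borel real_points)"
        using haar(1) by (simp add: moment_measure_def)
      show ?thesis
        using G.move_measurable[OF G.move_real_points[OF k]] by (simp add: measurable_cong_sets[OF s s])
    qed
    let ?\<theta> = "\<lambda>(g, x). (move \<Delta> k g, x)"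
    have P_eq: "distr ?P ?P ?\<theta> = ?P"
    proof -
      have "distr \<eta> \<eta> (move \<Delta> k) \<Otimes>\<^sub>M distr \<mu> \<mu> (\<lambda>x. x) = distr ?P ?P ?\<theta>"
        by (rule pair_measure_distr[OF mh]) (simp_all add: distr_id M.sigma_finite_measure_axioms)
      then show ?thesis by (simp add: haar(3)[OF k] distr_id)
    qed
    have \<theta>: "?\<theta> \<in> measurable ?P ?P" using mh by measurable
    have "distr ?T ?T (move \<delta> k) = distr ?T ?R (move \<delta> k)" by (rule distr_cong) simp_all
    also have "\<dots> = distr ?P ?R (move \<delta> k \<circ> \<alpha>)" by (rule distr_distr[OF mk \<alpha>])
    also have "\<dots> = distr ?P ?R (\<alpha> \<circ> ?\<theta>)"
    proof (rule distr_cong)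
      fix z assume z: "z \<in> space ?P"
      then have "fst z \<in> real_points" by (auto simp: space_pair_measure sp)
      then show "(move \<delta> k \<circ> \<alpha>) z = (\<alpha> \<circ> ?\<theta>) z"
        by (cases z) (simp add: \<alpha>_def move_def[of \<delta>] act_mult[OF action k])
    qed simp_all
    also have "\<dots> = distr (distr ?P ?P ?\<theta>) ?R \<alpha>" by (rule distr_distr[OF \<alpha> \<theta>, symmetric])
    also have "\<dots> = ?T" unfolding P_eq ..
    finally show ?thesis .
  qed
  then have "invariant_measure \<delta> ?T" unfolding invariant_measure_def by blast
  moreover have "moment_measure UNIV K ?T"
    unfolding moment_measure_def using \<alpha>_int(1) by (simp add: integrable_distr_eq[OF \<alpha> eval])
  moreover have "L f = (\<integral>x. x f \<partial>?T)" for f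
    using \<alpha>_int(2) by (simp add: integral_distr[OF \<alpha> eval])
  ultimately show ?thesis using that by blast
qed

end

section \<open>Passage to the quotient and duality of cones\<close>

lemma moment_measure_push_quotient:
  fixes \<delta> :: "'a::real_comm_algebra \<Rightarrow> ('h::real_comm_algebra, 'a) tensor"
  assumes "moment_measure UNIV K \<mu>"
  defines "\<nu> \<equiv> distr \<mu> (restrict_space borel (quotient_map_pts \<delta> ` K)) (quotient_map_pts \<delta>)"
  shows "moment_measure (invariants \<delta>) (quotient_map_pts \<delta> ` K) \<nu>"
    "f \<in> invariants \<delta> \<Longrightarrow> (\<integral>y. y f \<partial>\<nu>) = (\<integral>x. x f \<partial>\<mu>)"
proof -
  let ?R = "restrict_space borel (quotient_map_pts \<delta> ` K)"
  have "continuous_on UNIV (quotient_map_pts \<delta>)"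
  proof (rule continuous_on_coordinatewise_then_product)
    fix f
    \<comment> \<open>A coordinate is an evaluation for invariant \<open>f\<close> and the constant
      \<open>undefined\<close> otherwise.\<close>
    show "continuous_on UNIV (\<lambda>x. quotient_map_pts \<delta> x f)"
      by (cases "f \<in> invariants \<delta>")
        (simp_all add: quotient_map_pts_def continuous_on_product_coordinates)
  qed
  then have "quotient_map_pts \<delta> \<in> borel_measurable borel" by (rule borel_measurable_continuous_onI)
  from moment_measure_measurable[OF assms(1) this]
  have \<pi>: "quotient_map_pts \<delta> \<in> measurable \<mu> ?R"
    using moment_measure_space[OF assms(1)] by (intro measurable_restrict_space2) auto
  have eval: "(\<lambda>y. y f) \<in> borel_measurable ?R" for f :: 'a
    by (intro measurable_restrict_space1 eval_measurable)
  show "moment_measure (invariants \<delta>) (quotient_map_pts \<delta> ` K) \<nu>"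
    using assms(1) unfolding moment_measure_def \<nu>_def
    by (simp add: integrable_distr_eq[OF \<pi> eval]) (simp add: quotient_map_pts_def)
  show "f \<in> invariants \<delta> \<Longrightarrow> (\<integral>y. y f \<partial>\<nu>) = (\<integral>x. x f \<partial>\<mu>)"
    unfolding \<nu>_def by (simp add: integral_distr[OF \<pi> eval]) (simp add: quotient_map_pts_def)
qed

lemma moment_measure_nonneg:
  assumes "moment_measure B K \<mu>" "\<And>y. y \<in> K \<Longrightarrow> 0 \<le> y f"
  shows "0 \<le> (\<integral>y. y f \<partial>\<mu>)"
  using assms moment_measure_space[OF assms(1)] by (intro integral_nonneg_AE) auto

text \<open>The last hypothesis lets functionals separate \<open>P\<close> from the other points of
  \<open>E\<close>, so \<open>P\<close> is its own bipolar in \<open>E\<close>. The closure of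
  \<open>N\<close> is a bipolar too, and bipolars agree exactly if the dual cones do.\<close>

lemma finest_locally_convex_closure_iff_dual:
  fixes N :: "'v::real_vector set"
  assumes E: "subspace E" and N: "N \<subseteq> E" "0 \<in> N"
    "\<And>x y. x \<in> N \<Longrightarrow> y \<in> N \<Longrightarrow> x + y \<in> N" "\<And>r x. r \<ge> 0 \<Longrightarrow> x \<in> N \<Longrightarrow> r *\<^sub>R x \<in> N"
    and P: "P \<subseteq> E" "\<And>v. v \<in> E \<Longrightarrow> v \<notin> P \<Longrightarrow> \<exists>F :: 'v \<Rightarrow> real. linear F \<and> (\<forall>p\<in>P. 0 \<le> F p) \<and> F v < 0"
  shows "finest_locally_convex E closure_of N = P \<longleftrightarrow>
    (\<forall>F :: 'v \<Rightarrow> real. linear F \<longrightarrow> ((\<forall>n\<in>N. 0 \<le> F n) \<longleftrightarrow> (\<forall>p\<in>P. 0 \<le> F p)))"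
  (is "?cl = P \<longleftrightarrow> ?D")
proof -
  have cl: "?cl = {v \<in> E. \<forall>F :: 'v \<Rightarrow> real. linear F \<longrightarrow> (\<forall>n\<in>N. 0 \<le> F n) \<longrightarrow> 0 \<le> F v}"
    by (rule closure_of_cone_finest[OF E N])
  show ?thesis
  proof
    assume eq: "?cl = P"
    have "N \<subseteq> P" unfolding eq[symmetric] cl using N(1) by blast
    moreover have "0 \<le> F p" if "linear F" "\<forall>n\<in>N. 0 \<le> F n" "p \<in> P" for F :: "'v \<Rightarrow> real" and p
      using that unfolding eq[symmetric] cl by blast
    ultimately show ?D by blast
  next
    assume D: ?D
    show "?cl = P"
    proof (intro equalityI subsetI)
      fix v assume v: "v \<in> ?cl"
      show "v \<in> P"
      proof (rule ccontr)
        assume "v \<notin> P"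
        moreover have "v \<in> E" using v unfolding cl by blast
        ultimately obtain F :: "'v \<Rightarrow> real" where F: "linear F" "\<forall>p\<in>P. 0 \<le> F p" "F v < 0"
          using P(2) by blast
        then have "0 \<le> F v" using v D unfolding cl by blast
        with F(3) show False by simp
      qed
    next
      fix v assume "v \<in> P"
      then show "v \<in> ?cl" unfolding cl using P(1) D by blast
    qed
  qed
qed

theorem corollary6p15:
  fixes comul :: "'h::real_comm_algebra \<Rightarrow> ('h, 'h) tensor"
    and counit :: "'h \<Rightarrow> real"
    and antipode :: "'h \<Rightarrow> 'h"
    and coact :: "'a::real_comm_algebra \<Rightarrow> ('h, 'a) tensor"
    and \<rho> :: "'a \<Rightarrow> 'a"
    and K :: "('a \<Rightarrow> real) set"
    and M :: "'a set"
  assumes "linear_algebraic_group comul counit antipode"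
    and "real_points_dense TYPE('h)"
    and "compact (real_points :: ('h \<Rightarrow> real) set)"
    and "affine_variety TYPE('a)"
    and "group_action comul counit coact"
    and "reynolds coact \<rho>"
    and "basic_closed K"
    and "invariant_set coact K"
    and "quadratic_module M"
  shows "(solves_averaged_moment_problem coact K M \<longleftrightarrow>
            finest_locally_convex (invariants coact) closure_of (\<rho> ` M) =
              nonneg_on (invariants coact) (quotient_map_pts coact ` K)) \<and>
         (finest_locally_convex (invariants coact) closure_of (\<rho> ` M) =
              nonneg_on (invariants coact) (quotient_map_pts coact ` K) \<longleftrightarrow>
            solves_moment_problem (invariants coact) (quotient_map_pts coact ` K) (\<rho> ` M))"
proof -
  let ?A = "invariants coact" and ?\<pi> = "quotient_map_pts coact"
  let ?N = "\<rho> ` M" and ?P = "nonneg_on (invariants coact) (quotient_map_pts coact ` K)"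
  let ?D = "\<forall>F :: 'a \<Rightarrow> real. linear F \<longrightarrow> ((\<forall>n\<in>?N. 0 \<le> F n) \<longleftrightarrow> (\<forall>p\<in>?P. 0 \<le> F p))"
  interpret G: compact_algebraic_group comul counit antipode
    using assms(1,3) by unfold_locales
  interpret A: algebraic_group_action comul counit antipode coact
    using assms(1,5) by unfold_locales
  obtain h \<eta> where "h \<in> G.states" "\<And>g c. g \<in> real_points \<Longrightarrow> h (act comul g c) = h c"
    "moment_measure UNIV real_points \<eta>" "\<And>c. h c = (\<integral>g. g c \<partial>\<eta>)"
    "\<And>k. k \<in> real_points \<Longrightarrow> distr \<eta> \<eta> (move comul k) = \<eta>"
    by (rule G.haar_measure) (rule that)
  then interpret compact_group_action comul counit antipode coact h \<eta> by unfold_locales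
  note V = assms(4) and K = assms(7) and K_inv = assms(8) and M = assms(9)
  have \<rho>: "\<rho> = average" by (rule reynolds_average[OF assms(6)])
  have Kr: "K \<subseteq> real_points" using basic_closed_points[OF K] by blast
  have lin_\<rho>: "linear \<rho>" unfolding \<rho> by (rule linear_average)
  have \<rho>_A: "\<rho> f \<in> ?A" for f unfolding \<rho> by (rule average_invariant)
  have \<rho>_id: "\<rho> f = f" if "f \<in> ?A" for f using assms(6) that unfolding reynolds_def by blast
  have \<rho>_act: "\<rho> (act coact g f) = \<rho> f" if g: "g \<in> real_points" for g f
    by (rule A.reynolds_decomposition[OF assms(6), of f]) (simp add: g)
  have P_iff: "f \<in> ?P \<longleftrightarrow> f \<in> ?A \<and> (\<forall>x\<in>K. 0 \<le> x f)" for f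
    by (auto simp: nonneg_on_def quotient_map_pts_def)
  have M_props: "1 \<in> M" "\<And>f f'. f \<in> M \<Longrightarrow> f' \<in> M \<Longrightarrow> f + f' \<in> M" "\<And>a f. f \<in> M \<Longrightarrow> a\<^sup>2 * f \<in> M"
    using M unfolding quadratic_module_def by blast+
  have M_scale: "r *\<^sub>R f \<in> M" if "r \<ge> 0" "f \<in> M" for r f
  proof -
    \<comment> \<open>A nonnegative scalar is a square in the ring, so a quadratic module is a
      convex cone.\<close>
    have "(sqrt r *\<^sub>R 1)\<^sup>2 * f = r *\<^sub>R f" using that(1) by (simp add: power2_eq_square)
    with M_props(3)[OF that(2), of "sqrt r *\<^sub>R 1"] show ?thesis by simp
  qed
  have closure_iff: "finest_locally_convex ?A closure_of ?N = ?P \<longleftrightarrow> ?D"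
  proof (rule finest_locally_convex_closure_iff_dual[OF A.subspace_invariants])
    show "?N \<subseteq> ?A" using \<rho>_A by blast
    have "\<rho> (0 *\<^sub>R 1) \<in> ?N" using M_scale M_props(1) by blast
    then show "0 \<in> ?N" by (simp add: linear_0[OF lin_\<rho>])
    show "x + y \<in> ?N" if xy: "x \<in> ?N" "y \<in> ?N" for x y
    proof -
      obtain m m' where "m \<in> M" "m' \<in> M" "x = \<rho> m" "y = \<rho> m'" using xy by blast
      then show ?thesis using M_props(2) by (auto simp: linear_add[OF lin_\<rho>, symmetric])
    qed
    show "r *\<^sub>R x \<in> ?N" if "r \<ge> 0" "x \<in> ?N" for r x
      using that M_scale by (auto simp: linear_scale[OF lin_\<rho>, symmetric])
    show "?P \<subseteq> ?A" by (auto simp: nonneg_on_def)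
    show "\<exists>F :: 'a \<Rightarrow> real. linear F \<and> (\<forall>p\<in>?P. 0 \<le> F p) \<and> F v < 0" if v: "v \<in> ?A" "v \<notin> ?P" for v
    proof -
      \<comment> \<open>A point of \<open>K\<close> where \<open>v\<close> is negative is itself a
        separating functional.\<close>
      obtain x where x: "x \<in> K" "x v < 0" using v unfolding P_iff by (auto simp: not_le)
      have "linear x" using x(1) Kr real_pointsD(1) by blast
      moreover have "\<forall>p\<in>?P. 0 \<le> x p" using x(1) by (simp add: Ball_def P_iff)
      ultimately show ?thesis using x(2) by blast
    qed
  qed
  have invariant_iff:
    "(\<exists>\<mu>. moment_measure UNIV K \<mu> \<and> invariant_measure coact \<mu> \<and> (\<forall>f. L f = (\<integral>x. x f \<partial>\<mu>))) \<longleftrightarrow>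
      (\<forall>p\<in>?P. 0 \<le> L p)"
    if L: "linear L" "\<forall>g\<in>real_points. \<forall>f. L (act coact g f) = L f" for L :: "'a \<Rightarrow> real"
  proof
    assume "\<exists>\<mu>. moment_measure UNIV K \<mu> \<and> invariant_measure coact \<mu> \<and> (\<forall>f. L f = (\<integral>x. x f \<partial>\<mu>))"
    then obtain \<mu> where \<mu>: "moment_measure UNIV K \<mu>" "\<forall>f. L f = (\<integral>x. x f \<partial>\<mu>)" by blast
    show "\<forall>p\<in>?P. 0 \<le> L p"
    proof
      fix p assume "p \<in> ?P"
      then have "0 \<le> (\<integral>x. x p \<partial>\<mu>)" unfolding P_iff by (intro moment_measure_nonneg[OF \<mu>(1)]) blast
      with \<mu>(2) show "0 \<le> L p" by simp
    qed
  next
    assume P: "\<forall>p\<in>?P. 0 \<le> L p"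
    have pos: "0 \<le> L f" if f: "\<And>x. x \<in> K \<Longrightarrow> 0 \<le> x f" for f
    proof -
      \<comment> \<open>A function that is nonnegative on \<open>K\<close> averages to an element of
        ?P, so positivity on invariants suffices for Haviland's theorem.\<close>
      have "0 \<le> x (average f)" if x: "x \<in> K" for x
        using Kr K_inv f x by (rule average_nonneg_on)
      then have "average f \<in> ?P" unfolding P_iff using average_invariant by blast
      with P have "0 \<le> L (average f)" by blast
      with invariant_functional_average[OF L, of f] show ?thesis by simp
    qed
    have act: "L (act coact g f) = L f" if "g \<in> real_points" for g f using L(2) that by blast
    show "\<exists>\<mu>. moment_measure UNIV K \<mu> \<and> invariant_measure coact \<mu> \<and> (\<forall>f. L f = (\<integral>x. x f \<partial>\<mu>))"
      by (rule averaged_measure[OF V K K_inv L(1) act pos]) blast+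
  qed
  \<comment> \<open>\<open>F\<close> is constrained only on the invariants; composing with \<rho>
    gives a functional that is linear on the whole ring and has the same values on the
    invariants.\<close>
  have lin_comp: "linear (\<lambda>f. F (\<rho> f))" if F: "linear_functional_on ?A F" for F :: "'a \<Rightarrow> real"
    using F \<rho>_A unfolding linear_functional_on_def
    by (intro linearI) (simp_all add: linear_add[OF lin_\<rho>] linear_scale[OF lin_\<rho>])
  have lin_on: "linear_functional_on ?A F" if "linear F" for F :: "'a \<Rightarrow> real"
    using that by (simp add: linear_functional_on_def linear_add linear_scale)
  have comp_N: "(\<forall>n\<in>?N. 0 \<le> F (\<rho> n)) \<longleftrightarrow> (\<forall>n\<in>?N. 0 \<le> F n)" for F :: "'a \<Rightarrow> real"
    by (simp add: \<rho>_id[OF \<rho>_A])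
  have comp_P: "(\<forall>p\<in>?P. 0 \<le> F (\<rho> p)) \<longleftrightarrow> (\<forall>p\<in>?P. 0 \<le> F p)" for F :: "'a \<Rightarrow> real"
    by (rule ball_cong) (simp_all add: P_iff \<rho>_id)
  have averaged_iff: "solves_averaged_moment_problem coact K M \<longleftrightarrow> ?D"
  proof
    assume solves: "solves_averaged_moment_problem coact K M"
    show ?D
    proof (intro allI impI)
      fix F :: "'a \<Rightarrow> real" assume "linear F"
      \<comment> \<open>\<open>F\<close> need not be invariant, but its composition with \<rho> is,
        and it takes the same values on ?N and ?P.\<close>
      then have lin: "linear (\<lambda>f. F (\<rho> f))" by (intro lin_comp lin_on)
      have inv: "\<forall>g\<in>real_points. \<forall>f. F (\<rho> (act coact g f)) = F (\<rho> f)" by (simp add: \<rho>_act)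
      have "(\<forall>p\<in>?P. 0 \<le> F (\<rho> p)) \<longleftrightarrow> (\<forall>f\<in>M. 0 \<le> F (\<rho> f))"
        using solves lin inv invariant_iff[OF lin inv] unfolding solves_averaged_moment_problem_def by blast
      then show "(\<forall>n\<in>?N. 0 \<le> F n) \<longleftrightarrow> (\<forall>p\<in>?P. 0 \<le> F p)" unfolding comp_P by blast
    qed
  next
    assume D: ?D
    show "solves_averaged_moment_problem coact K M"
      unfolding solves_averaged_moment_problem_def
    proof (intro allI impI)
      fix L :: "'a \<Rightarrow> real"
      assume L: "linear L \<and> (\<forall>g\<in>real_points. \<forall>f. L (act coact g f) = L f)"
      \<comment> \<open>An invariant functional does not change under averaging, so its sign on
        \<open>M\<close> can be read off on ?N.\<close>
      have "L (\<rho> f) = L f" for f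
        unfolding \<rho> using L by (intro invariant_functional_average) blast+
      then have "(\<forall>f\<in>M. 0 \<le> L f) \<longleftrightarrow> (\<forall>n\<in>?N. 0 \<le> L n)" by simp
      then show "(\<exists>\<mu>. moment_measure UNIV K \<mu> \<and> invariant_measure coact \<mu> \<and> (\<forall>f. L f = (\<integral>x. x f \<partial>\<mu>)))
          \<longleftrightarrow> (\<forall>f\<in>M. 0 \<le> L f)"
        using invariant_iff[of L] L D by blast
    qed
  qed
  have quotient_iff:
    "(\<exists>\<nu>. moment_measure ?A (?\<pi> ` K) \<nu> \<and> (\<forall>f\<in>?A. F f = (\<integral>y. y f \<partial>\<nu>))) \<longleftrightarrow> (\<forall>p\<in>?P. 0 \<le> F p)"
    if F: "linear_functional_on ?A F" for F :: "'a \<Rightarrow> real"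
  proof
    assume "\<exists>\<nu>. moment_measure ?A (?\<pi> ` K) \<nu> \<and> (\<forall>f\<in>?A. F f = (\<integral>y. y f \<partial>\<nu>))"
    then obtain \<nu> where \<nu>: "moment_measure ?A (?\<pi> ` K) \<nu>" "\<forall>f\<in>?A. F f = (\<integral>y. y f \<partial>\<nu>)" by blast
    show "\<forall>p\<in>?P. 0 \<le> F p"
    proof
      fix p assume p: "p \<in> ?P"
      then have "0 \<le> (\<integral>y. y p \<partial>\<nu>)"
        by (intro moment_measure_nonneg[OF \<nu>(1)]) (auto simp: nonneg_on_def)
      with \<nu>(2) p show "0 \<le> F p" by (simp add: nonneg_on_def)
    qed
  next
    assume "\<forall>p\<in>?P. 0 \<le> F p"
    then have P: "\<forall>p\<in>?P. 0 \<le> F (\<rho> p)" unfolding comp_P .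
    have inv: "\<forall>g\<in>real_points. \<forall>f. F (\<rho> (act coact g f)) = F (\<rho> f)" by (simp add: \<rho>_act)
    obtain \<mu> where \<mu>: "moment_measure UNIV K \<mu>" "\<forall>f. F (\<rho> f) = (\<integral>x. x f \<partial>\<mu>)"
      using invariant_iff[OF lin_comp[OF F] inv] P by blast
    let ?\<nu> = "distr \<mu> (restrict_space borel (?\<pi> ` K)) ?\<pi>"
    have "F f = (\<integral>y. y f \<partial>?\<nu>)" if f: "f \<in> ?A" for f
      using moment_measure_push_quotient(2)[OF \<mu>(1) f] spec[OF \<mu>(2), of f]
      unfolding \<rho>_id[OF f] by simp
    then show "\<exists>\<nu>. moment_measure ?A (?\<pi> ` K) \<nu> \<and> (\<forall>f\<in>?A. F f = (\<integral>y. y f \<partial>\<nu>))"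
      using moment_measure_push_quotient(1)[OF \<mu>(1), of coact] by (intro exI[of _ ?\<nu>]) simp
  qed
  have moment_iff: "solves_moment_problem ?A (?\<pi> ` K) ?N \<longleftrightarrow> ?D"
  proof
    assume solves: "solves_moment_problem ?A (?\<pi> ` K) ?N"
    show ?D
    proof (intro allI impI)
      fix F :: "'a \<Rightarrow> real" assume "linear F"
      then have F: "linear_functional_on ?A F" by (rule lin_on)
      with solves show "(\<forall>n\<in>?N. 0 \<le> F n) \<longleftrightarrow> (\<forall>p\<in>?P. 0 \<le> F p)"
        unfolding solves_moment_problem_def quotient_iff[OF F, symmetric] by (elim allE[of _ F] impE)
    qed
  next
    assume D: ?D
    show "solves_moment_problem ?A (?\<pi> ` K) ?N"
      unfolding solves_moment_problem_def
    proof (intro allI impI)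
      fix F :: "'a \<Rightarrow> real" assume F: "linear_functional_on ?A F"
      have "(\<forall>n\<in>?N. 0 \<le> F (\<rho> n)) \<longleftrightarrow> (\<forall>p\<in>?P. 0 \<le> F (\<rho> p))"
        using D lin_comp[OF F] by blast
      then show "(\<forall>f\<in>?N. 0 \<le> F f) \<longleftrightarrow>
          (\<exists>\<nu>. moment_measure ?A (?\<pi> ` K) \<nu> \<and> (\<forall>f\<in>?A. F f = (\<integral>y. y f \<partial>\<nu>)))"
        unfolding comp_N comp_P quotient_iff[OF F] .
    qed
  qed
  show ?thesis unfolding closure_iff averaged_iff moment_iff by simp
qed

end
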